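(* Let $0\le k<n$ be integers, let $0\le\alpha\le k$ and $r\ge 0$ be real numbers, let $\emptyset\ne C\subset\mathbb{R}^n$, and let $B\subset\mathbb{R}^n$ be such that for every $x\in C$ there exists a $k$-dimensional affine subspace $P$ of $\mathbb{R}^n$ at distance $r$ from $x$ such that $P\cap B$ is nonempty and $\dim(P\cap B)\ge\alpha$. Then $$\dim B\ge 2\alpha-k+\dim C-(n-1).$$ In particular, for integers $0\le k<n$ and $B\subset\mathbb{R}^n$: if there is a fixed $r>0$ such that for every $x\in\mathbb{R}^n$ the set $B$ contains a $k$-dimensional affine subspace at distance $r$ from $x$, or if for every $x\in\mathbb{R}^n$ the set $B$ contains the $k$-skeleton of a rotated unit cube centered at $x$, then $\dim B\ge k+1$.
   Context: $\dim$ denotes Hausdorff dimension. A $0$-dimensional affine subspace is a single point. The distance of $P$ from $x$ is the Euclidean distance $\inf_{p\in P}|x-p|$. A rotated unit cube centered at $x$ is a set $x+T([-1/2,1/2]^n)$ with $T\in SO(n)$; its $k$-skeleton is the union of its $k$-dimensional faces. *)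

theory Defs
  imports "HOL-Analysis.Analysis"
begin

text \<open>
  The value \<open>(diam U)\<^sup>s\<close> with the usual conventions that the empty set contributes 0 and that
  \<open>0\<^sup>0 = 1\<close>; the case \<open>s = 0\<close> is separate because \<^term>\<open>0 powr 0 = (0::real)\<close> holds.
\<close>

definition diam_powr :: "real \<Rightarrow> 'a::metric_space set \<Rightarrow> real" where
  "diam_powr s U = (if U = {} then 0 else if s = 0 then 1 else diameter U powr s)"

text \<open>
  The covering sets are required to be bounded, since \<^const>\<open>diameter\<close> is real-valued and
  unspecified on unbounded sets.  Finite covers are included by taking almost all sets empty.
\<close>

definition hausdorff_premeasure :: "real \<Rightarrow> real \<Rightarrow> 'a::metric_space set \<Rightarrow> ennreal" where
  "hausdorff_premeasure s \<delta> A =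
     (INF U \<in> {U :: nat \<Rightarrow> 'a set. A \<subseteq> (\<Union>i. U i) \<and> (\<forall>i. bounded (U i) \<and> diameter (U i) \<le> \<delta>)}.
        (\<Sum>i. ennreal (diam_powr s (U i))))"

definition hausdorff_measure :: "real \<Rightarrow> 'a::metric_space set \<Rightarrow> ennreal" where
  "hausdorff_measure s A = (SUP \<delta> \<in> {0<..}. hausdorff_premeasure s \<delta> A)"

definition hausdorff_dim :: "'a::metric_space set \<Rightarrow> ereal" where
  "hausdorff_dim A = (INF s \<in> {s. 0 \<le> s \<and> hausdorff_measure s A = 0}. ereal s)"

definition affine_subspace_dim :: "nat \<Rightarrow> 'a::euclidean_space set \<Rightarrow> bool" where
  "affine_subspace_dim k P \<longleftrightarrow> affine P \<and> aff_dim P = int k"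

definition rotated_unit_cube :: "real ^ 'n \<Rightarrow> (real ^ 'n) set \<Rightarrow> bool" where
  "rotated_unit_cube x Q \<longleftrightarrow>
     (\<exists>T :: real ^ 'n ^ 'n. rotation_matrix T \<and>
        Q = (\<lambda>y. x + T *v y) ` cbox (\<chi> i. - 1 / 2) (\<chi> i. 1 / 2))"

definition skeleton :: "nat \<Rightarrow> 'a::euclidean_space set \<Rightarrow> 'a set" where
  "skeleton k Q = \<Union> {F. F face_of Q \<and> aff_dim F = int k}"

end

theory Submission
  imports Defs
begin

text \<open>
The sets considered here are arbitrary, so everything is expressed through null sets of Hausdorff
content, which for every exponent are those of Hausdorff measure (hausdorff_measure_eq_0_iff).  A
\<open>k\<close>-plane is written as a graph over \<open>k\<close> of the coordinates and thereby becomes a point \<open>\<theta>\<close> of a Euclidean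
space.  With \<open>n\<close> the dimension of the ambient space, the dimension formula is the sum of two estimates.

Centres.  The points at distance \<open>r\<close> from one plane form a hypersurface, and nearby planes have nearby
hypersurfaces: a family of planes whose parameters lie in a set of diameter \<open>\<rho>\<close> serves only centres in
a tube of width \<open>O(\<rho>)\<close>, which is covered by \<open>O(\<rho> powr (1 - n))\<close> sets of diameter \<open>O(\<rho>)\<close>.  Hence a \<open>\<tau>\<close>-null
set of parameters serves a \<open>(\<tau> + n - 1)\<close>-null set of centres (hausdorff_content_points_at_distance).

Slices.  Let \<open>B\<close> be \<open>s\<close>-null, \<open>0 < \<tau> \<le> 1\<close> and \<open>s < 2 * a + \<tau> - k\<close>.  Then the planes that meet \<open>B\<close> in a set
of positive \<open>a'\<close>-content, for some fixed \<open>a' > a\<close>, have a \<open>\<tau>\<close>-null set of parameters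
(large_slice_params_null).  The proof is a second moment argument.  Cover \<open>B\<close> by dyadic cells, about
\<open>2 powr (l * s)\<close> of side \<open>(1/2) ^ l\<close> for each \<open>l\<close>, in such a way that every point of \<open>B\<close> is covered infinitely
often.  A plane with a large slice meets \<open>2 powr (l * a)\<close> of these cells for infinitely many \<open>l\<close>.  Two
planes whose parameters have distance \<open>D \<ge> (1/2) ^ l\<close> share, in a bounded region, only
\<open>O(2 ^ (l * (k - 1)) / D)\<close> cells, because they are close to each other only near a \<open>(k - 1)\<close>-plane (card_common_cells_le).  If the planes that are rich at
level \<open>l\<close> carried a \<open>\<tau>\<close>-dimensional weight of total mass \<open>W\<close>, then Cauchy--Schwarz would give
\<open>W * 2 powr (2 * l * a) \<le> O(2 powr (l * s) * l * 2 powr (l * (k - \<tau>)))\<close>.  So the contents of the sets of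
rich parameters are summable over \<open>l\<close>, and the planes that are rich infinitely often form a null set.

For a set of centres of dimension greater than \<open>n - 1\<close> the two estimates combine to the first claim;
below that, monotonicity of the dimension suffices because \<open>\<alpha> \<le> k\<close>.  For the second claim take all points
as centres: the dimension of a convex set is at least its affine dimension, and the corresponding
\<open>k\<close>-faces of rotated unit cubes span planes at the same distance from the centres of the cubes.
\<close>

section \<open>Null sets of Hausdorff content\<close>

lemma diam_powr_nonneg: "0 \<le> diam_powr s U"
  by (simp add: diam_powr_def)

lemma diam_powr_empty [simp]: "diam_powr s {} = 0"
  by (simp add: diam_powr_def)

lemma diam_powr_le:
  assumes "diameter U \<le> d" "0 < d" "0 \<le> s" "bounded U"
  shows "diam_powr s U \<le> d powr s"
  using assms by (auto simp: diam_powr_def intro!: powr_mono2 diameter_ge_0)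

definition hausdorff_content :: "real \<Rightarrow> 'a::metric_space set \<Rightarrow> ennreal" where
  "hausdorff_content s A =
     (INF U \<in> {U :: nat \<Rightarrow> 'a set. A \<subseteq> (\<Union>i. U i) \<and> (\<forall>i. bounded (U i))}.
        (\<Sum>i. ennreal (diam_powr s (U i))))"

lemma hausdorff_content_le_premeasure:
  "hausdorff_content s A \<le> hausdorff_premeasure s \<delta> A"
  unfolding hausdorff_content_def hausdorff_premeasure_def
  by (rule INF_superset_mono) auto

lemma hausdorff_content_lessD:
  assumes "hausdorff_content s A < e"
  shows "\<exists>U. A \<subseteq> (\<Union>i. U i) \<and> (\<forall>i::nat. bounded (U i)) \<and>
    (\<Sum>i. ennreal (diam_powr s (U i))) < e"
  using assms unfolding hausdorff_content_def INF_less_iff by auto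

lemma hausdorff_content_le_suminf:
  assumes "A \<subseteq> (\<Union>i::nat. U i)" "\<And>i. bounded (U i)"
  shows "hausdorff_content s A \<le> (\<Sum>i. ennreal (diam_powr s (U i)))"
  unfolding hausdorff_content_def using assms by (intro INF_lower) auto

text \<open>
Content puts no bound on the diameters of a cover, and so it needs no limit; a cover of small total
size has small diameters automatically.
\<close>

lemma hausdorff_measure_eq_0_iff:
  fixes A :: "'a::metric_space set"
  assumes "0 \<le> s"
  shows "hausdorff_measure s A = 0 \<longleftrightarrow> hausdorff_content s A = 0"
proof
  assume "hausdorff_measure s A = 0"
  moreover have "hausdorff_premeasure s 1 A \<le> hausdorff_measure s A"
    unfolding hausdorff_measure_def by (rule SUP_upper) auto
  ultimately show "hausdorff_content s A = 0"
    using hausdorff_content_le_premeasure[of s A 1] by auto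
next
  assume 0: "hausdorff_content s A = 0"
  have "hausdorff_premeasure s \<delta> A = 0" if "\<delta> > 0" for \<delta>
  proof -
    have "hausdorff_premeasure s \<delta> A \<le> ennreal e" if "e > 0" for e
    proof -
      \<comment> \<open>A total below \<open>\<delta> powr s\<close> forces every covering set to have diameter at most \<open>\<delta>\<close>.\<close>
      have "hausdorff_content s A < ennreal (min e (\<delta> powr s))"
        using 0 \<open>e > 0\<close> \<open>\<delta> > 0\<close> by simp
      then obtain U where U: "A \<subseteq> (\<Union>i. U i)" "\<And>i::nat. bounded (U i)"
        and sum: "(\<Sum>i. ennreal (diam_powr s (U i))) < ennreal (min e (\<delta> powr s))"
        using hausdorff_content_lessD by blast
      have "diameter (U i) \<le> \<delta>" for i
      proof (rule ccontr)
        assume *: "\<not> diameter (U i) \<le> \<delta>"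
        then have "U i \<noteq> {}" using \<open>\<delta> > 0\<close> by auto
        have "\<delta> powr s \<le> diam_powr s (U i)"
          using * \<open>\<delta> > 0\<close> \<open>0 \<le> s\<close> \<open>U i \<noteq> {}\<close> by (auto simp: diam_powr_def intro: powr_mono2)
        moreover have "ennreal (diam_powr s (U i)) < ennreal (min e (\<delta> powr s))"
          using sum by (rule ennreal_suminf_lessD)
        ultimately show False
          by (simp add: ennreal_less_iff diam_powr_nonneg)
      qed
      then have "hausdorff_premeasure s \<delta> A \<le> (\<Sum>i. ennreal (diam_powr s (U i)))"
        unfolding hausdorff_premeasure_def using U by (intro INF_lower) auto
      also have "\<dots> \<le> ennreal e"
        using sum by (metis ennreal_leI less_imp_le min.cobounded1 order.trans)
      finally show ?thesis .
    qed
    then show ?thesis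
      by (metis ennreal_le_epsilon add.left_neutral le_zero_eq)
  qed
  then show "hausdorff_measure s A = 0"
    unfolding hausdorff_measure_def by (auto intro!: antisym SUP_least)
qed

lemma hausdorff_content_mono:
  "A \<subseteq> B \<Longrightarrow> hausdorff_content s A \<le> hausdorff_content s B"
  unfolding hausdorff_content_def by (rule INF_superset_mono) auto

lemma hausdorff_content_le_diam_powr:
  assumes "bounded U"
  shows "hausdorff_content s U \<le> ennreal (diam_powr s U)"
proof -
  have "hausdorff_content s U \<le> (\<Sum>i. ennreal (diam_powr s (if i = (0::nat) then U else {})))"
    using assms by (intro hausdorff_content_le_suminf) auto
  also have "\<dots> = ennreal (diam_powr s U)"
    by (subst suminf_finite[of "{0}"]) auto
  finally show ?thesis .
qed

lemma hausdorff_content_UN_le: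
  fixes A :: "nat \<Rightarrow> 'a::metric_space set"
  shows "hausdorff_content s (\<Union>i. A i) \<le> (\<Sum>i. hausdorff_content s (A i))"
proof (cases "(\<Sum>i. hausdorff_content s (A i)) = top")
  case True then show ?thesis by simp
next
  case False
  then have fin: "hausdorff_content s (A i) < top" for i
    using ennreal_suminf_lessD[of "\<lambda>i. hausdorff_content s (A i)" top] by (auto simp: less_top)
  show ?thesis
  proof (rule ennreal_le_epsilon)
    fix e :: real assume "0 < e"
    have "\<exists>U. A i \<subseteq> (\<Union>j. U j) \<and> (\<forall>j::nat. bounded (U j)) \<and>
            (\<Sum>j. ennreal (diam_powr s (U j))) \<le> hausdorff_content s (A i) + ennreal (e * (1/2) ^ Suc i)" for i
    proof -
      have "hausdorff_content s (A i) < hausdorff_content s (A i) + ennreal (e * (1/2) ^ Suc i)"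
        using fin[of i] \<open>0 < e\<close> ennreal_add_left_cancel_less[of "hausdorff_content s (A i)" 0 "ennreal (e * (1/2) ^ Suc i)"]
        by (simp add: less_top)
      from hausdorff_content_lessD[OF this] show ?thesis
        by (meson less_imp_le)
    qed
    then obtain U where U: "\<And>i. A i \<subseteq> (\<Union>j. U i j)" "\<And>i j::nat. bounded (U i j)"
      and le: "\<And>i. (\<Sum>j. ennreal (diam_powr s (U i j))) \<le> hausdorff_content s (A i) + ennreal (e * (1/2) ^ Suc i)"
      by metis
    let ?V = "\<lambda>p. case prod_decode p of (i, j) \<Rightarrow> U i j"
    have cover: "(\<Union>i. A i) \<subseteq> (\<Union>p. ?V p)"
    proof
      fix x assume "x \<in> (\<Union>i. A i)"
      then obtain i j where "x \<in> U i j" using U(1) by blast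
      then have "x \<in> ?V (prod_encode (i, j))" by simp
      then show "x \<in> (\<Union>p. ?V p)" by (rule UN_I[OF UNIV_I])
    qed
    have bdd: "bounded (?V p)" for p using U(2) by (simp split: prod.split)
    have "hausdorff_content s (\<Union>i. A i) \<le> (\<Sum>p. ennreal (diam_powr s (?V p)))"
      by (rule hausdorff_content_le_suminf[OF cover bdd])
    also have "\<dots> = (\<Sum>p. (\<lambda>(i, j). ennreal (diam_powr s (U i j))) (prod_decode p))"
      by (intro arg_cong[where f = suminf] ext) (auto split: prod.split)
    also have "\<dots> = (\<Sum>i. \<Sum>j. ennreal (diam_powr s (U i j)))"
      by (rule suminf_ennreal_2dimen) auto
    also have "\<dots> \<le> (\<Sum>i. hausdorff_content s (A i) + ennreal (e * (1/2) ^ Suc i))"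
      by (intro suminf_le le) auto
    also have "\<dots> = (\<Sum>i. hausdorff_content s (A i)) + (\<Sum>i. ennreal (e * (1/2) ^ Suc i))"
      by (rule suminf_add[symmetric]) auto
    also have "(\<Sum>i. ennreal (e * (1/2) ^ Suc i)) = ennreal e"
      using \<open>0 < e\<close> sums_mult[OF power_half_series, of e]
      by (intro suminf_ennreal_eq) auto
    finally show "hausdorff_content s (\<Union>i. A i) \<le> (\<Sum>i. hausdorff_content s (A i)) + ennreal e" .
  qed
qed

lemma hausdorff_content_empty [simp]: "hausdorff_content s {} = 0"
  using hausdorff_content_le_diam_powr[of "{}" s] by simp

lemma hausdorff_content_finite_UN_le:
  assumes "finite I"
  shows "hausdorff_content s (\<Union>i\<in>I. A i) \<le> (\<Sum>i\<in>I. hausdorff_content s (A i))"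
proof -
  obtain f where f: "bij_betw f {0..<card I} I"
    using assms ex_bij_betw_nat_finite by blast
  let ?B = "\<lambda>j. if j < card I then A (f j) else {}"
  have "(\<Union>i\<in>I. A i) \<subseteq> (\<Union>j. ?B j)"
  proof
    fix x assume "x \<in> (\<Union>i\<in>I. A i)"
    then obtain i where "i \<in> I" "x \<in> A i" by blast
    moreover have "i \<in> f ` {0..<card I}"
      using \<open>i \<in> I\<close> bij_betw_imp_surj_on[OF f] by simp
    then obtain j where "j < card I" "i = f j" by auto
    ultimately have "x \<in> ?B j" by simp
    then show "x \<in> (\<Union>j. ?B j)" by (rule UN_I[OF UNIV_I])
  qed
  then have "hausdorff_content s (\<Union>i\<in>I. A i) \<le> hausdorff_content s (\<Union>j. ?B j)"
    by (rule hausdorff_content_mono)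
  also have "\<dots> \<le> (\<Sum>j. hausdorff_content s (?B j))"
    by (rule hausdorff_content_UN_le)
  also have "\<dots> = (\<Sum>j\<in>{0..<card I}. hausdorff_content s (?B j))"
    by (rule suminf_finite) auto
  also have "\<dots> = (\<Sum>j\<in>{0..<card I}. hausdorff_content s (A (f j)))"
    by (rule sum.cong) auto
  also have "\<dots> = (\<Sum>i\<in>I. hausdorff_content s (A i))"
    by (rule sum.reindex_bij_betw[OF f])
  finally show ?thesis .
qed

lemma hausdorff_content_UN_eq_0:
  fixes A :: "'i \<Rightarrow> 'a::metric_space set"
  assumes "countable I" "\<And>i. i \<in> I \<Longrightarrow> hausdorff_content s (A i) = 0"
  shows "hausdorff_content s (\<Union>i\<in>I. A i) = 0"
proof (cases "I = {}")
  case False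
  have "(\<Union>n. A (from_nat_into I n)) = (\<Union>i\<in>range (from_nat_into I). A i)" by simp
  then have "(\<Union>i\<in>I. A i) = (\<Union>n. A (from_nat_into I n))"
    using range_from_nat_into[OF False assms(1)] by simp
  moreover have "hausdorff_content s (\<Union>n. A (from_nat_into I n))
      \<le> (\<Sum>n. hausdorff_content s (A (from_nat_into I n)))"
    by (rule hausdorff_content_UN_le)
  ultimately show ?thesis
    using assms(2) from_nat_into[OF False] by simp
qed simp

text \<open>
The Borel--Cantelli lemma: the tail of a convergent series of covers still covers every point that is
covered infinitely often.
\<close>

lemma hausdorff_content_limsup_eq_0:
  fixes V :: "nat \<Rightarrow> 'i \<Rightarrow> 'a::metric_space set"
  assumes fin: "\<And>l. finite (T l)"
    and bdd: "\<And>l i. i \<in> T l \<Longrightarrow> bounded (V l i)"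
    and le: "\<And>l. (\<Sum>i\<in>T l. diam_powr s (V l i)) \<le> b l"
    and "summable b"
    and lim: "\<And>x. x \<in> A \<Longrightarrow> \<exists>\<^sub>\<infinity>l. \<exists>i\<in>T l. x \<in> V l i"
  shows "hausdorff_content s A = 0"
proof -
  have b0: "0 \<le> b l" for l
    using le[of l] sum_nonneg[of "T l" "\<lambda>i. diam_powr s (V l i)"] diam_powr_nonneg by (metis order.trans)
  have tail: "hausdorff_content s A \<le> ennreal (\<Sum>l. b (l + L))" for L
  proof -
    have "A \<subseteq> (\<Union>l. \<Union>i\<in>T (l + L). V (l + L) i)"
    proof
      fix x assume "x \<in> A"
      then obtain l where "l \<ge> L" "\<exists>i\<in>T l. x \<in> V l i"
        using lim unfolding INFM_nat_le by blast
      then show "x \<in> (\<Union>l. \<Union>i\<in>T (l + L). V (l + L) i)"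
        by (metis UN_iff UNIV_I le_add_diff_inverse2)
    qed
    then have "hausdorff_content s A \<le> hausdorff_content s (\<Union>l. \<Union>i\<in>T (l + L). V (l + L) i)"
      by (rule hausdorff_content_mono)
    also have "\<dots> \<le> (\<Sum>l. hausdorff_content s (\<Union>i\<in>T (l + L). V (l + L) i))"
      by (rule hausdorff_content_UN_le)
    also have "\<dots> \<le> (\<Sum>l. ennreal (b (l + L)))"
    proof (rule suminf_le)
      fix l
      have "hausdorff_content s (\<Union>i\<in>T (l + L). V (l + L) i)
          \<le> (\<Sum>i\<in>T (l + L). hausdorff_content s (V (l + L) i))"
        by (rule hausdorff_content_finite_UN_le[OF fin])
      also have "\<dots> \<le> (\<Sum>i\<in>T (l + L). ennreal (diam_powr s (V (l + L) i)))"
        by (intro sum_mono hausdorff_content_le_diam_powr bdd)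
      also have "\<dots> = ennreal (\<Sum>i\<in>T (l + L). diam_powr s (V (l + L) i))"
        by (simp add: diam_powr_nonneg)
      also have "\<dots> \<le> ennreal (b (l + L))"
        using le by (rule ennreal_leI)
      finally show "hausdorff_content s (\<Union>i\<in>T (l + L). V (l + L) i) \<le> ennreal (b (l + L))" .
    qed auto
    also have "\<dots> = ennreal (\<Sum>l. b (l + L))"
      using b0 \<open>summable b\<close> by (intro suminf_ennreal2) (auto simp: summable_iff_shift)
    finally show ?thesis .
  qed
  have "(\<lambda>L. \<Sum>l. b (l + L)) \<longlonglongrightarrow> 0"
    by (rule suminf_exist_split2[OF \<open>summable b\<close>])
  then have "(\<lambda>L. ennreal (\<Sum>l. b (l + L))) \<longlonglongrightarrow> ennreal 0"
    by (rule tendsto_ennrealI)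
  then have "hausdorff_content s A \<le> ennreal 0"
    by (rule LIMSEQ_le_const) (use tail in auto)
  then show ?thesis by simp
qed

text \<open>
The error term \<open>\<eta>\<close> is there for \<open>d = 0\<close>, where no power of two is comparable to \<open>d\<close>.
\<close>

lemma dyadic_scale_above:
  fixes s \<eta> d :: real
  assumes "0 < s" "0 < \<eta>" "0 \<le> d" "d < 1"
  obtains l :: nat where "d \<le> (1/2) ^ l" "((1/2) ^ l) powr s \<le> 2 powr s * d powr s + \<eta>"
proof (cases "d = 0")
  case True
  have "(\<lambda>l::nat. ((1/2::real) ^ l) powr s) \<longlonglongrightarrow> 0"
    using \<open>0 < s\<close> by (intro tendsto_zero_powrI[where b = s]) (auto intro!: LIMSEQ_power_zero)
  then have "eventually (\<lambda>l::nat. ((1/2::real) ^ l) powr s < \<eta>) sequentially"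
    using \<open>0 < \<eta>\<close> by (rule order_tendstoD(2))
  then obtain l :: nat where "((1/2::real) ^ l) powr s < \<eta>"
    by (auto simp: eventually_sequentially)
  with True show ?thesis by (intro that[of l]) auto
next
  case False
  then have "d > 0" using assms by simp
  then obtain n where "(1/2) ^ n < d" using real_arch_pow_inv[of d "1/2"] by auto
  define m where "m = (LEAST n. (1/2) ^ n < d)"
  have m: "(1/2) ^ m < d" unfolding m_def using \<open>(1/2) ^ n < d\<close> by (rule LeastI)
  have "m \<noteq> 0" using m \<open>d < 1\<close> by (intro notI) simp
  then obtain l where l: "m = Suc l" by (cases m) auto
  have dl: "d \<le> (1/2) ^ l"
    using not_less_Least[of l "\<lambda>n. (1/2) ^ n < d"] l unfolding m_def by simp
  have "((1/2::real) ^ l) powr s \<le> (2 * d) powr s"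
    using m l \<open>0 < s\<close> by (intro powr_mono2) auto
  also have "\<dots> = 2 powr s * d powr s" using \<open>d > 0\<close> by (simp add: powr_mult)
  finally show ?thesis using dl \<open>0 < \<eta>\<close> by (intro that[of l]) auto
qed

text \<open>
Covers by sets of dyadic size, with the size recorded separately from the diameter, so that sets of
diameter 0 have a positive size.
\<close>

lemma hausdorff_content_0_dyadic_cover:
  fixes A :: "'a::metric_space set"
  assumes "hausdorff_content s A = 0" "0 < s" "0 < e"
  obtains U :: "nat \<Rightarrow> 'a set" and l :: "nat \<Rightarrow> nat"
  where "A = (\<Union>i. U i)" "\<And>i. bounded (U i)" "\<And>i. diameter (U i) \<le> (1/2) ^ l i"
    "\<And>N. (\<Sum>i<N. ((1/2) ^ l i) powr s) \<le> e"
proof -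
  \<comment> \<open>Half of the budget \<open>e\<close> pays the factor \<open>2 powr s\<close> of the rounding to powers of two, the other half
      pays for the sets of diameter 0; the bound 1 keeps all diameters below 1.\<close>
  have "hausdorff_content s A < ennreal (min 1 (e / (2 * 2 powr s)))"
    using assms by simp
  then obtain U0 where U0: "A \<subseteq> (\<Union>i. U0 i)" "\<And>i::nat. bounded (U0 i)"
    and sum0: "(\<Sum>i. ennreal (diam_powr s (U0 i))) < ennreal (min 1 (e / (2 * 2 powr s)))"
    using hausdorff_content_lessD by blast
  have part: "(\<Sum>i<N. diam_powr s (U0 i)) \<le> min 1 (e / (2 * 2 powr s))" for N
  proof -
    have "ennreal (\<Sum>i<N. diam_powr s (U0 i)) = (\<Sum>i<N. ennreal (diam_powr s (U0 i)))"
      by (simp add: diam_powr_nonneg)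
    also have "\<dots> \<le> (\<Sum>i. ennreal (diam_powr s (U0 i)))"
      by (rule sum_le_suminf) auto
    also have "\<dots> \<le> ennreal (min 1 (e / (2 * 2 powr s)))" using sum0 by simp
    finally show ?thesis using \<open>0 < e\<close> by (subst (asm) ennreal_le_iff) auto
  qed
  define U where "U i = U0 i \<inter> A" for i
  have bdd: "bounded (U i)" for i using U0(2) by (auto simp: U_def bounded_subset)
  have dU: "diameter (U i) \<le> diameter (U0 i)" for i
    unfolding U_def by (rule diameter_subset) (auto simp: U0(2))
  have "diameter (U i) < 1" for i
  proof (cases "U0 i = {}")
    case True then show ?thesis by (simp add: U_def)
  next
    case False
    have "ennreal (diam_powr s (U0 i)) < ennreal (min 1 (e / (2 * 2 powr s)))"
      using sum0 by (rule ennreal_suminf_lessD)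
    then have "diam_powr s (U0 i) < 1"
      by (simp add: ennreal_less_iff diam_powr_nonneg)
    then have lt: "diameter (U0 i) powr s < 1"
      using False \<open>0 < s\<close> by (simp add: diam_powr_def)
    have "diameter (U0 i) < 1"
    proof (rule ccontr)
      assume "\<not> diameter (U0 i) < 1"
      then have "1 powr s \<le> diameter (U0 i) powr s"
        using \<open>0 < s\<close> by (intro powr_mono2) auto
      with lt show False by simp
    qed
    with dU[of i] show ?thesis by simp
  qed
  then have "\<exists>l::nat. diameter (U i) \<le> (1/2) ^ l \<and>
       ((1/2) ^ l) powr s \<le> 2 powr s * diameter (U i) powr s + e / 2 * (1/2) ^ Suc i" for i
  proof -
    have "0 < e / 2 * (1/2) ^ Suc i" using \<open>0 < e\<close> by simp
    from dyadic_scale_above[OF \<open>0 < s\<close> this diameter_ge_0[OF bdd] \<open>diameter (U i) < 1\<close>]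
    show ?thesis by blast
  qed
  then obtain l where l: "\<And>i. diameter (U i) \<le> (1/2) ^ l i"
    "\<And>i. ((1/2) ^ l i) powr s \<le> 2 powr s * diameter (U i) powr s + e / 2 * (1/2) ^ Suc i"
    by metis
  have "(\<Sum>i<N. ((1/2) ^ l i) powr s) \<le> e" for N
  proof -
    have dp: "diameter (U i) powr s \<le> diam_powr s (U0 i)" for i
    proof (cases "U0 i = {}")
      case True then show ?thesis using \<open>0 < s\<close> by (simp add: U_def)
    next
      case False
      then show ?thesis using \<open>0 < s\<close> dU[of i] diameter_ge_0[OF bdd[of i]]
        by (auto simp: diam_powr_def intro: powr_mono2)
    qed
    have "(\<Sum>i<N. ((1/2) ^ l i) powr s)
        \<le> (\<Sum>i<N. 2 powr s * diam_powr s (U0 i) + e / 2 * (1/2) ^ Suc i)"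
      by (intro sum_mono order.trans[OF l(2)] add_mono mult_left_mono dp) (use \<open>0 < e\<close> in auto)
    also have "\<dots> = 2 powr s * (\<Sum>i<N. diam_powr s (U0 i)) + e / 2 * (\<Sum>i<N. (1/2) ^ Suc i)"
      by (simp add: sum.distrib sum_distrib_left)
    also have "(\<Sum>i<N. (1/2::real) ^ Suc i) \<le> 1"
      using sum_le_suminf[OF sums_summable[OF power_half_series], of "{..<N}"] sums_unique[OF power_half_series]
      by simp
    also have "2 powr s * (\<Sum>i<N. diam_powr s (U0 i)) \<le> 2 powr s * (e / (2 * 2 powr s))"
      using part[of N] by (intro mult_left_mono) auto
    also have "2 powr s * (e / (2 * 2 powr s)) + e / 2 * 1 = e" by simp
    finally show ?thesis using \<open>0 < e\<close> by simp
  qed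
  moreover have "A = (\<Union>i. U i)" using U0(1) by (auto simp: U_def)
  ultimately show ?thesis using that[of U l] bdd l(1) by blast
qed

text \<open>
Null sets are transported along any relation that maps a small set to a set of controlled content.  It
is applied to the relation between a plane and the points at a given distance from it, and to the
passage from a point to a segment that starts there.
\<close>

lemma hausdorff_content_image_eq_0:
  fixes R :: "('a::metric_space \<times> 'b::metric_space) set"
  assumes null: "hausdorff_content s A = 0" and "0 < s" "0 \<le> K"
    and le: "\<And>U l. U \<subseteq> A \<Longrightarrow> U \<noteq> {} \<Longrightarrow> bounded U \<Longrightarrow> diameter U \<le> (1/2) ^ l \<Longrightarrow>
        hausdorff_content t (R `` U) \<le> ennreal (K * ((1/2) ^ l) powr s)"
  shows "hausdorff_content t (R `` A) = 0"
proof -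
  have "hausdorff_content t (R `` A) \<le> ennreal e" if "e > 0" for e
  proof -
    have pos: "0 < e / (K + 1)" using \<open>0 \<le> K\<close> \<open>e > 0\<close> by simp
    obtain U l where U: "A = (\<Union>i. U i)" "\<And>i::nat. bounded (U i)" "\<And>i. diameter (U i) \<le> (1/2) ^ l i"
      and sum: "\<And>N. (\<Sum>i<N. ((1/2) ^ l i) powr s) \<le> e / (K + 1)"
      using hausdorff_content_0_dyadic_cover[OF null \<open>0 < s\<close> pos] by metis
    have summ: "summable (\<lambda>i. ((1/2::real) ^ l i) powr s)"
      by (rule summableI_nonneg_bounded[OF _ sum]) auto
    have "hausdorff_content t (R `` A) \<le> (\<Sum>i. hausdorff_content t (R `` U i))"
      unfolding U(1) Image_UN by (rule hausdorff_content_UN_le)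
    also have "\<dots> \<le> (\<Sum>i. ennreal (K * ((1/2) ^ l i) powr s))"
    proof (rule suminf_le)
      fix i
      show "hausdorff_content t (R `` U i) \<le> ennreal (K * ((1/2) ^ l i) powr s)"
      proof (cases "U i = {}")
        case False
        then show ?thesis using U by (intro le) auto
      qed simp
    qed auto
    also have "\<dots> = ennreal (\<Sum>i. K * ((1/2) ^ l i) powr s)"
      using \<open>0 \<le> K\<close> summ by (intro suminf_ennreal2) auto
    also have "\<dots> \<le> ennreal e"
    proof (rule ennreal_leI)
      have "(\<Sum>i. K * ((1/2) ^ l i) powr s) = K * (\<Sum>i. ((1/2) ^ l i) powr s)"
        by (rule suminf_mult[OF summ])
      also have "\<dots> \<le> K * (e / (K + 1))"
        using \<open>0 \<le> K\<close> by (intro mult_left_mono suminf_le_const[OF summ sum])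
      also have "\<dots> \<le> e" using \<open>0 \<le> K\<close> \<open>e > 0\<close> by (simp add: field_simps)
      finally show "(\<Sum>i. K * ((1/2) ^ l i) powr s) \<le> e" .
    qed
    finally show ?thesis .
  qed
  then show ?thesis
    by (metis ennreal_le_epsilon add.left_neutral le_zero_eq)
qed

lemma hausdorff_content_eq_0_mono:
  fixes A :: "'a::metric_space set"
  assumes "hausdorff_content s A = 0" "0 \<le> s" "s \<le> t"
  shows "hausdorff_content t A = 0"
proof -
  have "hausdorff_content t A \<le> ennreal e" if "e > 0" for e
  proof -
    \<comment> \<open>All diameters are below 1, so raising the exponent only shrinks the terms.\<close>
    have "hausdorff_content s A < ennreal (min 1 e)" using assms \<open>e > 0\<close> by simp
    then obtain U where U: "A \<subseteq> (\<Union>i. U i)" "\<And>i::nat. bounded (U i)"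
      and sum: "(\<Sum>i. ennreal (diam_powr s (U i))) < ennreal (min 1 e)"
      using hausdorff_content_lessD by blast
    have "diam_powr t (U i) \<le> diam_powr s (U i)" for i
    proof -
      have "ennreal (diam_powr s (U i)) < ennreal (min 1 e)"
        using sum by (rule ennreal_suminf_lessD)
      then have lt1: "diam_powr s (U i) < 1" by (simp add: ennreal_less_iff diam_powr_nonneg)
      show ?thesis
      proof (cases "U i = {} \<or> s = 0 \<or> s = t")
        case True
        then show ?thesis using lt1 by (auto simp: diam_powr_def split: if_splits)
      next
        case False
        then have "s > 0" "t > 0" using assms by auto
        have "diameter (U i) < 1"
        proof (rule ccontr)
          assume "\<not> diameter (U i) < 1"
          then have "1 powr s \<le> diameter (U i) powr s"
            using \<open>0 < s\<close> by (intro powr_mono2) auto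
          with lt1 False \<open>s > 0\<close> show False by (simp add: diam_powr_def)
        qed
        then have "diameter (U i) powr t \<le> diameter (U i) powr s"
          using assms diameter_ge_0[OF U(2)[of i]] by (intro powr_mono') auto
        then show ?thesis using False \<open>t > 0\<close> by (simp add: diam_powr_def)
      qed
    qed
    then have "(\<Sum>i. ennreal (diam_powr t (U i))) \<le> (\<Sum>i. ennreal (diam_powr s (U i)))"
      by (intro suminf_le ennreal_leI) auto
    with sum have "(\<Sum>i. ennreal (diam_powr t (U i))) \<le> ennreal e"
      by (metis ennreal_leI less_imp_le min.cobounded2 order.trans)
    then show ?thesis
      using hausdorff_content_le_suminf[OF U, of t] by (rule order.trans[rotated])
  qed
  then show ?thesis
    by (metis ennreal_le_epsilon add.left_neutral le_zero_eq)
qed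

lemma hausdorff_content_0_eq_0_iff: "hausdorff_content 0 A = 0 \<longleftrightarrow> A = {}"
proof
  assume "hausdorff_content 0 A = 0"
  then have "hausdorff_content 0 A < 1" by simp
  then obtain U where U: "A \<subseteq> (\<Union>i. U i)" "\<And>i::nat. bounded (U i)"
    and sum: "(\<Sum>i. ennreal (diam_powr 0 (U i))) < 1"
    using hausdorff_content_lessD by blast
  have "U i = {}" for i
    using ennreal_suminf_lessD[OF sum, of i] by (auto simp: diam_powr_def split: if_splits)
  with U show "A = {}" by auto
qed simp

section \<open>Dyadic cells and triangular counting\<close>

definition cell :: "nat \<Rightarrow> real ^ 'n \<Rightarrow> 'n \<Rightarrow> int" where
  "cell l z = (\<lambda>i. \<lfloor>2 ^ l * z $ i\<rfloor>)"

text \<open>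
Choose the coordinates of \<open>q\<close> in the order of \<open>rank\<close>: given the earlier ones, a coordinate has at most
\<open>2 * R i + 2\<close> values, those near \<open>c i q\<close>.  Formally, the shear \<open>q i - \<lfloor>c i q\<rfloor>\<close> is injective and maps \<open>S\<close> into
a box.
\<close>

lemma card_triangular_le:
  fixes S :: "('n::finite \<Rightarrow> int) set" and c :: "'n \<Rightarrow> ('n \<Rightarrow> int) \<Rightarrow> real" and rank :: "'n \<Rightarrow> nat"
  assumes dep: "\<And>i q q'. (\<And>i'. rank i' < rank i \<Longrightarrow> q i' = q' i') \<Longrightarrow> c i q = c i q'"
    and le: "\<And>q i. q \<in> S \<Longrightarrow> \<bar>real_of_int (q i) - c i q\<bar> \<le> R i"
    and "\<And>i. 0 \<le> R i"
  shows "finite S \<and> real (card S) \<le> (\<Prod>i\<in>UNIV. 2 * R i + 2)"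
proof -
  define \<Phi> where "\<Phi> q i = q i - \<lfloor>c i q\<rfloor>" for q i
  define Box where "Box = PiE (UNIV::'n set) (\<lambda>i. {- \<lfloor>R i\<rfloor>..\<lfloor>R i\<rfloor> + 1})"
  have "finite Box" unfolding Box_def by (intro finite_PiE) auto
  have sub: "\<Phi> ` S \<subseteq> Box"
  proof (clarsimp simp: Box_def PiE_iff \<Phi>_def)
    fix q i assume "q \<in> S"
    then have "\<bar>real_of_int (q i) - c i q\<bar> \<le> R i" by (rule le)
    then show "- \<lfloor>R i\<rfloor> \<le> q i - \<lfloor>c i q\<rfloor> \<and> q i - \<lfloor>c i q\<rfloor> \<le> \<lfloor>R i\<rfloor> + 1" by linarith
  qed
  have inj: "inj_on \<Phi> S"
  proof (rule inj_onI)
    fix q q' assume eq: "\<Phi> q = \<Phi> q'"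
    have "q i = q' i" for i
    proof (induction "rank i" arbitrary: i rule: less_induct)
      case less
      then have "c i q = c i q'" by (intro dep) auto
      with fun_cong[OF eq, of i] show ?case by (simp add: \<Phi>_def)
    qed
    then show "q = q'" by blast
  qed
  have "finite S" using inj sub \<open>finite Box\<close> by (metis finite_imageD finite_subset)
  have "card S \<le> card Box"
    using inj sub \<open>finite Box\<close> by (metis card_image card_mono)
  also have "card Box = (\<Prod>i\<in>UNIV. card {- \<lfloor>R i\<rfloor>..\<lfloor>R i\<rfloor> + 1})"
    unfolding Box_def by (simp add: card_PiE)
  finally have "real (card S) \<le> (\<Prod>i\<in>UNIV. real (card {- \<lfloor>R i\<rfloor>..\<lfloor>R i\<rfloor> + 1}))"
    by (metis of_nat_le_iff of_nat_prod)
  also have "\<dots> \<le> (\<Prod>i\<in>UNIV. 2 * R i + 2)"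
  proof (rule prod_mono)
    fix i
    have "0 \<le> \<lfloor>R i\<rfloor>" using assms(3) by simp
    then have "real (card {- \<lfloor>R i\<rfloor>..\<lfloor>R i\<rfloor> + 1}) = 2 * real_of_int \<lfloor>R i\<rfloor> + 2" by simp
    also have "\<dots> \<le> 2 * R i + 2" by simp
    finally show "0 \<le> real (card {- \<lfloor>R i\<rfloor>..\<lfloor>R i\<rfloor> + 1}) \<and> real (card {- \<lfloor>R i\<rfloor>..\<lfloor>R i\<rfloor> + 1}) \<le> 2 * R i + 2"
      by simp
  qed
  finally show ?thesis using \<open>finite S\<close> by blast
qed

lemma cell_abs_le:
  assumes "norm z \<le> m"
  shows "\<bar>real_of_int (cell l z i)\<bar> \<le> (m + 1) * 2 ^ l"
proof -
  have "\<bar>z $ i\<bar> \<le> m" using component_le_norm_cart[of z i] assms by linarith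
  then have "2 ^ l * \<bar>z $ i\<bar> \<le> 2 ^ l * m" by (intro mult_left_mono) auto
  moreover have "\<bar>2 ^ l * z $ i\<bar> = 2 ^ l * \<bar>z $ i\<bar>" by (simp add: abs_mult)
  ultimately have "\<bar>2 ^ l * z $ i\<bar> \<le> 2 ^ l * m" by linarith
  moreover have "\<bar>real_of_int (cell l z i)\<bar> \<le> \<bar>2 ^ l * z $ i\<bar> + 1"
    unfolding cell_def by linarith
  moreover have "(1::real) \<le> 2 ^ l" by simp
  moreover have "(m + 1) * 2 ^ l = 2 ^ l * m + 2 ^ l" by (simp add: algebra_simps)
  ultimately show ?thesis by linarith
qed

lemma cell_dist_le:
  fixes x y :: "real ^ 'n"
  assumes "cell l x = cell l y"
  shows "dist x y \<le> real CARD('n) * (1/2) ^ l"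
proof -
  have "\<bar>(x - y) $ i\<bar> \<le> (1/2) ^ l" for i
  proof -
    have "\<lfloor>2 ^ l * x $ i\<rfloor> = \<lfloor>2 ^ l * y $ i\<rfloor>"
      using fun_cong[OF assms, of i] by (simp add: cell_def)
    then have "\<bar>2 ^ l * x $ i - 2 ^ l * y $ i\<bar> \<le> 1" by linarith
    then have "2 ^ l * \<bar>x $ i - y $ i\<bar> \<le> 1"
      by (simp add: right_diff_distrib[symmetric] abs_mult)
    then show ?thesis by (simp add: power_one_over field_simps)
  qed
  then have "norm (x - y) \<le> (\<Sum>i\<in>(UNIV::'n set). (1/2) ^ l)"
    by (intro order.trans[OF norm_le_l1_cart sum_mono])
  then show ?thesis by (simp add: dist_norm)
qed

lemma cell_fibre_bounded: "bounded {z :: real ^ 'n. cell l z = q}"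
proof (cases "{z :: real ^ 'n. cell l z = q} = {}")
  case False
  then obtain x :: "real ^ 'n" where "cell l x = q" by auto
  then have "{z. cell l z = q} \<subseteq> cball x (real CARD('n) * (1/2) ^ l)"
    by (auto intro!: cell_dist_le)
  then show ?thesis using bounded_subset bounded_cball by blast
qed simp

lemma diam_powr_cell_le:
  assumes "0 \<le> s"
  shows "diam_powr s {z :: real ^ 'n. cell l z = q} \<le> real CARD('n) powr s * ((1/2) ^ l) powr s"
proof -
  have "0 < real CARD('n) * (1/2) ^ l" by simp
  moreover from this have "diameter {z :: real ^ 'n. cell l z = q} \<le> real CARD('n) * (1/2) ^ l"
    by (intro diameter_le) (auto simp: dist_norm[symmetric] intro!: cell_dist_le)
  ultimately have "diam_powr s {z :: real ^ 'n. cell l z = q} \<le> (real CARD('n) * (1/2) ^ l) powr s"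
    using assms cell_fibre_bounded by (intro diam_powr_le) auto
  then show ?thesis by (simp add: powr_mult)
qed

lemma finite_card_cells_of_ball:
  assumes "0 \<le> m"
  shows "finite (cell l ` cball (0 :: real ^ 'n) m) \<and>
    real (card (cell l ` cball (0 :: real ^ 'n) m)) \<le> ((2 * m + 4) * 2 ^ l) ^ CARD('n)"
proof -
  let ?T = "cell l ` cball (0 :: real ^ 'n) m"
  have "finite ?T \<and> real (card ?T) \<le> (\<Prod>i\<in>(UNIV::'n set). 2 * ((m + 1) * 2 ^ l) + 2)"
  proof (rule card_triangular_le[where c = "\<lambda>_ _. 0" and rank = "\<lambda>_. 0"])
    fix q i assume "q \<in> ?T"
    then obtain z :: "real ^ 'n" where "norm z \<le> m" "q = cell l z" by auto
    then show "\<bar>real_of_int (q i) - 0\<bar> \<le> (m + 1) * 2 ^ l" using cell_abs_le[of z m l i] by simp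
  qed (use \<open>0 \<le> m\<close> in auto)
  moreover have "(2 * ((m + 1) * 2 ^ l) + 2) ^ CARD('n) \<le> ((2 * m + 4) * 2 ^ l) ^ CARD('n)"
  proof (rule power_mono)
    have "(1::real) \<le> 2 ^ l" by simp
    then show "2 * ((m + 1) * 2 ^ l) + 2 \<le> (2 * m + 4) * 2 ^ l" by (simp add: algebra_simps)
  qed (use \<open>0 \<le> m\<close> in auto)
  ultimately show ?thesis by (simp only: prod_constant) (meson order.trans)
qed

lemma finite_card_cells_of_small_set:
  fixes U :: "(real ^ 'n) set"
  assumes "bounded U" "diameter U \<le> (1/2) ^ l"
  shows "finite (cell l ` U) \<and> real (card (cell l ` U)) \<le> 4 ^ CARD('n)"
proof (cases "U = {}")
  case False
  then obtain x0 where "x0 \<in> U" by auto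
  have "finite (cell l ` U) \<and> real (card (cell l ` U)) \<le> (\<Prod>i\<in>(UNIV::'n set). 2 * 1 + 2)"
  proof (rule card_triangular_le[where c = "\<lambda>i _. real_of_int (cell l x0 i)" and rank = "\<lambda>_. 0"])
    fix q i assume "q \<in> cell l ` U"
    then obtain x where x: "x \<in> U" "q = cell l x" by auto
    have "\<bar>(x - x0) $ i\<bar> \<le> (1/2) ^ l"
      using component_le_norm_cart[of "x - x0" i] diameter_bounded_bound[OF assms(1) x(1) \<open>x0 \<in> U\<close>] assms(2)
      by (simp add: dist_norm)
    then have "2 ^ l * \<bar>(x - x0) $ i\<bar> \<le> 2 ^ l * (1/2) ^ l" by (intro mult_left_mono) auto
    moreover have "2 ^ l * \<bar>(x - x0) $ i\<bar> = \<bar>2 ^ l * x $ i - 2 ^ l * x0 $ i\<bar>"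
      by (simp add: right_diff_distrib[symmetric] abs_mult)
    moreover have "2 ^ l * (1/2::real) ^ l = 1" by (simp add: power_one_over)
    ultimately have "\<bar>2 ^ l * x $ i - 2 ^ l * x0 $ i\<bar> \<le> 1" by linarith
    then have "cell l x i \<le> cell l x0 i + 1" "cell l x0 i \<le> cell l x i + 1"
      unfolding cell_def by linarith+
    then show "\<bar>real_of_int (q i) - real_of_int (cell l x0 i)\<bar> \<le> 1"
      unfolding x(2) by linarith
  qed auto
  then show ?thesis by simp
qed simp

section \<open>Dimension of Euclidean space and of convex sets\<close>

lemma hausdorff_content_UNIV_eq_0:
  assumes "real CARD('n) < t"
  shows "hausdorff_content t (UNIV :: (real ^ 'n) set) = 0"
proof -
  have "hausdorff_content t (cball (0 :: real ^ 'n) (real m)) = 0" for m :: nat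
  proof (rule hausdorff_content_limsup_eq_0)
    let ?n = "CARD('n)" and ?T = "\<lambda>l. cell l ` cball (0 :: real ^ 'n) (real m)"
    define C where "C = (2 * real m + 4) ^ ?n * real ?n powr t"
    have T: "finite (?T l) \<and> real (card (?T l)) \<le> ((2 * real m + 4) * 2 ^ l) ^ ?n" for l
      by (rule finite_card_cells_of_ball) simp
    show "finite (?T l)" for l using T by blast
    show "bounded {z :: real ^ 'n. cell l z = q}" for l q by (rule cell_fibre_bounded)
    show "(\<Sum>q\<in>?T l. diam_powr t {z :: real ^ 'n. cell l z = q}) \<le> C * (2 powr (real ?n - t)) ^ l" for l
    proof -
      have "(\<Sum>q\<in>?T l. diam_powr t {z :: real ^ 'n. cell l z = q})
          \<le> (\<Sum>q\<in>?T l. real ?n powr t * ((1/2) ^ l) powr t)"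
        using assms by (intro sum_mono diam_powr_cell_le) auto
      also have "\<dots> \<le> ((2 * real m + 4) * 2 ^ l) ^ ?n * (real ?n powr t * ((1/2) ^ l) powr t)"
        using T[of l] by (simp add: mult_right_mono)
      also have "\<dots> = C * ((2 ^ l) ^ ?n * ((1/2) ^ l) powr t)"
        by (simp add: C_def power_mult_distrib mult_ac)
      also have "((1/2::real) ^ l) powr t = 2 powr (- (real l * t))"
        by (simp add: power_one_over powr_realpow[symmetric] powr_minus_divide[symmetric] powr_powr)
      also have "(2 ^ l) ^ ?n * 2 powr (- (real l * t)) = (2 powr (real ?n - t)) ^ l"
        by (simp add: powr_realpow[symmetric] powr_add[symmetric] powr_powr power_mult[symmetric] algebra_simps)
      finally show ?thesis .
    qed
    show "summable (\<lambda>l. C * (2 powr (real ?n - t)) ^ l)"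
      using assms by (intro summable_mult summable_geometric) (simp add: powr_less_one)
    show "\<exists>\<^sub>\<infinity>l. \<exists>q\<in>?T l. x \<in> {z. cell l z = q}" if "x \<in> cball 0 (real m)" for x
      using that by (auto simp: INFM_nat_le)
  qed
  then have "hausdorff_content t (\<Union>m\<in>UNIV. cball (0 :: real ^ 'n) (real m)) = 0"
    by (intro hausdorff_content_UN_eq_0) auto
  moreover have "(\<Union>m\<in>UNIV. cball (0 :: real ^ 'n) (real m)) = UNIV"
    using real_arch_simple by (auto simp: set_eq_iff)
  ultimately show ?thesis by simp
qed

text \<open>
A set of diameter \<open>d\<close> lies in a cube of side \<open>2 * d\<close>.
\<close>

lemma hausdorff_content_0_imp_negligible:
  fixes A :: "(real ^ 'n) set"
  assumes "hausdorff_content (real CARD('n)) A = 0"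
  shows "negligible A"
  unfolding negligible_outer
proof (intro allI impI)
  fix e :: real assume "0 < e"
  define n where "n = CARD('n)"
  have "n > 0" by (simp add: n_def)
  then have pos: "0 < real n" "0 < e / (2 * 2 ^ n)" using \<open>0 < e\<close> by auto
  obtain U :: "nat \<Rightarrow> (real ^ 'n) set" and l where U: "A = (\<Union>i. U i)" "\<And>i. bounded (U i)"
    "\<And>i. diameter (U i) \<le> (1/2) ^ l i"
    and sum: "\<And>M. (\<Sum>i<M. ((1/2) ^ l i) powr n) \<le> e / (2 * 2 ^ n)"
    using hausdorff_content_0_dyadic_cover[OF _ pos, of A] assms unfolding n_def by metis
  have "\<exists>c. U i \<subseteq> cball c ((1/2) ^ l i)" for i
  proof (cases "U i = {}")
    case False
    then obtain c where "c \<in> U i" by auto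
    then have "U i \<subseteq> cball c ((1/2) ^ l i)"
      using diameter_bounded_bound[OF U(2) \<open>c \<in> U i\<close>] U(3)[of i] by (force simp: dist_commute)
    then show ?thesis ..
  qed auto
  then obtain c where c: "\<And>i. U i \<subseteq> cball (c i) ((1/2) ^ l i)" by metis
  define Q where "Q i = cbox (c i - (\<chi> j. (1/2) ^ l i)) (c i + (\<chi> j. (1/2) ^ l i))" for i
  have sub: "U i \<subseteq> Q i" for i
  proof
    fix x assume "x \<in> U i"
    then have "norm (x - c i) \<le> (1/2) ^ l i" using c[of i] by (auto simp: dist_norm norm_minus_commute)
    then have "\<bar>(x - c i) $ j\<bar> \<le> (1/2) ^ l i" for j
      using component_le_norm_cart[of "x - c i" j] by linarith
    then show "x \<in> Q i" unfolding Q_def mem_box_cart by (auto simp: abs_le_iff algebra_simps)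
  qed
  have content: "measure lebesgue (Q i) = 2 ^ n * ((1/2) ^ l i) powr n" for i
  proof -
    have "Q i \<noteq> {}" unfolding Q_def by (simp add: interval_ne_empty_cart)
    then have "measure lborel (Q i) = (\<Prod>j\<in>(UNIV::'n set). (c i + (\<chi> j. (1/2) ^ l i)) $ j - (c i - (\<chi> j. (1/2) ^ l i)) $ j)"
      unfolding Q_def by (rule content_cbox_cart)
    also have "\<dots> = (\<Prod>j\<in>(UNIV::'n set). 2 * (1/2) ^ l i)" by (intro prod.cong) auto
    finally show ?thesis
      using \<open>n > 0\<close> by (simp add: n_def[symmetric] power_mult_distrib powr_realpow measure_completion Q_def)
  qed
  have part: "(\<Sum>i\<le>M. measure lebesgue (Q i)) \<le> e / 2" for M
  proof -
    have "(\<Sum>i\<le>M. measure lebesgue (Q i)) = 2 ^ n * (\<Sum>i<Suc M. ((1/2) ^ l i) powr n)"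
      unfolding content lessThan_Suc_atMost by (simp add: sum_distrib_left)
    also have "\<dots> \<le> 2 ^ n * (e / (2 * 2 ^ n))" by (intro mult_left_mono sum) auto
    finally show ?thesis by simp
  qed
  have meas: "Q i \<in> lmeasurable" for i unfolding Q_def by (rule lmeasurable_cbox)
  have "measure lebesgue (\<Union>i\<le>M. Q i) \<le> (\<Sum>i\<le>M. measure lebesgue (Q i))" for M
    using meas by (intro measure_UNION_le) (auto simp: fmeasurable_def)
  then have union: "measure lebesgue (\<Union>i\<le>M. Q i) \<le> e / 2" for M
    using part order.trans by blast
  show "\<exists>T. A \<subseteq> T \<and> T \<in> lmeasurable \<and> measure lebesgue T < e"
  proof (intro exI[of _ "\<Union>i. Q i"] conjI)
    show "A \<subseteq> (\<Union>i. Q i)" using sub U(1) by blast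
    show "(\<Union>i. Q i) \<in> lmeasurable"
      by (rule fmeasurable_countable_Union[OF meas union])
    have "measure lebesgue (\<Union>i. Q i) \<le> e / 2"
      by (rule measure_countable_Union_le[OF meas union])
    then show "measure lebesgue (\<Union>i. Q i) < e" using \<open>0 < e\<close> by linarith
  qed
qed

text \<open>
Thickening a set in one direction raises its dimension by at most one: a covering set of diameter \<open>d\<close>
is replaced by about \<open>1 / d\<close> translates of size \<open>O(d)\<close>.
\<close>

lemma hausdorff_content_add_segment_eq_0:
  fixes S :: "'a::real_normed_vector set"
  assumes "hausdorff_content s S = 0" "0 \<le> s"
  shows "hausdorff_content (s + 1) {x + t *\<^sub>R v |x t. x \<in> S \<and> 0 \<le> t \<and> t \<le> 1} = 0"
proof (cases "s = 0")
  case True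
  then show ?thesis using assms by (simp add: hausdorff_content_0_eq_0_iff)
next
  case False
  then have "0 < s" using assms by simp
  define R where "R = {(x, x + t *\<^sub>R v) |x t. 0 \<le> t \<and> t \<le> 1}"
  define K where "K = 2 * (1 + norm v) powr (s + 1)"
  have "hausdorff_content (s + 1) (R `` S) = 0"
  proof (rule hausdorff_content_image_eq_0[OF assms(1) \<open>0 < s\<close>])
    show "0 \<le> K" by (simp add: K_def)
    fix U l assume U: "U \<subseteq> S" "U \<noteq> {}" "bounded U" "diameter U \<le> (1/2) ^ l"
    \<comment> \<open>About \<open>2 ^ l\<close> pieces of the segment, each comparable in length to the bound on the diameter of \<open>U\<close>.\<close>
    define V where "V j = {x + t *\<^sub>R v |x t. x \<in> U \<and> real j \<le> 2 ^ l * t \<and> 2 ^ l * t \<le> real j + 1}" for j :: nat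
    have cover: "R `` U \<subseteq> (\<Union>j\<le>2 ^ l. V j)"
    proof
      fix y assume "y \<in> R `` U"
      then obtain x t where x: "x \<in> U" "y = x + t *\<^sub>R v" "0 \<le> t" "t \<le> 1" by (auto simp: R_def)
      define j where "j = nat \<lfloor>2 ^ l * t\<rfloor>"
      have j: "real j \<le> 2 ^ l * t" "2 ^ l * t \<le> real j + 1"
        using x(3) unfolding j_def by simp_all
      have "2 ^ l * t \<le> 2 ^ l * 1" using x(4) by (intro mult_left_mono) auto
      with j(1) have "real j \<le> 2 ^ l" by linarith
      then have "j \<le> 2 ^ l" by (metis of_nat_le_iff of_nat_numeral of_nat_power)
      moreover have "y \<in> V j" using x j by (auto simp: V_def)
      ultimately show "y \<in> (\<Union>j\<le>2 ^ l. V j)" by blast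
    qed
    define d where "d = (1 + norm v) * (1/2) ^ l"
    have "0 < d" by (simp add: d_def add_pos_nonneg)
    have d: "norm (y - y') \<le> d" if yy: "y \<in> V j" "y' \<in> V j" for y y' j
    proof -
      obtain x t x' t' where x: "x \<in> U" "y = x + t *\<^sub>R v" "real j \<le> 2 ^ l * t" "2 ^ l * t \<le> real j + 1"
        and x': "x' \<in> U" "y' = x' + t' *\<^sub>R v" "real j \<le> 2 ^ l * t'" "2 ^ l * t' \<le> real j + 1"
        using yy unfolding V_def by blast
      have "\<bar>2 ^ l * t - 2 ^ l * t'\<bar> \<le> 1" using x(3,4) x'(3,4) by linarith
      then have "2 ^ l * \<bar>t - t'\<bar> \<le> 1" by (simp add: right_diff_distrib[symmetric] abs_mult)
      then have t: "\<bar>t - t'\<bar> \<le> (1/2) ^ l" by (simp add: power_one_over field_simps)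
      have "norm (x - x') \<le> (1/2) ^ l"
        using diameter_bounded_bound[OF U(3) x(1) x'(1)] U(4) by (simp add: dist_norm)
      moreover have "norm (y - y') \<le> norm (x - x') + \<bar>t - t'\<bar> * norm v"
      proof -
        have "y - y' = (x - x') + (t - t') *\<^sub>R v" by (simp add: x(2) x'(2) algebra_simps)
        then show ?thesis using norm_triangle_ineq[of "x - x'" "(t - t') *\<^sub>R v"] by simp
      qed
      moreover have "\<bar>t - t'\<bar> * norm v \<le> (1/2) ^ l * norm v" using t by (intro mult_right_mono) auto
      ultimately show ?thesis unfolding d_def by (simp add: algebra_simps)
    qed
    have V: "hausdorff_content (s + 1) (V j) \<le> ennreal (d powr (s + 1))" for j
    proof -
      have b: "bounded (V j)"
      proof (cases "V j = {}")
        case False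
        then obtain y where "y \<in> V j" by auto
        then have "V j \<subseteq> cball y d" using d by (auto simp: dist_norm)
        then show ?thesis using bounded_subset bounded_cball by blast
      qed simp
      have "diameter (V j) \<le> d" using d \<open>0 < d\<close> by (intro diameter_le) auto
      then have "diam_powr (s + 1) (V j) \<le> d powr (s + 1)"
        using \<open>0 < d\<close> \<open>0 < s\<close> b by (intro diam_powr_le) auto
      then show ?thesis using hausdorff_content_le_diam_powr[OF b, of "s + 1"] ennreal_leI order.trans by blast
    qed
    have "hausdorff_content (s + 1) (R `` U) \<le> hausdorff_content (s + 1) (\<Union>j\<le>2 ^ l. V j)"
      by (rule hausdorff_content_mono[OF cover])
    also have "\<dots> \<le> (\<Sum>j\<le>2 ^ l. hausdorff_content (s + 1) (V j))"
      by (rule hausdorff_content_finite_UN_le) simp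
    also have "\<dots> \<le> (\<Sum>j\<le>(2 ^ l :: nat). ennreal (d powr (s + 1)))" by (intro sum_mono V)
    also have "\<dots> = ennreal (\<Sum>j\<le>(2 ^ l :: nat). d powr (s + 1))" by (rule sum_ennreal) simp
    also have "\<dots> \<le> ennreal (K * ((1/2) ^ l) powr s)"
    proof (rule ennreal_leI)
      have d_powr: "d powr (s + 1) = (1 + norm v) powr (s + 1) * (((1/2) ^ l) powr s * (1/2) ^ l)"
        unfolding d_def by (subst powr_mult) (auto simp: powr_add)
      have "(\<Sum>j\<le>(2 ^ l :: nat). d powr (s + 1)) = (2 ^ l + 1) * d powr (s + 1)" by (simp add: algebra_simps)
      also have "\<dots> \<le> (2 * 2 ^ l) * d powr (s + 1)" by (intro mult_right_mono) auto
      also have "\<dots> = K * ((1/2) ^ l) powr s"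
        unfolding K_def d_powr by (simp add: power_one_over)
      finally show "(\<Sum>j\<le>(2 ^ l :: nat). d powr (s + 1)) \<le> K * ((1/2) ^ l) powr s" .
    qed
    finally show "hausdorff_content (s + 1) (R `` U) \<le> ennreal (K * ((1/2) ^ l) powr s)" .
  qed
  moreover have "R `` S = {x + t *\<^sub>R v |x t. x \<in> S \<and> 0 \<le> t \<and> t \<le> 1}" by (auto simp: R_def)
  ultimately show ?thesis by simp
qed

text \<open>
A convex set of full affine dimension has interior and is not Lebesgue null.  Every other convex set
is thickened, one segment outside of its affine hull at a time, until it has full dimension; a null
set would have remained null for the increasing exponents.
\<close>

lemma convex_hausdorff_content_neq_0:
  fixes S :: "(real ^ 'n) set"
  assumes "convex S" "int d \<le> aff_dim S"
  shows "hausdorff_content (real d) S \<noteq> 0"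
proof -
  have "d \<le> CARD('n)"
    using assms(2) aff_dim_le_DIM[of S] by simp
  then show ?thesis using assms
  proof (induction d arbitrary: S rule: inc_induct)
    case base
    then have "aff_dim S = int DIM(real ^ 'n)"
      using aff_dim_le_DIM[of S] by simp
    moreover from this have "S \<noteq> {}" by auto
    ultimately have "interior S \<noteq> {}"
      using interior_rel_interior[of S] rel_interior_eq_empty[OF base(1)] by auto
    then have "\<not> negligible S"
      using open_not_negligible[OF open_interior] negligible_subset[OF _ interior_subset] by blast
    then show ?case using hausdorff_content_0_imp_negligible by blast
  next
    case (step d)
    show ?case
    proof (cases "int (Suc d) \<le> aff_dim S")
      case True
      then have "hausdorff_content (real (Suc d)) S \<noteq> 0" using step by blast
      then show ?thesis using hausdorff_content_eq_0_mono[of "real d" S "real (Suc d)"] by auto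
    next
      case False
      then have dim: "aff_dim S = int d" using step.prems by simp
      then have "affine hull S \<noteq> UNIV"
        using step.hyps aff_dim_eq_full[of S] by auto
      then obtain p where p: "p \<notin> affine hull S" by blast
      have "S \<noteq> {}" using dim by auto
      then obtain x0 where "x0 \<in> S" by auto
      define v where "v = p - x0"
      define S' where "S' = {x + t *\<^sub>R v |x t. x \<in> S \<and> 0 \<le> t \<and> t \<le> 1}"
      have "linear (\<lambda>z. fst z + snd z *\<^sub>R v)"
        by (rule linearI) (simp_all add: algebra_simps)
      moreover have "S' = (\<lambda>z. fst z + snd z *\<^sub>R v) ` (S \<times> {0..1})"
        unfolding S'_def by force
      ultimately have "convex S'"
        using step.prems(1) by (simp only:) (intro convex_linear_image convex_Times convex_real_interval)
      have "insert p S \<subseteq> S'"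
      proof -
        have "x \<in> S'" if "x \<in> S" for x using that unfolding S'_def by (intro CollectI exI[of _ x] exI[of _ "0::real"]) auto
        moreover have "p \<in> S'" using \<open>x0 \<in> S\<close> unfolding S'_def v_def by (intro CollectI exI[of _ x0] exI[of _ "1::real"]) auto
        ultimately show ?thesis by blast
      qed
      then have "aff_dim (insert p S) \<le> aff_dim S'" by (rule aff_dim_subset)
      then have "int (Suc d) \<le> aff_dim S'" using p dim by (simp add: aff_dim_insert)
      then have "hausdorff_content (real (Suc d)) S' \<noteq> 0" using step.IH \<open>convex S'\<close> by blast
      then show ?thesis
        using hausdorff_content_add_segment_eq_0[of "real d" S v] unfolding S'_def by (auto simp: add.commute)
    qed
  qed
qed

section \<open>Planes as graphs\<close>

text \<open>
The parameter is an affine projection \<open>u \<mapsto> fst \<theta> + snd \<theta> *v u\<close>, and the plane is the set of its fixed points.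
\<close>

definition plane :: "(real ^ 'n) \<times> (real ^ 'n ^ 'n) \<Rightarrow> (real ^ 'n) set" where
  "plane \<theta> = {z. fst \<theta> + snd \<theta> *v z = z}"

text \<open>
The projection depends only on the coordinates in \<open>I\<close> and preserves them, so that its image is the graph
of an affine function of these coordinates.  Storing that function as a square matrix keeps the
parameters of all dimensions in one Euclidean space.
\<close>

definition graph_params :: "'n set \<Rightarrow> ((real ^ 'n) \<times> (real ^ 'n ^ 'n)) set" where
  "graph_params I = {\<theta>. (\<forall>i j. j \<notin> I \<longrightarrow> snd \<theta> $ i $ j = 0) \<and>
     (\<forall>u. \<forall>i\<in>I. (fst \<theta> + snd \<theta> *v u) $ i = u $ i)}"

lemma affine_subspace_is_plane:
  fixes P :: "(real ^ 'n) set"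
  assumes "affine_subspace_dim k P"
  shows "\<exists>I. card I = k \<and> (\<exists>\<theta>\<in>graph_params I. P = plane \<theta>)"
proof -
  have "affine P" and dimP: "aff_dim P = int k" using assms by (auto simp: affine_subspace_dim_def)
  then have "P \<noteq> {}" by auto
  then obtain p where "p \<in> P" by auto
  define V where "V = (\<lambda>z. - p + z) ` P"
  have "subspace V" unfolding V_def using \<open>affine P\<close> \<open>p \<in> P\<close> by (rule affine_diffs_subspace)
  have dimV: "dim V = k"
    using aff_dim_eq_dim[of p P] hull_inc[of p P] \<open>p \<in> P\<close> dimP by (simp add: V_def)
  obtain B where B: "B \<subseteq> V" "independent B" "V \<subseteq> span B" "card B = dim V"
    using basis_exists by metis
  have spanB: "span B = V" using B \<open>subspace V\<close> by (simp add: span_subspace)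
  define Ax where "Ax = (\<lambda>j. axis j (1::real)) ` (UNIV :: 'n set)"
  have "span Ax = UNIV"
  proof -
    have "Ax = Basis" by (auto simp: Ax_def Basis_vec_def)
    then show ?thesis by simp
  qed
  obtain B' where B': "B \<subseteq> B'" "B' \<subseteq> B \<union> Ax" "independent B'" "B \<union> Ax \<subseteq> span B'"
    using maximal_independent_subset_extend[of B "B \<union> Ax"] B(2) by blast
  have spanB': "span B' = UNIV"
    using B'(4) \<open>span Ax = UNIV\<close> by (metis Un_subset_iff span_minimal subspace_span top.extremum_uniqueI)
  \<comment> \<open>Complete a basis of the direction space by coordinate vectors; projecting these away is the linear
      part of the parameter.\<close>
  define J where "J = {j. axis j 1 \<in> B' - B}"
  have B'J: "B' - B = (\<lambda>j. axis j 1) ` J" using B'(2) by (auto simp: J_def Ax_def)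
  have "card (B' - B) = card J"
    unfolding B'J by (rule card_image) (auto simp: inj_on_def axis_eq_axis)
  moreover have "finite B'" using B'(3) by (rule independent_imp_finite)
  moreover have "card B' = CARD('n)"
    using B'(3) spanB' by (metis dim_UNIV dim_span_eq_card_independent DIM_cart DIM_real mult.right_neutral)
  ultimately have cardJ: "card J = CARD('n) - k"
    using card_Diff_subset[of B B'] B'(1) B(4) dimV finite_subset by fastforce
  have "k \<le> CARD('n)"
    using dimV dim_subset_UNIV[of V] by simp
  then have cardI: "card (- J) = k"
    using cardJ by (simp add: Compl_eq_Diff_UNIV card_Diff_subset)
  obtain f where f: "linear f" "\<And>x. x \<in> B' \<Longrightarrow> f x = (if x \<in> B then x else 0)"
    using linear_independent_extend[OF B'(3), of "\<lambda>x. if x \<in> B then x else 0"] by auto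
  have fB: "f b = b" if "b \<in> B" for b using f(2) B'(1) that by auto
  have fV: "f x = x" if "x \<in> V" for x
  proof -
    have "f x = id x"
      by (rule linear_eq_on[OF f(1) linear_id, of x B]) (use that spanB fB in auto)
    then show ?thesis by simp
  qed
  have f_range: "f x \<in> V" for x
  proof -
    have "f ` span B' = span (f ` B')" using f(1) by (simp add: linear_span_image)
    moreover have "f ` B' \<subseteq> V" using f(2) B(1) \<open>subspace V\<close> subspace_0 by auto
    ultimately show ?thesis using spanB' \<open>subspace V\<close> span_minimal by blast
  qed
  have f_axis: "f (axis j 1) = 0" if "j \<in> J" for j
    using that f(2) by (simp add: J_def)
  have f_I: "f x $ i = x $ i" if "i \<notin> J" for x i
  proof -
    have "linear (\<lambda>x. f x $ i)" "linear (\<lambda>x :: real ^ 'n. x $ i)"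
      using linear_compose[OF f(1), of "\<lambda>x. x $ i"] by (auto simp: o_def linear_iff)
    moreover have "f b $ i = b $ i" if "b \<in> B'" for b
    proof (cases "b \<in> B")
      case False
      then have "b \<in> (\<lambda>j. axis j 1) ` J" unfolding B'J[symmetric] using that by simp
      then obtain j where "j \<in> J" "b = axis j 1" by auto
      moreover have "i \<noteq> j" using \<open>j \<in> J\<close> \<open>i \<notin> J\<close> by auto
      ultimately show ?thesis using f(2)[OF that] False by (simp add: axis_def)
    next
      case True
      then show ?thesis by (simp add: fB)
    qed
    ultimately show ?thesis using linear_eq_on[of "\<lambda>x. f x $ i" "\<lambda>x. x $ i" x B'] spanB' by auto
  qed
  define \<theta> where "\<theta> = (p - f p, matrix f)"
  have mult: "fst \<theta> + snd \<theta> *v u = p + f (u - p)" for u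
    using f(1) by (simp add: \<theta>_def matrix_works linear_diff)
  have "\<theta> \<in> graph_params (- J)"
    unfolding graph_params_def mem_Collect_eq
  proof (intro conjI allI ballI impI)
    show "snd \<theta> $ i $ j = 0" if "j \<notin> - J" for i j
      using f_axis that by (simp add: \<theta>_def matrix_def)
    show "(fst \<theta> + snd \<theta> *v u) $ i = u $ i" if "i \<in> - J" for u i
      unfolding mult using f_I[of i "u - p"] that by simp
  qed
  moreover have "P = plane \<theta>"
  proof (intro set_eqI iffI)
    fix z assume "z \<in> P"
    then have "z - p \<in> V" by (auto simp: V_def)
    then show "z \<in> plane \<theta>" unfolding plane_def mem_Collect_eq mult using fV by simp
  next
    fix z assume "z \<in> plane \<theta>"
    then have "z - p = f (z - p)" unfolding plane_def mem_Collect_eq mult by (metis add_diff_cancel_left')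
    then have "z - p \<in> V" using f_range by metis
    then show "z \<in> P" by (auto simp: V_def)
  qed
  ultimately show ?thesis using cardI by blast
qed

lemma norm_fst_le_norm: "norm (fst p) \<le> norm p"
  using norm_fst_le[of "fst p" "snd p"] by simp

lemma norm_snd_le_norm: "norm (snd p) \<le> norm p"
  using norm_snd_le[of "snd p" "fst p"] by simp

lemma matrix_entry_le_norm: "\<bar>(A :: real ^ 'n ^ 'm) $ i $ j\<bar> \<le> norm A"
  by (rule order.trans[OF component_le_norm_cart Finite_Cartesian_Product.norm_nth_le])

lemma norm_matrix_le_entries:
  fixes A :: "real ^ 'n ^ 'm"
  assumes "\<And>i j. \<bar>A $ i $ j\<bar> \<le> \<beta>"
  shows "norm A \<le> real CARD('m) * (real CARD('n) * \<beta>)"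
proof -
  have "norm A \<le> (\<Sum>i\<in>UNIV. norm (A $ i))"
    unfolding norm_vec_def by (rule L2_set_le_sum) simp
  also have "\<dots> \<le> (\<Sum>i\<in>(UNIV::'m set). real CARD('n) * \<beta>)"
  proof (rule sum_mono)
    fix i
    have "norm (A $ i) \<le> (\<Sum>j\<in>UNIV. \<bar>A $ i $ j\<bar>)" by (rule norm_le_l1_cart)
    also have "\<dots> \<le> (\<Sum>j\<in>(UNIV::'n set). \<beta>)" by (intro sum_mono assms)
    finally show "norm (A $ i) \<le> real CARD('n) * \<beta>" by simp
  qed
  finally show ?thesis by simp
qed

lemma norm_matrix_vector_mult_le:
  fixes A :: "real ^ 'n ^ 'm"
  shows "norm (A *v x) \<le> real CARD('m) * (norm A * norm x)"
proof -
  have "norm (A *v x) \<le> (\<Sum>i\<in>UNIV. \<bar>(A *v x) $ i\<bar>)" by (rule norm_le_l1_cart)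
  also have "\<dots> \<le> (\<Sum>i\<in>(UNIV::'m set). norm A * norm x)"
  proof (rule sum_mono)
    fix i
    have "\<bar>(A *v x) $ i\<bar> = \<bar>A $ i \<bullet> x\<bar>" by (simp add: matrix_mult_dot)
    also have "\<dots> \<le> norm (A $ i) * norm x" by (rule Cauchy_Schwarz_ineq2)
    also have "\<dots> \<le> norm A * norm x" by (intro mult_right_mono Finite_Cartesian_Product.norm_nth_le) auto
    finally show "\<bar>(A *v x) $ i\<bar> \<le> norm A * norm x" .
  qed
  finally show ?thesis by simp
qed

lemma graph_mult_cong:
  assumes "\<theta> \<in> graph_params I" "\<And>i. i \<in> I \<Longrightarrow> u $ i = v $ i"
  shows "snd \<theta> *v u = snd \<theta> *v v"
proof -
  have "snd \<theta> $ i $ j * u $ j = snd \<theta> $ i $ j * v $ j" for i j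
    using assms(1) assms(2)[of j] by (cases "j \<in> I") (simp_all add: graph_params_def)
  then show ?thesis by (simp only: matrix_vector_mult_def)
qed

lemma graph_point_in_plane:
  assumes "\<theta> \<in> graph_params I"
  shows "fst \<theta> + snd \<theta> *v u \<in> plane \<theta>"
proof -
  have "snd \<theta> *v (fst \<theta> + snd \<theta> *v u) = snd \<theta> *v u"
    by (rule graph_mult_cong[OF assms]) (use assms in \<open>simp add: graph_params_def\<close>)
  then show ?thesis unfolding plane_def mem_Collect_eq by simp
qed

lemma plane_nonempty: "\<theta> \<in> graph_params I \<Longrightarrow> plane \<theta> \<noteq> {}"
  using graph_point_in_plane by blast

lemma closed_plane: "closed (plane \<theta>)"
  unfolding plane_def
  by (intro closed_Collect_eq continuous_intros linear_continuous_on matrix_vector_mul_bounded_linear)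

lemma convex_plane: "convex (plane \<theta>)"
proof (rule convexI)
  fix x y and u v :: real
  assume "x \<in> plane \<theta>" "y \<in> plane \<theta>" and uv: "0 \<le> u" "0 \<le> v" "u + v = 1"
  then have x: "fst \<theta> + snd \<theta> *v x = x" and y: "fst \<theta> + snd \<theta> *v y = y" by (simp_all add: plane_def)
  have "u *\<^sub>R x + v *\<^sub>R y = u *\<^sub>R (fst \<theta> + snd \<theta> *v x) + v *\<^sub>R (fst \<theta> + snd \<theta> *v y)" using x y by simp
  also have "\<dots> = (u + v) *\<^sub>R fst \<theta> + snd \<theta> *v (u *\<^sub>R x + v *\<^sub>R y)"
    by (simp add: matrix_vector_right_distrib matrix_vector_mult_scaleR scaleR_add_left scaleR_add_right)
  finally show "u *\<^sub>R x + v *\<^sub>R y \<in> plane \<theta>" using uv by (simp add: plane_def)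
qed

section \<open>Points at a given distance from a family of planes\<close>

lemma infdist_subgradient:
  fixes P :: "'a::euclidean_space set"
  assumes "p \<in> P" "norm g = 1" "infdist z P = g \<bullet> (z - p)" "\<And>p'. p' \<in> P \<Longrightarrow> g \<bullet> (p' - p) \<le> 0"
  shows "infdist z P + g \<bullet> (z' - z) \<le> infdist z' P"
proof -
  have "infdist z P + g \<bullet> (z' - z) \<le> dist z' p'" if "p' \<in> P" for p'
  proof -
    have "infdist z P + g \<bullet> (z' - z) = g \<bullet> (z' - p') + g \<bullet> (p' - p)"
      unfolding assms(3) by (simp add: inner_diff_right)
    also have "\<dots> \<le> norm g * norm (z' - p')"
      using assms(4)[OF that] norm_cauchy_schwarz[of g "z' - p'"] by linarith
    finally show ?thesis using assms(2) by (simp add: dist_norm)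
  qed
  note le = this
  have "P \<noteq> {}" using assms(1) by auto
  then have "infdist z P + g \<bullet> (z' - z) \<le> (INF p'\<in>P. dist z' p')"
    using le by (intro cINF_greatest)
  then show ?thesis by (simp only: infdist_notempty[OF \<open>P \<noteq> {}\<close>, of z'])
qed

text \<open>
The distance from a proper plane is a convex function whose slope is 1 everywhere: off the plane in
the direction away from the nearest point, and on the plane along any normal.
\<close>

lemma plane_infdist_subgradient:
  fixes \<theta> :: "(real ^ 'n) \<times> (real ^ 'n ^ 'n)"
  assumes \<theta>: "\<theta> \<in> graph_params I" and "I \<noteq> UNIV"
  shows "\<exists>g. norm g = 1 \<and> (\<forall>z'. infdist z (plane \<theta>) + g \<bullet> (z' - z) \<le> infdist z' (plane \<theta>))"
proof (cases "z \<in> plane \<theta>")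
  case True
  obtain j where "j \<notin> I" using \<open>I \<noteq> UNIV\<close> by blast
  \<comment> \<open>Row \<open>j\<close> of the defining equation gives a normal of the plane; it is nonzero because
      \<open>snd \<theta> $ j $ j = 0\<close>.\<close>
  define g where "g = axis j 1 - snd \<theta> $ j"
  have "g $ j = 1" using \<theta> \<open>j \<notin> I\<close> by (simp add: g_def graph_params_def)
  then have "g \<noteq> 0" by (metis zero_index zero_neq_one)
  have orth: "g \<bullet> (p - z) = 0" if "p \<in> plane \<theta>" for p
  proof -
    have "snd \<theta> *v (p - z) = p - z"
      using that True unfolding plane_def mem_Collect_eq by (metis add_diff_cancel_left matrix_vector_mult_diff_distrib)
    then have "snd \<theta> $ j \<bullet> (p - z) = (p - z) $ j"
      by (metis matrix_mult_dot vec_lambda_beta)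
    then show ?thesis by (simp add: g_def inner_diff_left inner_axis')
  qed
  show ?thesis
  proof (intro exI[of _ "g /\<^sub>R norm g"] conjI allI)
    show "norm (g /\<^sub>R norm g) = 1" using \<open>g \<noteq> 0\<close> by simp
    show "infdist z (plane \<theta>) + (g /\<^sub>R norm g) \<bullet> (z' - z) \<le> infdist z' (plane \<theta>)" for z'
      by (rule infdist_subgradient[OF True]) (use True orth \<open>g \<noteq> 0\<close> in auto)
  qed
next
  case False
  obtain p where p: "p \<in> plane \<theta>" "infdist z (plane \<theta>) = dist z p"
    using infdist_attains_inf[OF closed_plane plane_nonempty[OF \<theta>]] by metis
  have "z \<noteq> p" using False p by auto
  define g where "g = (z - p) /\<^sub>R norm (z - p)"
  have "g \<bullet> (p' - p) \<le> 0" if "p' \<in> plane \<theta>" for p'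
  proof -
    have "\<forall>w\<in>plane \<theta>. dist z p \<le> dist z w"
      using p(2) infdist_le[of _ "plane \<theta>" z] by simp
    then have "(z - p) \<bullet> (p' - p) \<le> 0"
      by (rule any_closest_point_dot[OF convex_plane closed_plane p(1) that])
    then show ?thesis by (simp add: g_def mult_nonneg_nonpos)
  qed
  moreover have "norm g = 1" using \<open>z \<noteq> p\<close> by (simp add: g_def)
  moreover have "infdist z (plane \<theta>) = g \<bullet> (z - p)"
    using \<open>z \<noteq> p\<close> by (simp add: g_def p(2) dist_norm power2_norm_eq_inner[symmetric] power2_eq_square)
  ultimately show ?thesis using infdist_subgradient[OF p(1)] by blast
qed

text \<open>
The projection with parameter \<open>\<phi>\<close> moves the point of the first plane nearest to \<open>x\<close> into the second plane,
and it moves it only by the distance of the parameters times a factor that depends on its norm.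
\<close>

lemma infdist_plane_le:
  fixes \<theta> \<phi> :: "(real ^ 'n) \<times> (real ^ 'n ^ 'n)"
  assumes "\<theta> \<in> graph_params I" "\<phi> \<in> graph_params I"
  shows "infdist x (plane \<phi>) \<le> infdist x (plane \<theta>)
     + (1 + real CARD('n) * (norm x + infdist x (plane \<theta>))) * dist \<theta> \<phi>"
proof -
  obtain p where p: "p \<in> plane \<theta>" "infdist x (plane \<theta>) = dist x p"
    using infdist_attains_inf[OF closed_plane plane_nonempty[OF assms(1)]] by metis
  define p' where "p' = fst \<phi> + snd \<phi> *v p"
  have "p' \<in> plane \<phi>" unfolding p'_def by (rule graph_point_in_plane[OF assms(2)])
  have "p - p' = fst (\<theta> - \<phi>) + snd (\<theta> - \<phi>) *v p"
    using p(1) unfolding plane_def p'_def by (simp add: matrix_vector_mult_diff_rdistrib algebra_simps)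
  then have "dist p p' \<le> norm (fst (\<theta> - \<phi>)) + norm (snd (\<theta> - \<phi>) *v p)"
    by (simp add: dist_norm norm_triangle_ineq)
  also have "\<dots> \<le> norm (\<theta> - \<phi>) + real CARD('n) * (norm (\<theta> - \<phi>) * norm p)"
    by (intro add_mono norm_fst_le_norm order.trans[OF norm_matrix_vector_mult_le] mult_left_mono mult_right_mono norm_snd_le_norm) auto
  also have "\<dots> = (1 + real CARD('n) * norm p) * dist \<theta> \<phi>"
    by (simp add: dist_norm algebra_simps)
  also have "\<dots> \<le> (1 + real CARD('n) * (norm x + infdist x (plane \<theta>))) * dist \<theta> \<phi>"
  proof -
    have "norm p \<le> norm x + dist x p" by (simp add: dist_norm norm_triangle_sub norm_minus_commute)
    then show ?thesis unfolding p(2) by (intro mult_right_mono add_left_mono mult_left_mono) auto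
  qed
  finally have "dist p p' \<le> (1 + real CARD('n) * (norm x + infdist x (plane \<theta>))) * dist \<theta> \<phi>" .
  moreover have "infdist x (plane \<phi>) \<le> dist x p'" using \<open>p' \<in> plane \<phi>\<close> by (rule infdist_le)
  moreover have "dist x p' \<le> dist x p + dist p p'" by (rule dist_triangle)
  ultimately show ?thesis using p(2) by linarith
qed

text \<open>
The only property of \<open>h\<close> that matters is a unit subgradient at every point.  Such a vector has a
coordinate of size at least \<open>1 / N\<close>, and two points of the tube in the same column in that coordinate
direction, with the same sign, cannot be far apart: by the subgradient inequality \<open>h\<close> would otherwise
grow from one to the other by more than the width of the tube.  There are about \<open>2 ^ (l * (n - 1))\<close>
columns.
\<close>

lemma hausdorff_content_tube_le:
  fixes h :: "real ^ 'n \<Rightarrow> real" and m \<kappa> t :: real and l :: nat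
  assumes "0 \<le> m" "0 \<le> \<kappa>" "0 \<le> t"
    and subgrad: "\<And>z. \<exists>g. norm g = 1 \<and> (\<forall>z'. h z + g \<bullet> (z' - z) \<le> h z')"
  defines "N \<equiv> real CARD('n)"
  shows "hausdorff_content t {x. norm x \<le> m \<and> \<bar>h x - r\<bar> \<le> \<kappa> * (1/2) ^ l}
     \<le> ennreal (4 * N * (2 * m + 4) ^ (CARD('n) - 1) * (N * (2 * \<kappa> + N) + N) powr t
          * ((1/2) ^ l) powr (t - (N - 1)))"
proof -
  define W where "W = {x. norm x \<le> m \<and> \<bar>h x - r\<bar> \<le> \<kappa> * (1/2) ^ l}"
  define d where "d = (N * (2 * \<kappa> + N) + N) * (1/2) ^ l"
  have N1: "N \<ge> 1" by (simp add: N_def Suc_leI)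
  have d0: "0 < d" using N1 \<open>0 \<le> \<kappa>\<close> by (simp add: d_def add_nonneg_pos)
  obtain g where g: "\<And>z. norm (g z) = 1" "\<And>z z'. h z + g z \<bullet> (z' - z) \<le> h z'"
    using subgrad by metis
  define Col where "Col i = {q :: 'n \<Rightarrow> int. q i = 0 \<and> (\<forall>i'. \<bar>real_of_int (q i')\<bar> \<le> (m + 1) * 2 ^ l)}" for i
  have Col: "finite (Col i)" "real (card (Col i)) \<le> 2 * ((2 * m + 4) * 2 ^ l) ^ (CARD('n) - 1)" for i
  proof -
    let ?R = "\<lambda>i'. if i' = i then 0 else (m + 1) * 2 ^ l"
    have *: "finite (Col i) \<and> real (card (Col i)) \<le> (\<Prod>i'\<in>UNIV. 2 * ?R i' + 2)"
      by (rule card_triangular_le[where c = "\<lambda>_ _. 0" and rank = "\<lambda>_. 0"])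
        (use \<open>0 \<le> m\<close> in \<open>auto simp: Col_def\<close>)
    then show "finite (Col i)" by simp
    have "(\<Prod>i'\<in>UNIV. 2 * ?R i' + 2) = 2 * (\<Prod>i'\<in>UNIV - {i}. 2 * ?R i' + 2)"
      by (subst prod.remove[of UNIV i]) auto
    also have "(\<Prod>i'\<in>UNIV - {i}. 2 * ?R i' + 2) = (\<Prod>i'\<in>UNIV - {i}. 2 * ((m + 1) * 2 ^ l) + 2)"
      by (rule prod.cong) auto
    also have "\<dots> = (2 * ((m + 1) * 2 ^ l) + 2) ^ (CARD('n) - 1)" by simp
    also have "\<dots> \<le> ((2 * m + 4) * 2 ^ l) ^ (CARD('n) - 1)"
    proof (rule power_mono)
      have "(1::real) \<le> 2 ^ l" by simp
      then show "2 * ((m + 1) * 2 ^ l) + 2 \<le> (2 * m + 4) * 2 ^ l" by (simp add: algebra_simps)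
    qed (use \<open>0 \<le> m\<close> in auto)
    finally show "real (card (Col i)) \<le> 2 * ((2 * m + 4) * 2 ^ l) ^ (CARD('n) - 1)" using * by simp
  qed
  \<comment> \<open>A class is given by a coordinate \<open>i\<close> along which the subgradient has size at least \<open>1 / N\<close>, its sign,
      and the column of cells in direction \<open>i\<close> that contains the point.\<close>
  define J where "J = (SIGMA i:UNIV. {1, -1::real} \<times> Col i)"
  define V where "V = (\<lambda>(i, \<sigma>, q). {x \<in> W. (cell l x)(i := 0) = q \<and> 1 / N \<le> \<sigma> * g x $ i})"
  have finJ: "finite J" unfolding J_def using Col(1) by auto
  have cover: "W \<subseteq> (\<Union>j\<in>J. V j)"
  proof
    fix x assume "x \<in> W"
    have "\<exists>i. 1 / N \<le> \<bar>g x $ i\<bar>"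
    proof (rule ccontr)
      assume "\<not> ?thesis"
      then have "(\<Sum>i\<in>UNIV. \<bar>g x $ i\<bar>) < (\<Sum>i\<in>(UNIV::'n set). 1 / N)"
        by (intro sum_strict_mono) (auto simp: not_le)
      moreover have "norm (g x) \<le> (\<Sum>i\<in>UNIV. \<bar>g x $ i\<bar>)" by (rule norm_le_l1_cart)
      ultimately show False using g(1)[of x] N1 by (simp add: N_def)
    qed
    then obtain i where i: "1 / N \<le> \<bar>g x $ i\<bar>" by auto
    define \<sigma> where "\<sigma> = (if 0 \<le> g x $ i then 1 else -1::real)"
    have "(cell l x)(i := 0) \<in> Col i"
      using \<open>x \<in> W\<close> \<open>0 \<le> m\<close> cell_abs_le[of x m l] by (simp add: W_def Col_def)
    then have "(i, \<sigma>, (cell l x)(i := 0)) \<in> J" by (simp add: J_def \<sigma>_def)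
    moreover have "x \<in> V (i, \<sigma>, (cell l x)(i := 0))"
      using i \<open>x \<in> W\<close> by (cases "0 \<le> g x $ i") (auto simp: V_def \<sigma>_def)
    ultimately show "x \<in> (\<Union>j\<in>J. V j)" by blast
  qed
  have half: "dist x y \<le> d" if "x \<in> V (i, \<sigma>, q)" "y \<in> V (i, \<sigma>, q)" "(i, \<sigma>, q) \<in> J" "\<sigma> * x $ i \<le> \<sigma> * y $ i" for x y i \<sigma> q
  proof -
    have x: "x \<in> W" "1 / N \<le> \<sigma> * g x $ i" and y: "y \<in> W"
      and cells: "(cell l x)(i := 0) = (cell l y)(i := 0)" and \<sigma>: "\<sigma> = 1 \<or> \<sigma> = -1"
      using that by (auto simp: V_def J_def)
    have off: "\<bar>y $ i' - x $ i'\<bar> \<le> (1/2) ^ l" if "i' \<noteq> i" for i'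
    proof -
      have "\<lfloor>2 ^ l * x $ i'\<rfloor> = \<lfloor>2 ^ l * y $ i'\<rfloor>"
        using fun_cong[OF cells, of i'] that by (simp add: cell_def)
      then have "\<bar>2 ^ l * y $ i' - 2 ^ l * x $ i'\<bar> \<le> 1" by linarith
      then have "2 ^ l * \<bar>y $ i' - x $ i'\<bar> \<le> 1"
        by (simp add: right_diff_distrib[symmetric] abs_mult)
      then show ?thesis by (simp add: power_one_over field_simps)
    qed
    \<comment> \<open>Going from \<open>x\<close> to \<open>y\<close> follows the sign of the subgradient at \<open>x\<close>, which therefore bounds the
        increase of \<open>h\<close> from below.\<close>
    have on: "\<bar>y $ i - x $ i\<bar> = \<sigma> * (y $ i - x $ i)"
      using \<sigma> that(4) by auto
    have sum_off: "(\<Sum>i'\<in>UNIV - {i}. \<bar>y $ i' - x $ i'\<bar>) \<le> N * (1/2) ^ l"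
    proof -
      have "(\<Sum>i'\<in>UNIV - {i}. \<bar>y $ i' - x $ i'\<bar>) \<le> (\<Sum>i'\<in>UNIV - {i}. (1/2) ^ l)"
        using off by (intro sum_mono) auto
      also have "\<dots> \<le> (\<Sum>i'\<in>(UNIV::'n set). (1/2) ^ l)"
        by (intro sum_mono2) auto
      finally show ?thesis by (simp add: N_def)
    qed
    have "g x \<bullet> (y - x) = g x $ i * (y $ i - x $ i) + (\<Sum>i'\<in>UNIV - {i}. g x $ i' * (y $ i' - x $ i'))"
      unfolding inner_vec_def by (subst sum.remove[of UNIV i]) auto
    moreover have "- (N * (1/2) ^ l) \<le> (\<Sum>i'\<in>UNIV - {i}. g x $ i' * (y $ i' - x $ i'))"
    proof -
      have "\<bar>\<Sum>i'\<in>UNIV - {i}. g x $ i' * (y $ i' - x $ i')\<bar> \<le> (\<Sum>i'\<in>UNIV - {i}. \<bar>y $ i' - x $ i'\<bar>)"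
      proof (rule order.trans[OF sum_abs sum_mono])
        fix i'
        have "\<bar>g x $ i'\<bar> \<le> 1" using component_le_norm_cart[of "g x" i'] g(1)[of x] by simp
        then have "\<bar>g x $ i'\<bar> * \<bar>y $ i' - x $ i'\<bar> \<le> 1 * \<bar>y $ i' - x $ i'\<bar>" by (intro mult_right_mono) auto
        then show "\<bar>g x $ i' * (y $ i' - x $ i')\<bar> \<le> \<bar>y $ i' - x $ i'\<bar>" by (simp add: abs_mult)
      qed
      with sum_off show ?thesis by linarith
    qed
    moreover have "1 / N * \<bar>y $ i - x $ i\<bar> \<le> g x $ i * (y $ i - x $ i)"
    proof -
      have "1 / N * \<bar>y $ i - x $ i\<bar> \<le> (\<sigma> * g x $ i) * \<bar>y $ i - x $ i\<bar>"
        using x(2) by (intro mult_right_mono) auto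
      also have "\<dots> = (\<sigma> * \<sigma>) * (g x $ i * (y $ i - x $ i))" unfolding on by (simp only: mult_ac)
      also have "\<sigma> * \<sigma> = 1" using \<sigma> by auto
      finally show ?thesis by simp
    qed
    moreover have "g x \<bullet> (y - x) \<le> 2 * \<kappa> * (1/2) ^ l"
      using g(2)[of x y] x(1) y unfolding W_def by (auto simp: abs_le_iff)
    ultimately have "1 / N * \<bar>y $ i - x $ i\<bar> \<le> (2 * \<kappa> + N) * (1/2) ^ l"
      by (simp add: algebra_simps)
    then have "N * (1 / N * \<bar>y $ i - x $ i\<bar>) \<le> N * ((2 * \<kappa> + N) * (1/2) ^ l)"
      using N1 by (intro mult_left_mono) auto
    then have "\<bar>y $ i - x $ i\<bar> \<le> N * (2 * \<kappa> + N) * (1/2) ^ l"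
      using N1 by (simp add: mult.assoc)
    moreover have "norm (y - x) \<le> \<bar>y $ i - x $ i\<bar> + (\<Sum>i'\<in>UNIV - {i}. \<bar>y $ i' - x $ i'\<bar>)"
      using norm_le_l1_cart[of "y - x"] by (subst (asm) sum.remove[of UNIV i]) auto
    ultimately have "norm (y - x) \<le> N * (2 * \<kappa> + N) * (1/2) ^ l + N * (1/2) ^ l"
      using sum_off by linarith
    then show ?thesis unfolding d_def by (simp add: dist_norm norm_minus_commute distrib_right)
  qed
  have diam: "hausdorff_content t (V j) \<le> ennreal (d powr t)" if "j \<in> J" for j
  proof -
    obtain i \<sigma> q where j: "j = (i, \<sigma>, q)" by (cases j) auto
    have d: "dist x y \<le> d" if "x \<in> V j" "y \<in> V j" for x y
      using half[of x i \<sigma> q y] half[of y i \<sigma> q x] that \<open>j \<in> J\<close> unfolding j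
      by (cases "\<sigma> * x $ i \<le> \<sigma> * y $ i") (auto simp: dist_commute)
    have "V j \<subseteq> cball 0 m" unfolding j V_def W_def by auto
    then have b: "bounded (V j)" by (rule bounded_subset[rotated]) simp
    have "diameter (V j) \<le> d" using d d0 by (intro diameter_le) (auto simp: dist_norm)
    then have "diam_powr t (V j) \<le> d powr t" using d0 \<open>0 \<le> t\<close> b by (rule diam_powr_le)
    then show ?thesis using hausdorff_content_le_diam_powr[OF b, of t] ennreal_leI order.trans by blast
  qed
  have cardJ: "real (card J) \<le> 4 * N * ((2 * m + 4) * 2 ^ l) ^ (CARD('n) - 1)"
  proof -
    have "card J = (\<Sum>i\<in>(UNIV::'n set). 2 * card (Col i))"
      unfolding J_def using Col(1) by (subst card_SigmaI) (auto simp: card_cartesian_product mult_2)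
    then have "real (card J) = (\<Sum>i\<in>(UNIV::'n set). 2 * real (card (Col i)))" by simp
    also have "\<dots> \<le> (\<Sum>i\<in>(UNIV::'n set). 2 * (2 * ((2 * m + 4) * 2 ^ l) ^ (CARD('n) - 1)))"
      using Col(2) by (intro sum_mono mult_left_mono) auto
    finally show ?thesis by (simp add: N_def mult_ac)
  qed
  have "hausdorff_content t W \<le> hausdorff_content t (\<Union>j\<in>J. V j)"
    by (rule hausdorff_content_mono[OF cover])
  also have "\<dots> \<le> (\<Sum>j\<in>J. hausdorff_content t (V j))"
    by (rule hausdorff_content_finite_UN_le[OF finJ])
  also have "\<dots> \<le> (\<Sum>j\<in>J. ennreal (d powr t))" by (intro sum_mono diam)
  also have "\<dots> = ennreal (\<Sum>j\<in>J. d powr t)" by (rule sum_ennreal) simp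
  also have "\<dots> \<le> ennreal (4 * N * (2 * m + 4) ^ (CARD('n) - 1) * (N * (2 * \<kappa> + N) + N) powr t
          * ((1/2) ^ l) powr (t - (N - 1)))"
  proof (rule ennreal_leI)
    have "((1/2::real) ^ l) powr (N - 1) = 1 / (2 ^ l) ^ (CARD('n) - 1)"
    proof -
      have "N - 1 = real (CARD('n) - 1)" by (simp add: N_def Suc_leI of_nat_diff)
      then have "((1/2::real) ^ l) powr (N - 1) = ((1/2) ^ l) ^ (CARD('n) - 1)"
        by (simp only:) (rule powr_realpow, simp)
      then show ?thesis by (simp add: power_one_over)
    qed
    moreover have "((1/2::real) ^ l) powr t = ((1/2) ^ l) powr (t - (N - 1)) * ((1/2) ^ l) powr (N - 1)"
      by (simp add: powr_add[symmetric])
    moreover have "d powr t = (N * (2 * \<kappa> + N) + N) powr t * ((1/2) ^ l) powr t"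
      unfolding d_def using N1 \<open>0 \<le> \<kappa>\<close> by (intro powr_mult)
    ultimately have d_powr: "d powr t = (N * (2 * \<kappa> + N) + N) powr t
        * (((1/2) ^ l) powr (t - (N - 1)) * (1 / (2 ^ l) ^ (CARD('n) - 1)))"
      by simp
    have "(\<Sum>j\<in>J. d powr t) \<le> 4 * N * ((2 * m + 4) * 2 ^ l) ^ (CARD('n) - 1) * d powr t"
      using cardJ by (simp add: mult_right_mono)
    also have "\<dots> = 4 * N * (2 * m + 4) ^ (CARD('n) - 1) * (N * (2 * \<kappa> + N) + N) powr t
          * ((1/2) ^ l) powr (t - (N - 1))"
      unfolding d_powr by (simp add: power_mult_distrib)
    finally show "(\<Sum>j\<in>J. d powr t) \<le> 4 * N * (2 * m + 4) ^ (CARD('n) - 1) * (N * (2 * \<kappa> + N) + N) powr t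
          * ((1/2) ^ l) powr (t - (N - 1))" .
  qed
  finally show ?thesis unfolding W_def .
qed

lemma hausdorff_content_points_at_distance:
  fixes E :: "((real ^ 'n) \<times> (real ^ 'n ^ 'n)) set"
  assumes null: "hausdorff_content \<tau> E = 0" and "0 < \<tau>"
    and E: "E \<subseteq> graph_params I" and "I \<noteq> UNIV" and "0 \<le> m" "0 \<le> r"
  shows "hausdorff_content (\<tau> + (real CARD('n) - 1)) {x. norm x \<le> m \<and> (\<exists>\<theta>\<in>E. infdist x (plane \<theta>) = r)} = 0"
proof -
  define N where "N = real CARD('n)"
  define R where "R = {(\<theta> :: (real ^ 'n) \<times> (real ^ 'n ^ 'n), x). norm x \<le> m \<and> infdist x (plane \<theta>) = r}"
  have N1: "N \<ge> 1" by (simp add: N_def Suc_leI)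
  define \<kappa>1 where "\<kappa>1 = 1 + N * (m + r)"
  define \<kappa> where "\<kappa> = 1 + N * (m + (r + \<kappa>1))"
  have \<kappa>10: "0 \<le> \<kappa>1" using N1 assms by (simp add: \<kappa>1_def)
  then have \<kappa>: "\<kappa>1 \<le> \<kappa>" "0 \<le> \<kappa>" using N1 assms by (simp_all add: \<kappa>_def \<kappa>1_def)
  define K where "K = 4 * N * (2 * m + 4) ^ (CARD('n) - 1) * (N * (2 * \<kappa> + N) + N) powr (\<tau> + (N - 1))"
  have "0 \<le> K" unfolding K_def using N1 \<open>0 \<le> m\<close> by (intro mult_nonneg_nonneg) auto
  have "hausdorff_content (\<tau> + (N - 1)) (R `` E) = 0"
  proof (rule hausdorff_content_image_eq_0[OF null \<open>0 < \<tau>\<close> \<open>0 \<le> K\<close>])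
    fix U l assume U: "U \<subseteq> E" "U \<noteq> {}" "bounded U" "diameter U \<le> (1/2) ^ l"
    then obtain \<phi> where "\<phi> \<in> U" by auto
    then have \<phi>: "\<phi> \<in> graph_params I" using U E by auto
    have "R `` U \<subseteq> {x. norm x \<le> m \<and> \<bar>infdist x (plane \<phi>) - r\<bar> \<le> \<kappa> * (1/2) ^ l}"
    proof
      fix x assume "x \<in> R `` U"
      then obtain \<theta> where "\<theta> \<in> U" and x: "norm x \<le> m" "infdist x (plane \<theta>) = r"
        by (auto simp: R_def)
      then have \<theta>: "\<theta> \<in> graph_params I" using U E by auto
      have D: "dist \<theta> \<phi> \<le> (1/2) ^ l"
        using diameter_bounded_bound[OF U(3) \<open>\<theta> \<in> U\<close> \<open>\<phi> \<in> U\<close>] U(4) by linarith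
      have "infdist x (plane \<phi>) \<le> r + (1 + N * (norm x + r)) * dist \<theta> \<phi>"
        using infdist_plane_le[OF \<theta> \<phi>, of x] x(2) by (simp add: N_def)
      also have "\<dots> \<le> r + \<kappa>1 * (1/2) ^ l"
        unfolding \<kappa>1_def using N1 x(1) D assms by (intro add_left_mono mult_mono mult_left_mono add_right_mono) auto
      finally have 1: "infdist x (plane \<phi>) \<le> r + \<kappa>1 * (1/2) ^ l" .
      also have "\<dots> \<le> r + \<kappa>1" using \<kappa>10 by (simp add: mult_left_le power_le_one)
      finally have 2: "infdist x (plane \<phi>) \<le> r + \<kappa>1" .
      have "r \<le> infdist x (plane \<phi>) + (1 + N * (norm x + infdist x (plane \<phi>))) * dist \<phi> \<theta>"
        using infdist_plane_le[OF \<phi> \<theta>, of x] x(2) by (simp add: N_def)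
      also have "\<dots> \<le> infdist x (plane \<phi>) + \<kappa> * (1/2) ^ l"
        unfolding \<kappa>_def using N1 x(1) D 2 assms \<kappa>10
        by (intro add_left_mono mult_mono mult_left_mono add_mono) (auto simp: dist_commute)
      finally have 3: "r \<le> infdist x (plane \<phi>) + \<kappa> * (1/2) ^ l" .
      have "\<kappa>1 * (1/2) ^ l \<le> \<kappa> * (1/2) ^ l" using \<kappa>(1) by (intro mult_right_mono) auto
      then have "\<bar>infdist x (plane \<phi>) - r\<bar> \<le> \<kappa> * (1/2) ^ l"
        using 1 3 by linarith
      then show "x \<in> {x. norm x \<le> m \<and> \<bar>infdist x (plane \<phi>) - r\<bar> \<le> \<kappa> * (1/2) ^ l}"
        using x(1) by simp
    qed
    then have "hausdorff_content (\<tau> + (N - 1)) (R `` U)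
      \<le> hausdorff_content (\<tau> + (N - 1)) {x. norm x \<le> m \<and> \<bar>infdist x (plane \<phi>) - r\<bar> \<le> \<kappa> * (1/2) ^ l}"
      by (rule hausdorff_content_mono)
    also have "\<dots> \<le> ennreal (K * ((1/2) ^ l) powr (\<tau> + (N - 1) - (N - 1)))"
      unfolding K_def N_def
      by (rule hausdorff_content_tube_le[OF \<open>0 \<le> m\<close> \<kappa>(2)])
        (use \<open>0 < \<tau>\<close> N1 plane_infdist_subgradient[OF \<phi> \<open>I \<noteq> UNIV\<close>] in \<open>auto simp: N_def\<close>)
    finally show "hausdorff_content (\<tau> + (N - 1)) (R `` U) \<le> ennreal (K * ((1/2) ^ l) powr \<tau>)" by simp
  qed
  moreover have "R `` E = {x. norm x \<le> m \<and> (\<exists>\<theta>\<in>E. infdist x (plane \<theta>) = r)}"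
    by (auto simp: R_def)
  ultimately show ?thesis by (simp add: N_def)
qed

section \<open>Cells shared by two planes\<close>

definition plane_cells :: "nat \<Rightarrow> real \<Rightarrow> (real ^ 'n) \<times> (real ^ 'n ^ 'n) \<Rightarrow> ('n \<Rightarrow> int) set" where
  "plane_cells l m \<theta> = cell l ` (plane \<theta> \<inter> cball 0 m)"

text \<open>
\<open>2 ^ l\<close> times coordinate \<open>i\<close> of the point of the plane above the lattice point \<open>q / 2 ^ l\<close>.
\<close>

definition scaled_height :: "nat \<Rightarrow> (real ^ 'n) \<times> (real ^ 'n ^ 'n) \<Rightarrow> 'n \<Rightarrow> ('n \<Rightarrow> int) \<Rightarrow> real" where
  "scaled_height l \<theta> i q = 2 ^ l * fst \<theta> $ i + (\<Sum>j\<in>UNIV. snd \<theta> $ i $ j * q j)"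

lemma scaled_height_error_le:
  fixes \<theta> :: "(real ^ 'n) \<times> (real ^ 'n ^ 'n)"
  assumes "q \<in> plane_cells l m \<theta>" "norm \<theta> \<le> M"
  shows "\<bar>real_of_int (q i) - scaled_height l \<theta> i q\<bar> \<le> 1 + real CARD('n) * M"
proof -
  obtain z where z: "z \<in> plane \<theta>" "q = cell l z"
    using assms(1) by (auto simp: plane_cells_def)
  define f where "f j = 2 ^ l * z $ j - q j" for j
  have f: "0 \<le> f j" "f j \<le> 1" for j
    unfolding f_def z(2) cell_def by linarith+
  have q: "real_of_int (q j) = 2 ^ l * z $ j - f j" for j by (simp add: f_def)
  have "z $ i = fst \<theta> $ i + (\<Sum>j\<in>UNIV. snd \<theta> $ i $ j * z $ j)"
    using arg_cong[of _ _ "\<lambda>v. v $ i", OF z(1)[unfolded plane_def mem_Collect_eq]]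
    by (simp add: matrix_vector_mult_def)
  then have "2 ^ l * z $ i = 2 ^ l * fst \<theta> $ i + (\<Sum>j\<in>UNIV. snd \<theta> $ i $ j * (2 ^ l * z $ j))"
    by (simp add: distrib_left sum_distrib_left mult_ac)
  then have "q i - scaled_height l \<theta> i q = (\<Sum>j\<in>UNIV. snd \<theta> $ i $ j * f j) - f i"
    unfolding scaled_height_def q by (simp add: right_diff_distrib sum_subtractf)
  moreover have "\<bar>\<Sum>j\<in>UNIV. snd \<theta> $ i $ j * f j\<bar> \<le> (\<Sum>j\<in>(UNIV::'n set). M)"
  proof (rule order.trans[OF sum_abs sum_mono])
    fix j
    have "\<bar>snd \<theta> $ i $ j\<bar> \<le> M"
      using matrix_entry_le_norm[of "snd \<theta>" i j] norm_snd_le_norm[of \<theta>] assms(2) by linarith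
    then have "\<bar>snd \<theta> $ i $ j\<bar> * f j \<le> M * 1"
      using f[of j] by (intro mult_mono) auto
    then show "\<bar>snd \<theta> $ i $ j * f j\<bar> \<le> M" using f[of j] by (simp add: abs_mult)
  qed
  ultimately show ?thesis using f[of i] by (auto simp: abs_le_iff)
qed

lemma scaled_height_cong:
  assumes "\<theta> \<in> graph_params I" "\<And>j. j \<in> I \<Longrightarrow> q j = q' j"
  shows "scaled_height l \<theta> i q = scaled_height l \<theta> i q'"
proof -
  have "snd \<theta> $ i $ j * q j = snd \<theta> $ i $ j * q' j" for j
    using assms(1) assms(2)[of j] by (cases "j \<in> I") (simp_all add: graph_params_def)
  then show ?thesis by (simp only: scaled_height_def)
qed

text \<open>
At the corner of a common cell the two graphs differ by \<open>O((1/2) ^ l)\<close>.  If the parameters have distance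
at least about \<open>(1/2) ^ j\<close>, then some linear coefficient of the difference of the two affine maps is that
large (unless \<open>2 ^ j\<close> is comparable to \<open>2 ^ l\<close>), and so one of the free coordinates has only \<open>O(2 ^ j)\<close> instead of \<open>O(2 ^ l)\<close> values once the others are
chosen.  The factor \<open>2 ^ l\<close> stands on the left because the truncated exponent \<open>card I - 1\<close> would be wrong for
\<open>card I = 0\<close>.
\<close>

lemma card_common_cells_le:
  fixes I :: "'n::finite set" and m lam :: real
  assumes "0 \<le> m" "0 < lam"
  shows "\<exists>K::real. 0 < K \<and> (\<forall>\<theta>\<in>graph_params I. \<forall>\<phi>\<in>graph_params I. norm \<theta> \<le> m \<longrightarrow> norm \<phi> \<le> m \<longrightarrow>
     (\<forall>l j. j \<le> l \<longrightarrow> (j = l \<or> lam * (1/2) ^ Suc j \<le> dist \<theta> \<phi>) \<longrightarrow>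
       real (card (plane_cells l m \<theta> \<inter> plane_cells l m \<phi>)) * 2 ^ l \<le> K * (2 ^ l) ^ card I * 2 ^ j))"
proof -
  define N where "N = real CARD('n)"
  define K1 where "K1 = 1 + N * m"
  define c1 where "c1 = 2 * N * K1"
  define c2 where "c2 = N * (N * (m + 2))"
  define c3 where "c3 = 8 * c2 * K1 / lam"
  define C where "C = 2 * (m + 1) + 2 + (2 * K1 + 2) + 2 * c3"
  have N: "N \<ge> 1" by (simp add: N_def Suc_leI)
  have K1: "K1 \<ge> 1" using N \<open>0 \<le> m\<close> by (simp add: K1_def)
  then have c1: "c1 \<ge> 0" using N by (simp add: c1_def)
  have c2: "c2 > 0" using N \<open>0 \<le> m\<close> by (simp add: c2_def)
  note pos = K1 c1 c2
  have frac: "0 \<le> c3" using pos \<open>0 < lam\<close> by (simp add: c3_def)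
  have C: "C > 0" unfolding C_def using \<open>0 \<le> m\<close> pos(1) frac by simp
  define K where "K = C ^ CARD('n) * (1 + 4 * c1 / lam)"
  have "K > 0" unfolding K_def using C pos assms by (intro mult_pos_pos add_pos_nonneg) auto
  show ?thesis
  proof (intro exI[of _ K] conjI ballI impI allI \<open>K > 0\<close>)
    fix \<theta> \<phi> :: "(real ^ 'n) \<times> (real ^ 'n ^ 'n)" and l j :: nat
    assume \<theta>: "\<theta> \<in> graph_params I" "norm \<theta> \<le> m" and \<phi>: "\<phi> \<in> graph_params I" "norm \<phi> \<le> m"
      and "j \<le> l" and far: "j = l \<or> lam * (1/2) ^ Suc j \<le> dist \<theta> \<phi>"
    define S where "S = plane_cells l m \<theta> \<inter> plane_cells l m \<phi>"
    have range: "\<bar>real_of_int (q i)\<bar> \<le> (m + 1) * 2 ^ l" if "q \<in> S" for q i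
      using that cell_abs_le by (auto simp: S_def plane_cells_def)
    have d\<theta>: "\<bar>real_of_int (q i) - scaled_height l \<theta> i q\<bar> \<le> K1" if "q \<in> S" for q i
      using that \<theta> unfolding K1_def N_def S_def by (intro scaled_height_error_le) auto
    have d\<phi>: "\<bar>real_of_int (q i) - scaled_height l \<phi> i q\<bar> \<le> K1" if "q \<in> S" for q i
      using that \<phi> unfolding K1_def N_def S_def by (intro scaled_height_error_le) auto
    have gen: "real (card S) \<le> C ^ CARD('n) * (\<Prod>i\<in>UNIV. t i)"
      if "\<And>i q q'. (\<And>i'. rank i' < rank i \<Longrightarrow> q i' = q' i') \<Longrightarrow> c i q = c i q'"
        "\<And>q i. q \<in> S \<Longrightarrow> \<bar>real_of_int (q i) - c i q\<bar> \<le> R i" "\<And>i. 0 \<le> R i" "\<And>i. 2 * R i + 2 \<le> C * t i"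
      for rank :: "'n \<Rightarrow> nat" and c R t
    proof -
      have "real (card S) \<le> (\<Prod>i\<in>UNIV. 2 * R i + 2)"
        using card_triangular_le[where rank = rank and c = c and R = R and S = S, OF that(1) that(2) that(3)] by simp
      also have "\<dots> \<le> (\<Prod>i\<in>UNIV. C * t i)"
        using that(3,4) by (intro prod_mono conjI) (auto intro: add_nonneg_nonneg)
      also have "\<dots> = C ^ CARD('n) * (\<Prod>i\<in>UNIV. t i)" by (simp add: prod.distrib)
      finally show ?thesis .
    qed
    have l1: "(1::real) \<le> 2 ^ l" and j1: "(1::real) \<le> 2 ^ j" by simp_all
    have RI: "2 * ((m + 1) * 2 ^ l) + 2 \<le> C * 2 ^ l"
    proof -
      have "2 * ((m + 1) * 2 ^ l) + 2 \<le> (2 * (m + 1) + 2) * 2 ^ l" using l1 by (simp add: algebra_simps)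
      also have "\<dots> \<le> C * 2 ^ l" using pos frac assms unfolding C_def by (intro mult_right_mono) auto
      finally show ?thesis .
    qed
    have RJ: "2 * K1 + 2 \<le> C" using pos frac assms unfolding C_def by simp
    have "real (card S) * 2 ^ l \<le> K * (2 ^ l) ^ card I * 2 ^ j"
    proof (cases "2 ^ l \<le> (1 + 4 * c1 / lam) * 2 ^ j")
      case True
      \<comment> \<open>The scale \<open>(1/2) ^ j\<close> is comparable to the mesh \<open>(1/2) ^ l\<close>, and the number of cells met by a
          single plane is good enough: the coordinates in \<open>I\<close> are free, the others are determined.\<close>
      have "real (card S) \<le> C ^ CARD('n) * (\<Prod>i\<in>UNIV. if i \<in> I then 2 ^ l else 1)"
      proof (rule gen[of "\<lambda>i. if i \<in> I then 0 else 1" "\<lambda>i q. if i \<in> I then 0 else scaled_height l \<theta> i q"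
            "\<lambda>i. if i \<in> I then (m + 1) * 2 ^ l else K1"])
        fix i and q q' :: "'n \<Rightarrow> int"
        assume *: "\<And>i'. (if i' \<in> I then 0 else (1::nat)) < (if i \<in> I then 0 else 1) \<Longrightarrow> q i' = q' i'"
        have "scaled_height l \<theta> i q = scaled_height l \<theta> i q'" if "i \<notin> I"
        proof (rule scaled_height_cong[OF \<theta>(1)])
          show "q j = q' j" if "j \<in> I" for j using *[of j] \<open>i \<notin> I\<close> that by simp
        qed
        then show "(if i \<in> I then 0 else scaled_height l \<theta> i q) = (if i \<in> I then 0 else scaled_height l \<theta> i q')" by simp
      next
        fix q i assume "q \<in> S"
        then show "\<bar>real_of_int (q i) - (if i \<in> I then 0 else scaled_height l \<theta> i q)\<bar>
            \<le> (if i \<in> I then (m + 1) * 2 ^ l else K1)"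
          using range[of q i] d\<theta>[of q i] by simp
      next
        show "0 \<le> (if i \<in> I then (m + 1) * 2 ^ l else K1)" for i
          using \<open>0 \<le> m\<close> K1 by simp
      next
        show "2 * (if i \<in> I then (m + 1) * 2 ^ l else K1) + 2 \<le> C * (if i \<in> I then 2 ^ l else 1)" for i
          using RI RJ by simp
      qed
      also have "(\<Prod>i\<in>UNIV. if i \<in> I then 2 ^ l else (1::real)) = (2 ^ l) ^ card I"
        by (simp add: prod.If_cases)
      finally have "real (card S) * 2 ^ l \<le> (C ^ CARD('n) * (2 ^ l) ^ card I) * ((1 + 4 * c1 / lam) * 2 ^ j)"
        using True C by (intro mult_mono) auto
      then show ?thesis by (simp add: K_def mult_ac)
    next
      case False
      have "j \<noteq> l"
      proof
        assume "j = l"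
        have "1 * 2 ^ j \<le> (1 + 4 * c1 / lam) * 2 ^ j" using pos assms by (intro mult_right_mono) auto
        with False \<open>j = l\<close> show False by simp
      qed
      then have D: "lam * (1/2) ^ Suc j \<le> dist \<theta> \<phi>" using far by simp
      define a where "a i = fst \<theta> $ i - fst \<phi> $ i" for i
      define b where "b i i' = snd \<theta> $ i $ i' - snd \<phi> $ i $ i'" for i i'
      have boff: "b i i' = 0" if "i' \<notin> I" for i i'
        using that \<theta>(1) \<phi>(1) by (simp add: graph_params_def b_def)
      have diff: "scaled_height l \<theta> i q - scaled_height l \<phi> i q = 2 ^ l * a i + (\<Sum>i'\<in>UNIV. b i i' * q i')" for i q
        unfolding scaled_height_def a_def b_def by (simp add: algebra_simps sum_subtractf)
      have diff_le: "\<bar>2 ^ l * a i + (\<Sum>i'\<in>UNIV. b i i' * q i')\<bar> \<le> 2 * K1" if "q \<in> S" for i q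
        using d\<theta>[OF that, of i] d\<phi>[OF that, of i] unfolding diff[symmetric] by linarith
      \<comment> \<open>The largest entry by which the linear parts differ.  A common cell forces the planes to be close
          at one point, so that the linear parts account for the distance of the parameters.\<close>
      define \<beta> where "\<beta> = Max (range (\<lambda>(i, i'). \<bar>b i i'\<bar>))"
      have \<beta>_ge: "\<bar>b i i'\<bar> \<le> \<beta>" for i i'
        unfolding \<beta>_def by (rule Max_ge) (auto intro: image_eqI[of _ _ "(i, i')"])
      have "\<beta> \<in> range (\<lambda>(i, i'). \<bar>b i i'\<bar>)" unfolding \<beta>_def by (rule Max_in) auto
      then obtain i0 j0 where \<beta>: "\<beta> = \<bar>b j0 i0\<bar>" by auto
      have "\<beta> \<ge> 0" using \<beta> by simp
      show ?thesis
      proof (cases "S = {}")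
        case True
        then show ?thesis using \<open>K > 0\<close> by simp
      next
        case False
        then obtain q where "q \<in> S" by auto
        have a_le: "\<bar>a i\<bar> \<le> 2 * K1 * (1/2) ^ l + N * ((m + 1) * \<beta>)" for i
        proof -
          have "\<bar>\<Sum>i'\<in>UNIV. b i i' * q i'\<bar> \<le> (\<Sum>i'\<in>(UNIV::'n set). \<beta> * ((m + 1) * 2 ^ l))"
          proof (rule order.trans[OF sum_abs sum_mono])
            show "\<bar>b i i' * q i'\<bar> \<le> \<beta> * ((m + 1) * 2 ^ l)" for i'
              unfolding abs_mult using \<beta>_ge range[OF \<open>q \<in> S\<close>] \<open>\<beta> \<ge> 0\<close> by (intro mult_mono) auto
          qed
          then have "2 ^ l * \<bar>a i\<bar> \<le> 2 * K1 + N * (\<beta> * ((m + 1) * 2 ^ l))"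
            using diff_le[OF \<open>q \<in> S\<close>, of i] abs_mult[of "2 ^ l" "a i"] by (simp add: N_def)
          then show ?thesis by (simp add: field_simps power_one_over)
        qed
        have "norm (fst \<theta> - fst \<phi>) \<le> (\<Sum>i\<in>UNIV. \<bar>(fst \<theta> - fst \<phi>) $ i\<bar>)" by (rule norm_le_l1_cart)
        also have "\<dots> \<le> (\<Sum>i\<in>(UNIV::'n set). 2 * K1 * (1/2) ^ l + N * ((m + 1) * \<beta>))"
          using a_le by (intro sum_mono) (simp add: a_def)
        finally have "norm (fst \<theta> - fst \<phi>) \<le> N * (2 * K1 * (1/2) ^ l + N * ((m + 1) * \<beta>))"
          by (simp add: N_def)
        moreover have "norm (snd \<theta> - snd \<phi>) \<le> N * (N * \<beta>)"
          unfolding N_def using \<beta>_ge by (intro norm_matrix_le_entries) (simp add: b_def)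
        moreover have "dist \<theta> \<phi> \<le> norm (fst \<theta> - fst \<phi>) + norm (snd \<theta> - snd \<phi>)"
          unfolding dist_norm by (metis fst_diff snd_diff norm_Pair_le prod.collapse)
        ultimately have "dist \<theta> \<phi> \<le> c1 * (1/2) ^ l + c2 * \<beta>"
          unfolding c1_def c2_def by (simp add: algebra_simps)
        then have "lam * (1/2) ^ Suc j \<le> c1 * (1/2) ^ l + c2 * \<beta>" using D by simp
        moreover have "c1 * (1/2) ^ l < lam / 4 * (1/2) ^ j"
        proof -
          have "4 * c1 / lam * 2 ^ j \<le> (1 + 4 * c1 / lam) * 2 ^ j" by (intro mult_right_mono) auto
          then have "4 * c1 / lam * 2 ^ j < 2 ^ l"
            using \<open>\<not> 2 ^ l \<le> (1 + 4 * c1 / lam) * 2 ^ j\<close> by linarith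
          then have "4 * c1 * 2 ^ j < lam * 2 ^ l" using \<open>lam > 0\<close> by (simp add: pos_divide_less_eq mult_ac)
          then have "4 * c1 * 2 ^ j / 2 ^ l < lam" by (simp add: pos_divide_less_eq)
          then have "4 * c1 / 2 ^ l < lam / 2 ^ j" by (simp add: pos_less_divide_eq mult_ac)
          then show ?thesis by (simp add: power_one_over)
        qed
        ultimately have \<beta>_big: "lam / 4 * (1/2) ^ j \<le> c2 * \<beta>" by simp
        moreover have "0 < lam / 4 * (1/2) ^ j" using \<open>lam > 0\<close> by simp
        ultimately have "0 < c2 * \<beta>" by linarith
        then have "\<beta> > 0" using pos by (simp add: zero_less_mult_iff)
        then have "i0 \<in> I" and b0: "b j0 i0 \<noteq> 0" using \<beta> boff by auto
        have invb: "2 * K1 / \<beta> \<le> c3 * 2 ^ j"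
        proof -
          have "lam \<le> 4 * c2 * \<beta> * 2 ^ j"
            using mult_right_mono[OF \<beta>_big, of "2 ^ j"] by (simp add: power_one_over)
          then have "2 * K1 * lam \<le> 2 * K1 * (4 * c2 * \<beta> * 2 ^ j)"
            using K1 by (intro mult_left_mono) auto
          then have "2 * K1 \<le> 8 * c2 * K1 * 2 ^ j * \<beta> / lam"
            using \<open>lam > 0\<close> by (simp add: pos_le_divide_eq mult_ac)
          also have "\<dots> = c3 * 2 ^ j * \<beta>" by (simp add: c3_def)
          finally show ?thesis using \<open>\<beta> > 0\<close> by (simp add: pos_divide_le_eq)
        qed
        \<comment> \<open>The coordinates in \<open>I - {i0}\<close> are free; then row \<open>j0\<close> of the difference of the two planes, where
            \<open>q i0\<close> has the coefficient \<open>\<beta>\<close> up to sign, pins down \<open>q i0\<close> up to \<open>O(1 / \<beta>)\<close>; the other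
            coordinates are then determined up to a constant by the first plane.\<close>
        define r where "r i = (if i = i0 then 1 else if i \<in> I then 0 else (2::nat))" for i
        define c where "c i q = (if i = i0 then - (2 ^ l * a j0 + (\<Sum>i'\<in>UNIV - {i0}. b j0 i' * q i')) / b j0 i0
            else if i \<in> I then 0 else scaled_height l \<theta> i q)" for i and q :: "'n \<Rightarrow> int"
        define R where "R i = (if i = i0 then c3 * 2 ^ j else if i \<in> I then (m + 1) * 2 ^ l else K1)" for i
        define t where "t i = (if i = i0 then 2 ^ j else if i \<in> I then 2 ^ l else (1::real))" for i
        have prod_t: "(\<Prod>i\<in>UNIV. t i) * 2 ^ l = (2 ^ l) ^ card I * 2 ^ j"
        proof -
          have I0: "(UNIV - {i0}) \<inter> I = I - {i0}" by auto
          have "(\<Prod>i\<in>UNIV. t i) * 2 ^ l = t i0 * (\<Prod>i\<in>UNIV - {i0}. t i) * 2 ^ l"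
            by (subst prod.remove[of UNIV i0]) auto
          also have "(\<Prod>i\<in>UNIV - {i0}. t i) = (\<Prod>i\<in>UNIV - {i0}. if i \<in> I - {i0} then 2 ^ l else 1)"
            by (rule prod.cong) (auto simp: t_def)
          also have "\<dots> = (2 ^ l) ^ card (I - {i0})"
            by (simp add: prod.If_cases I0)
          also have "t i0 * (2 ^ l) ^ card (I - {i0}) * 2 ^ l = (2 ^ l) ^ Suc (card (I - {i0})) * 2 ^ j"
            by (simp only: t_def refl if_True power_Suc mult_ac)
          also have "Suc (card (I - {i0})) = card I"
            using \<open>i0 \<in> I\<close> card_Suc_Diff1[of I i0] by simp
          finally show ?thesis .
        qed
        have "real (card S) \<le> C ^ CARD('n) * (\<Prod>i\<in>UNIV. t i)"
        proof (rule gen[of r c R])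
          fix i and q q' :: "'n \<Rightarrow> int" assume *: "\<And>i'. r i' < r i \<Longrightarrow> q i' = q' i'"
          show "c i q = c i q'"
          proof (cases "i = i0")
            case True
            have "(\<Sum>i'\<in>UNIV - {i0}. b j0 i' * q i') = (\<Sum>i'\<in>UNIV - {i0}. b j0 i' * q' i')"
            proof (rule sum.cong)
              fix i' assume "i' \<in> UNIV - {i0}"
              then show "b j0 i' * q i' = b j0 i' * q' i'"
                using *[of i'] boff[of i' j0] True by (cases "i' \<in> I") (simp_all add: r_def)
            qed simp
            then show ?thesis by (simp add: c_def True)
          next
            case False
            have "scaled_height l \<theta> i q = scaled_height l \<theta> i q'" if "i \<notin> I"
            proof (rule scaled_height_cong[OF \<theta>(1)])
              have "r j < r i" if "j \<in> I" for j using that \<open>i \<notin> I\<close> False by (simp add: r_def)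
              then show "q j = q' j" if "j \<in> I" for j using * that by simp
            qed
            then show ?thesis by (simp add: c_def False)
          qed
        next
          fix q i assume "q \<in> S"
          show "\<bar>real_of_int (q i) - c i q\<bar> \<le> R i"
          proof (cases "i = i0")
            case True
            have "(\<Sum>i'\<in>UNIV. b j0 i' * q i') = b j0 i0 * q i0 + (\<Sum>i'\<in>UNIV - {i0}. b j0 i' * q i')"
              by (rule sum.remove) auto
            then have "q i0 - c i0 q = (2 ^ l * a j0 + (\<Sum>i'\<in>UNIV. b j0 i' * q i')) / b j0 i0"
              using b0 by (simp add: c_def field_simps)
            then have "\<bar>q i0 - c i0 q\<bar> = \<bar>2 ^ l * a j0 + (\<Sum>i'\<in>UNIV. b j0 i' * q i')\<bar> / \<beta>"
              by (simp add: \<beta>)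
            also have "\<dots> \<le> 2 * K1 / \<beta>"
              using diff_le[OF \<open>q \<in> S\<close>, of j0] \<open>\<beta> > 0\<close> by (intro divide_right_mono) auto
            finally show ?thesis using invb True by (simp add: R_def)
          next
            case False
            then show ?thesis using range[OF \<open>q \<in> S\<close>] d\<theta>[OF \<open>q \<in> S\<close>] by (simp add: c_def R_def)
          qed
        next
          show "0 \<le> R i" for i using assms pos frac by (simp add: R_def)
        next
          fix i
          have "2 * (c3 * 2 ^ j) + 2 \<le> (2 * c3 + 2) * 2 ^ j"
            using j1 by (simp add: algebra_simps)
          also have "\<dots> \<le> C * 2 ^ j" using pos frac assms unfolding C_def by (intro mult_right_mono) auto
          finally show "2 * R i + 2 \<le> C * t i" using RI RJ by (simp add: R_def t_def)
        qed
        then have "real (card S) * 2 ^ l \<le> C ^ CARD('n) * (\<Prod>i\<in>UNIV. t i) * 2 ^ l"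
          by (intro mult_right_mono) auto
        also have "\<dots> = C ^ CARD('n) * ((2 ^ l) ^ card I * 2 ^ j)"
          by (simp only: mult.assoc prod_t)
        also have "\<dots> = (C ^ CARD('n) * 1) * ((2 ^ l) ^ card I * 2 ^ j)" by simp
        also have "\<dots> \<le> K * ((2 ^ l) ^ card I * 2 ^ j)"
          unfolding K_def using C pos assms by (intro mult_right_mono mult_left_mono) auto
        finally show ?thesis by (simp add: mult.assoc)
      qed
    qed
    then show "real (card (plane_cells l m \<theta> \<inter> plane_cells l m \<phi>)) * 2 ^ l \<le> K * (2 ^ l) ^ card I * 2 ^ j"
      unfolding S_def .
  qed
qed

section \<open>A second moment bound for incidences\<close>

text \<open>
A finite substitute for the Frostman measure: the points are given weight greedily, one after another.
\<close>

lemma tight_weights_exist: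
  fixes cap :: "'i \<Rightarrow> real" and Q :: "'i \<Rightarrow> 'a set"
  assumes "finite X" "finite I" "\<And>i. i \<in> I \<Longrightarrow> 0 \<le> cap i"
    and "\<And>x. x \<in> X \<Longrightarrow> \<exists>i\<in>I. x \<in> Q i"
  shows "\<exists>w :: 'a \<Rightarrow> real. (\<forall>x. 0 \<le> w x) \<and> (\<forall>i\<in>I. sum w (X \<inter> Q i) \<le> cap i) \<and>
     (\<forall>x\<in>X. \<exists>i\<in>I. x \<in> Q i \<and> sum w (X \<inter> Q i) = cap i)"
  using assms(1,4)
proof (induction X rule: finite_induct)
  case empty
  then show ?case using assms(3) by (intro exI[of _ "\<lambda>_. 0"]) auto
next
  case (insert x X)
  then obtain w :: "'a \<Rightarrow> real" where w: "\<forall>x. 0 \<le> w x" "\<forall>i\<in>I. sum w (X \<inter> Q i) \<le> cap i"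
    "\<forall>x\<in>X. \<exists>i\<in>I. x \<in> Q i \<and> sum w (X \<inter> Q i) = cap i"
    by auto
  define J where "J = {i \<in> I. x \<in> Q i}"
  define slack where "slack i = cap i - sum w (X \<inter> Q i)" for i
  have J: "finite J" "J \<noteq> {}" using \<open>finite I\<close> insert.prems[of x] by (auto simp: J_def)
  \<comment> \<open>The new point receives as much weight as the constraints through it allow; this makes one of
      them an equality, and a constraint that is already an equality leaves no weight to give.\<close>
  define m where "m = Min (slack ` J)"
  have "m \<in> slack ` J" unfolding m_def using J by (intro Min_in) auto
  then obtain i0 where i0: "i0 \<in> J" "m = slack i0" by auto
  have m_le: "m \<le> slack i" if "i \<in> J" for i
    unfolding m_def using J that by (intro Min_le) auto
  have m0: "0 \<le> m" using i0 w(2) by (auto simp: J_def slack_def)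
  have same: "sum (w(x := m)) (X \<inter> Q i) = sum w (X \<inter> Q i)" for i
    using insert.hyps by (intro sum.cong) auto
  have new: "sum (w(x := m)) (insert x X \<inter> Q i) = sum w (X \<inter> Q i) + (if x \<in> Q i then m else 0)" for i
    using insert.hyps same[of i] by (auto simp: Int_insert_left)
  show ?case
  proof (intro exI[of _ "w(x := m)"] conjI ballI allI)
    show "0 \<le> (w(x := m)) y" for y using m0 w(1) by simp
    show "sum (w(x := m)) (insert x X \<inter> Q i) \<le> cap i" if "i \<in> I" for i
      unfolding new using m_le[of i] w(2) that by (auto simp: J_def slack_def)
    show "\<exists>i\<in>I. y \<in> Q i \<and> sum (w(x := m)) (insert x X \<inter> Q i) = cap i" if y: "y \<in> insert x X" for y
    proof (cases "y = x")
      case True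
      then show ?thesis unfolding new using i0 by (intro bexI[of _ i0]) (auto simp: J_def slack_def)
    next
      case False
      then obtain i where i: "i \<in> I" "y \<in> Q i" "sum w (X \<inter> Q i) = cap i"
        using w(3) y by auto
      have "x \<notin> Q i \<or> m = 0"
        using m_le[of i] m0 i by (auto simp: J_def slack_def)
      then show ?thesis unfolding new using i by (intro bexI[of _ i]) auto
    qed
  qed
qed

lemma weighted_incidence_bound:
  fixes w :: "'a \<Rightarrow> real" and c :: "'a \<Rightarrow> 'g set" and h E :: real
  assumes "finite X" "finite G" "\<And>x. x \<in> X \<Longrightarrow> c x \<subseteq> G" "\<And>x. 0 \<le> w x"
    and h: "0 \<le> h" "\<And>x. x \<in> X \<Longrightarrow> h \<le> card (c x)"
    and E: "0 \<le> E" "\<And>y. y \<in> X \<Longrightarrow> (\<Sum>x\<in>X. w x * card (c x \<inter> c y)) \<le> E"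
  shows "sum w X * h\<^sup>2 \<le> card G * E"
proof -
  define S where "S g = (\<Sum>x | x \<in> X \<and> g \<in> c x. w x)" for g
  have S_eq: "S g = (\<Sum>x\<in>X. w x * of_bool (g \<in> c x))" for g
    using \<open>finite X\<close> unfolding S_def by (simp add: sum.inter_filter of_bool_def if_distrib cong: if_cong)
  have cardc: "(\<Sum>g\<in>G. of_bool (g \<in> A)) = real (card A)" if "A \<subseteq> G" for A
  proof -
    have "(\<Sum>g\<in>G. of_bool (g \<in> A)) = real (card (G \<inter> A))"
      using \<open>finite G\<close> by (simp add: of_bool_def sum.If_cases)
    then show ?thesis using that by (simp add: Int_absorb1)
  qed
  let ?W = "sum w X"
  have "?W * h \<le> (\<Sum>x\<in>X. w x * card (c x))"
    unfolding sum_distrib_right using h assms(4) by (intro sum_mono mult_left_mono) auto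
  also have "\<dots> = (\<Sum>x\<in>X. \<Sum>g\<in>G. w x * of_bool (g \<in> c x))"
    using assms(3) cardc by (simp add: sum_distrib_left[symmetric])
  also have "\<dots> = (\<Sum>g\<in>G. S g)"
    unfolding S_eq by (rule sum.swap)
  finally have 1: "?W * h \<le> (\<Sum>g\<in>G. S g)" .
  have "(\<Sum>g\<in>G. (S g)\<^sup>2) = (\<Sum>g\<in>G. \<Sum>x\<in>X. \<Sum>y\<in>X. w x * w y * of_bool (g \<in> c x \<inter> c y))"
    unfolding S_eq power2_eq_square sum_product
    by (intro sum.cong refl) (auto simp: of_bool_def)
  also have "\<dots> = (\<Sum>x\<in>X. \<Sum>y\<in>X. \<Sum>g\<in>G. w x * w y * of_bool (g \<in> c x \<inter> c y))"
    by (subst sum.swap) (intro sum.cong refl sum.swap)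
  also have "\<dots> = (\<Sum>x\<in>X. \<Sum>y\<in>X. w x * w y * card (c x \<inter> c y))"
  proof (intro sum.cong refl)
    fix x y assume "x \<in> X" "y \<in> X"
    then have "c x \<inter> c y \<subseteq> G" using assms(3) by blast
    from cardc[OF this] show "(\<Sum>g\<in>G. w x * w y * of_bool (g \<in> c x \<inter> c y)) = w x * w y * card (c x \<inter> c y)"
      by (simp add: sum_distrib_left[symmetric])
  qed
  also have "\<dots> = (\<Sum>y\<in>X. w y * (\<Sum>x\<in>X. w x * card (c x \<inter> c y)))"
    unfolding sum_distrib_left by (subst sum.swap) (simp add: mult_ac)
  also have "\<dots> \<le> (\<Sum>y\<in>X. w y * E)"
    using E assms(4) by (intro sum_mono mult_left_mono) auto
  also have "\<dots> = ?W * E" by (simp add: sum_distrib_right)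
  finally have 2: "(\<Sum>g\<in>G. (S g)\<^sup>2) \<le> ?W * E" .
  have W0: "0 \<le> ?W" using assms(4) by (simp add: sum_nonneg)
  \<comment> \<open>Cauchy--Schwarz over the cells.\<close>
  have "(?W * h)\<^sup>2 \<le> (\<Sum>g\<in>G. S g)\<^sup>2"
    using 1 W0 h(1) by (intro power_mono) auto
  also have "\<dots> = (\<Sum>g\<in>G. 1 * S g)\<^sup>2" by simp
  also have "\<dots> \<le> (\<Sum>g\<in>G. 1\<^sup>2) * (\<Sum>g\<in>G. (S g)\<^sup>2)"
    by (rule Cauchy_Schwarz_ineq_sum)
  also have "\<dots> \<le> card G * (?W * E)"
    using 2 by (simp add: mult_left_mono)
  finally have 3: "?W * (?W * h\<^sup>2) \<le> ?W * (card G * E)"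
    by (simp add: power2_eq_square mult_ac)
  show ?thesis
  proof (cases "?W = 0")
    case True
    then show ?thesis using \<open>0 \<le> E\<close> by simp
  next
    case False
    with 3 W0 show ?thesis by (simp add: mult_le_cancel_left)
  qed
qed

text \<open>
Put weights on \<open>X\<close> that obey the \<open>\<tau>\<close>-dimensional bound on all balls of dyadic radius down to level \<open>l\<close> and
that attain it on some ball around every point.  By the Vitali covering lemma the total weight then
bounds the \<open>\<tau>\<close>-dimensional size of a cover of \<open>X\<close>.  By Cauchy--Schwarz the total weight is at most the
energy, that is the weighted number of cells shared with a fixed point; a point at distance about
\<open>lam * (1/2) ^ j\<close> shares at most \<open>M * 2 ^ j\<close> cells and such points have weight at most \<open>((1/2) ^ j) powr \<tau>\<close>.
\<close>

lemma weighted_cover_of_incidences: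
  fixes X :: "'a::euclidean_space set" and c :: "'a \<Rightarrow> 'g set" and l :: nat and M lam \<tau> h :: real
  assumes "finite X" "finite G" "\<And>x. x \<in> X \<Longrightarrow> c x \<subseteq> G" and "0 < lam" "\<tau> \<le> 1" "0 \<le> M"
    and h: "0 \<le> h" "\<And>x. x \<in> X \<Longrightarrow> h \<le> card (c x)"
    and diam: "\<And>x y. x \<in> X \<Longrightarrow> y \<in> X \<Longrightarrow> dist x y < lam"
    and meet: "\<And>x y j. x \<in> X \<Longrightarrow> y \<in> X \<Longrightarrow> j \<le> l \<Longrightarrow> j = l \<or> lam * (1/2) ^ Suc j \<le> dist x y \<Longrightarrow>
       card (c x \<inter> c y) \<le> M * 2 ^ j"
  obtains T :: "('a \<times> nat) set" where "T \<subseteq> X \<times> {..l}"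
    "X \<subseteq> (\<Union>(x, j)\<in>T. ball x (5 * lam * (1/2) ^ j))"
    "(\<Sum>(x, j)\<in>T. ((1/2) ^ j) powr \<tau>) * h\<^sup>2 \<le> card G * (M * (real l + 1) * 2 powr (l * (1 - \<tau>)))"
proof -
  define I where "I = X \<times> {..l}"
  define r where "r i = lam * (1/2) ^ snd i" for i :: "'a \<times> nat"
  define cap where "cap i = ((1/2::real) ^ snd i) powr \<tau>" for i :: "'a \<times> nat"
  define Q where "Q i = ball (fst i) (r i)" for i
  have finI: "finite I" using \<open>finite X\<close> by (simp add: I_def)
  have "\<exists>i\<in>I. x \<in> Q i" if "x \<in> X" for x
    using that \<open>0 < lam\<close> by (intro bexI[of _ "(x, 0)"]) (auto simp: I_def Q_def r_def)
  moreover have "0 \<le> cap i" for i by (simp add: cap_def)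
  ultimately obtain w where w: "\<And>x. 0 \<le> w x" "\<And>i. i \<in> I \<Longrightarrow> sum w (X \<inter> Q i) \<le> cap i"
    "\<And>x. x \<in> X \<Longrightarrow> \<exists>i\<in>I. x \<in> Q i \<and> sum w (X \<inter> Q i) = cap i"
    using tight_weights_exist[OF \<open>finite X\<close> finI, of cap Q] by blast
  \<comment> \<open>The balls whose constraint is an equality cover \<open>X\<close>; in a disjoint subfamily their caps add up
      to at most the total weight.\<close>
  define tight where "tight = {i \<in> I. sum w (X \<inter> Q i) = cap i}"
  have "X \<subseteq> (\<Union>i\<in>tight. ball (fst i) (r i))"
    using w(3) unfolding tight_def Q_def by blast
  moreover have "0 < r i \<and> r i \<le> lam" for i
    using \<open>0 < lam\<close> by (auto simp: r_def power_le_one mult_left_le)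
  ultimately obtain T where T: "T \<subseteq> tight"
     "pairwise (\<lambda>i j. disjnt (ball (fst i) (r i)) (ball (fst j) (r j))) T"
     "X \<subseteq> (\<Union>i\<in>T. ball (fst i) (5 * r i))"
    by (rule Vitali_covering_lemma_balls)
  have finT: "finite T" using T(1) finI by (auto simp: tight_def intro: finite_subset)
  have "(\<Sum>i\<in>T. cap i) = (\<Sum>i\<in>T. sum w (X \<inter> Q i))"
    using T(1) by (intro sum.cong) (auto simp: tight_def)
  also have "\<dots> = sum w (\<Union>i\<in>T. X \<inter> Q i)"
  proof (rule sum.UNION_disjoint[symmetric])
    show "\<forall>i\<in>T. \<forall>j\<in>T. i \<noteq> j \<longrightarrow> X \<inter> Q i \<inter> (X \<inter> Q j) = {}"
      using T(2) unfolding pairwise_def disjnt_def Q_def by blast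
  qed (use finT \<open>finite X\<close> in auto)
  also have "\<dots> \<le> sum w X"
    using \<open>finite X\<close> w(1) by (intro sum_mono2) auto
  finally have cap_le: "(\<Sum>i\<in>T. cap i) \<le> sum w X" .
  have energy: "(\<Sum>x\<in>X. w x * card (c x \<inter> c y)) \<le> M * (real l + 1) * 2 powr (l * (1 - \<tau>))" if "y \<in> X" for y
  proof -
    have pt: "real (card (c x \<inter> c y)) \<le> (\<Sum>j\<le>l. M * 2 ^ j * of_bool (x \<in> Q (y, j)))" if "x \<in> X" for x
    proof -
      define J where "J = {j. j \<le> l \<and> dist x y < lam * (1/2) ^ j}"
      have J: "finite J" "0 \<in> J" using diam \<open>x \<in> X\<close> \<open>y \<in> X\<close> by (auto simp: J_def)
      \<comment> \<open>The dyadic scale of the distance between \<open>x\<close> and \<open>y\<close>, cut off at level \<open>l\<close>.\<close>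
      define j where "j = Max J"
      have j: "j \<in> J" unfolding j_def using J by (intro Max_in) auto
      have "Suc j \<notin> J" using Max_ge[OF J(1), of "Suc j"] by (auto simp: j_def)
      then have "j = l \<or> lam * (1/2) ^ Suc j \<le> dist x y" using j by (auto simp: J_def)
      then have "card (c x \<inter> c y) \<le> M * 2 ^ j"
        using meet \<open>x \<in> X\<close> \<open>y \<in> X\<close> j by (auto simp: J_def)
      also have "\<dots> = M * 2 ^ j * of_bool (x \<in> Q (y, j))"
        using j by (simp add: J_def Q_def r_def dist_commute)
      also have "\<dots> \<le> (\<Sum>j\<le>l. M * 2 ^ j * of_bool (x \<in> Q (y, j)))"
        using j \<open>0 \<le> M\<close> by (intro member_le_sum) (auto simp: J_def)
      finally show ?thesis .
    qed
    have "(\<Sum>x\<in>X. w x * card (c x \<inter> c y))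
        \<le> (\<Sum>x\<in>X. w x * (\<Sum>j\<le>l. M * 2 ^ j * of_bool (x \<in> Q (y, j))))"
      by (intro sum_mono mult_left_mono pt w(1))
    also have "\<dots> = (\<Sum>j\<le>l. M * 2 ^ j * (\<Sum>x\<in>X. w x * of_bool (x \<in> Q (y, j))))"
      unfolding sum_distrib_left by (subst sum.swap) (simp add: mult_ac)
    also have "\<dots> \<le> (\<Sum>j\<le>l. M * 2 powr (l * (1 - \<tau>)))"
    proof (rule sum_mono)
      fix j assume "j \<in> {..l}"
      have "(\<Sum>x\<in>X. w x * of_bool (x \<in> Q (y, j))) = sum w (X \<inter> Q (y, j))"
        using \<open>finite X\<close> by (simp add: of_bool_def sum.inter_restrict if_distrib cong: if_cong)
      also have "\<dots> \<le> cap (y, j)"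
        using \<open>y \<in> X\<close> \<open>j \<in> {..l}\<close> by (intro w(2)) (auto simp: I_def)
      also have "\<dots> = 2 powr (- (real j * \<tau>))"
        by (simp add: cap_def power_one_over powr_realpow[symmetric] powr_minus_divide[symmetric] powr_powr)
      \<comment> \<open>Every scale contributes at most as much as the finest one; here \<open>\<tau> \<le> 1\<close> enters.\<close>
      finally have "M * 2 ^ j * (\<Sum>x\<in>X. w x * of_bool (x \<in> Q (y, j))) \<le> M * 2 ^ j * 2 powr (- (real j * \<tau>))"
        using \<open>0 \<le> M\<close> by (intro mult_left_mono) auto
      also have "\<dots> = M * 2 powr (real j * (1 - \<tau>))"
        by (simp add: powr_realpow[symmetric] powr_add[symmetric] algebra_simps)
      also have "\<dots> \<le> M * 2 powr (real l * (1 - \<tau>))"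
        using \<open>0 \<le> M\<close> \<open>\<tau> \<le> 1\<close> \<open>j \<in> {..l}\<close> by (intro mult_left_mono powr_mono mult_right_mono) auto
      finally show "M * 2 ^ j * (\<Sum>x\<in>X. w x * of_bool (x \<in> Q (y, j))) \<le> M * 2 powr (real l * (1 - \<tau>))" .
    qed
    also have "\<dots> = M * (real l + 1) * 2 powr (l * (1 - \<tau>))" by simp
    finally show ?thesis .
  qed
  have "sum w X * h\<^sup>2 \<le> card G * (M * (real l + 1) * 2 powr (l * (1 - \<tau>)))"
    by (rule weighted_incidence_bound[OF \<open>finite X\<close> \<open>finite G\<close> assms(3) w(1) h _ energy])
      (use \<open>0 \<le> M\<close> in auto)
  moreover have "(\<Sum>i\<in>T. cap i) * h\<^sup>2 \<le> sum w X * h\<^sup>2"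
    using cap_le by (intro mult_right_mono) auto
  ultimately have "(\<Sum>(x, j)\<in>T. ((1/2) ^ j) powr \<tau>) * h\<^sup>2 \<le> card G * (M * (real l + 1) * 2 powr (l * (1 - \<tau>)))"
    by (simp add: cap_def case_prod_unfold)
  moreover have "X \<subseteq> (\<Union>(x, j)\<in>T. ball x (5 * lam * (1/2) ^ j))"
    using T(3) by (simp add: r_def case_prod_unfold mult.assoc)
  moreover have "T \<subseteq> X \<times> {..l}"
    using T(1) by (auto simp: tight_def I_def)
  ultimately show ?thesis using that[of T] by blast
qed

section \<open>Planes with large slices\<close>

text \<open>
The level at which a plane meets many cells depends on the plane.  Covering every point at infinitely
many levels by one family of cells makes a single family serve all planes.
\<close>

lemma hausdorff_null_imp_grid_cover:
  fixes B :: "(real ^ 'n) set"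
  assumes "hausdorff_content s B = 0" "0 < s"
  shows "\<exists>(G :: nat \<Rightarrow> ('n \<Rightarrow> int) set) A. 0 \<le> A \<and> (\<forall>l. finite (G l)) \<and>
    (\<forall>l. real (card (G l)) \<le> A * 2 powr (l * s)) \<and> (\<forall>z\<in>B. \<exists>\<^sub>\<infinity>l. cell l z \<in> G l)"
proof -
  have "\<exists>U lev. B = (\<Union>i::nat. U i) \<and> (\<forall>i. bounded (U i)) \<and> (\<forall>i. diameter (U i) \<le> (1/2) ^ lev i)
      \<and> (\<forall>N. (\<Sum>i<N. ((1/2) ^ lev i) powr s) \<le> (1/2) ^ L)" for L :: nat
  proof -
    have "(0::real) < (1/2) ^ L" by simp
    from hausdorff_content_0_dyadic_cover[OF assms this] show ?thesis by metis
  qed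
  then obtain U and lev :: "nat \<Rightarrow> nat \<Rightarrow> nat"
    where U: "\<And>L. B = (\<Union>i::nat. U L i)" "\<And>L i. bounded (U L i)" "\<And>L i. diameter (U L i) \<le> (1/2) ^ lev L i"
      and sum: "\<And>L N. (\<Sum>i<N. ((1/2) ^ lev L i) powr s) \<le> (1/2) ^ L"
    by metis
  have half: "((1/2::real) ^ l) powr s = 2 powr (- (real l * s))" for l
    by (simp add: power_one_over powr_realpow[symmetric] powr_minus_divide[symmetric] powr_powr)
  \<comment> \<open>For every \<open>L\<close> there is a cover of total size at most \<open>(1/2) ^ L\<close>, and \<open>P l\<close> collects the pieces of scale
      \<open>l\<close> from all of them: their total number is controlled by the sum of a geometric series.\<close>
  define P where "P l = {p. lev (fst p) (snd p) = l}" for l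
  have card_F: "real (card F) \<le> 2 * 2 powr (l * s)" if F: "finite F" "F \<subseteq> P l" for F l
  proof -
    have "finite (fst ` F \<union> snd ` F)" using F by auto
    then obtain N where N: "\<And>n. n \<in> fst ` F \<union> snd ` F \<Longrightarrow> n < N"
      using finite_nat_set_iff_bounded by metis
    have "real (card F) * 2 powr (- (real l * s)) = (\<Sum>p\<in>F. ((1/2) ^ lev (fst p) (snd p)) powr s)"
      using F by (subst half) (auto simp: P_def subset_eq)
    also have "\<dots> \<le> (\<Sum>p\<in>{..<N} \<times> {..<N}. ((1/2) ^ lev (fst p) (snd p)) powr s)"
    proof (rule sum_mono2)
      show "F \<subseteq> {..<N} \<times> {..<N}"
      proof
        fix p assume "p \<in> F"
        then have "fst p < N" "snd p < N" using N by blast+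
        then show "p \<in> {..<N} \<times> {..<N}" by (simp add: mem_Times_iff)
      qed
    qed auto
    also have "\<dots> = (\<Sum>L<N. \<Sum>i<N. ((1/2) ^ lev L i) powr s)"
      by (simp add: sum.cartesian_product case_prod_unfold)
    also have "\<dots> \<le> (\<Sum>L<N. (1/2) ^ L)" by (intro sum_mono sum)
    also have "(\<Sum>L<N. (1/2::real) ^ L) = 2 - 2 * (1/2) ^ N" by (induction N) auto
    also have "\<dots> \<le> 2" by simp
    finally show ?thesis by (simp add: powr_minus field_simps)
  qed
  have finP: "finite (P l)" for l
  proof (rule ccontr)
    assume inf: "infinite (P l)"
    obtain n :: nat where n: "2 * 2 powr (l * s) < n" using reals_Archimedean2 by blast
    obtain F where "finite F" "card F = n" "F \<subseteq> P l" using infinite_arbitrarily_large[OF inf] by blast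
    with card_F[of F l] n show False by simp
  qed
  define G where "G l = (\<Union>p\<in>P l. cell l ` U (fst p) (snd p))" for l
  have small: "finite (cell l ` U (fst p) (snd p)) \<and> real (card (cell l ` U (fst p) (snd p))) \<le> 4 ^ CARD('n)"
    if "p \<in> P l" for p l
    using U(2,3) that by (intro finite_card_cells_of_small_set) (auto simp: P_def)
  show ?thesis
  proof (intro exI[of _ G] exI[of _ "4 ^ CARD('n) * 2"] conjI allI ballI)
    show "finite (G l)" for l unfolding G_def using finP small by blast
    show "real (card (G l)) \<le> 4 ^ CARD('n) * 2 * 2 powr (l * s)" for l
    proof -
      have "card (G l) \<le> (\<Sum>p\<in>P l. card (cell l ` U (fst p) (snd p)))"
        unfolding G_def by (rule card_UN_le[OF finP])
      then have "real (card (G l)) \<le> (\<Sum>p\<in>P l. real (card (cell l ` U (fst p) (snd p))))"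
        by (metis of_nat_le_iff of_nat_sum)
      also have "\<dots> \<le> (\<Sum>p\<in>P l. 4 ^ CARD('n))" using small by (intro sum_mono) blast
      also have "\<dots> = 4 ^ CARD('n) * real (card (P l))" by simp
      also have "\<dots> \<le> 4 ^ CARD('n) * (2 * 2 powr (l * s))"
        using card_F[OF finP] by (intro mult_left_mono) auto
      finally show ?thesis by simp
    qed
    show "\<exists>\<^sub>\<infinity>l. cell l z \<in> G l" if "z \<in> B" for z
      unfolding INFM_nat_le
    proof
      fix M :: nat
      \<comment> \<open>A cover of total size at most \<open>(1/2) ^ L\<close> has no piece coarser than level \<open>L / s\<close>.\<close>
      define L where "L = nat \<lceil>real M * s\<rceil>"
      have L: "real M * s \<le> real L" unfolding L_def using \<open>0 < s\<close> by linarith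
      obtain i where i: "z \<in> U L i" using \<open>z \<in> B\<close> U(1)[of L] by auto
      have "((1/2::real) ^ lev L i) powr s \<le> (\<Sum>i<Suc i. ((1/2) ^ lev L i) powr s)"
        by (intro member_le_sum) auto
      also have "\<dots> \<le> (1/2) ^ L" by (rule sum)
      finally have "2 powr (- (real (lev L i) * s)) \<le> 2 powr (- real L)"
        unfolding half by (simp add: power_one_over powr_realpow[symmetric] powr_minus_divide)
      then have "real L \<le> real (lev L i) * s" by (subst (asm) powr_le_cancel_iff) auto
      with L have "real M * s \<le> real (lev L i) * s" by linarith
      then have "M \<le> lev L i" using \<open>0 < s\<close> by simp
      moreover have "cell (lev L i) z \<in> G (lev L i)"
        unfolding G_def using i by (intro UN_I[of "(L, i)"]) (auto simp: P_def)
      ultimately show "\<exists>n\<ge>M. cell n z \<in> G n" by blast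
    qed
  qed auto
qed

text \<open>
If the set met fewer than \<open>2 powr (l * a)\<close> of the cells at all fine levels, then these cells would show that
it is \<open>a'\<close>-null.
\<close>

lemma infinitely_many_levels_with_many_cells:
  fixes A :: "(real ^ 'n) set"
  assumes "hausdorff_content a' A \<noteq> 0" "a < a'" "0 \<le> a'"
    and fin: "\<And>l. finite (G l)" and inf: "\<And>z. z \<in> A \<Longrightarrow> \<exists>\<^sub>\<infinity>l. cell l z \<in> G l"
  shows "\<exists>\<^sub>\<infinity>l. 2 powr (real l * a) \<le> real (card (cell l ` A \<inter> G l))"
proof (cases "a' = 0")
  case True
  then obtain z where "z \<in> A" using assms(1) by (auto simp: hausdorff_content_0_eq_0_iff)
  show ?thesis
  proof (rule INFM_mono[OF inf[OF \<open>z \<in> A\<close>]])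
    fix l assume "cell l z \<in> G l"
    then have "cell l ` A \<inter> G l \<noteq> {}" using \<open>z \<in> A\<close> by auto
    then have "1 \<le> card (cell l ` A \<inter> G l)" using fin[of l] by (simp add: Suc_leI card_gt_0_iff)
    moreover have "2 powr (real l * a) \<le> 2 powr 0"
      using \<open>a < a'\<close> True by (intro powr_mono) (auto intro: mult_nonneg_nonpos)
    ultimately show "2 powr (real l * a) \<le> real (card (cell l ` A \<inter> G l))" by simp
  qed
next
  case False
  show ?thesis
  proof (rule ccontr)
    assume "\<not> ?thesis"
    then obtain L where L: "\<And>l. l \<ge> L \<Longrightarrow> real (card (cell l ` A \<inter> G l)) < 2 powr (real l * a)"
      unfolding INFM_nat_le by (meson not_le)
    define T where "T l = (if L \<le> l then cell l ` A \<inter> G l else {})" for l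
    let ?n = "real CARD('n)"
    have "hausdorff_content a' A = 0"
    proof (rule hausdorff_content_limsup_eq_0)
      show "finite (T l)" for l using fin by (simp add: T_def)
      show "bounded {z :: real ^ 'n. cell l z = q}" for l q by (rule cell_fibre_bounded)
      show "(\<Sum>q\<in>T l. diam_powr a' {z :: real ^ 'n. cell l z = q}) \<le> ?n powr a' * (2 powr (a - a')) ^ l" for l
      proof -
        have "(\<Sum>q\<in>T l. diam_powr a' {z :: real ^ 'n. cell l z = q}) \<le> (\<Sum>q\<in>T l. ?n powr a' * ((1/2) ^ l) powr a')"
          using \<open>0 \<le> a'\<close> by (intro sum_mono diam_powr_cell_le)
        also have "\<dots> = real (card (T l)) * (?n powr a' * ((1/2) ^ l) powr a')" by simp
        also have "\<dots> \<le> 2 powr (real l * a) * (?n powr a' * ((1/2) ^ l) powr a')"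
          using L[of l] by (intro mult_right_mono) (auto simp: T_def)
        also have "((1/2::real) ^ l) powr a' = 2 powr (- (real l * a'))"
          by (simp add: power_one_over powr_realpow[symmetric] powr_minus_divide[symmetric] powr_powr)
        also have "2 powr (real l * a) * (?n powr a' * 2 powr (- (real l * a'))) = ?n powr a' * (2 powr (a - a')) ^ l"
          by (simp add: powr_realpow[symmetric] powr_add[symmetric] powr_powr algebra_simps)
        finally show ?thesis .
      qed
      show "summable (\<lambda>l. ?n powr a' * (2 powr (a - a')) ^ l)"
        using \<open>a < a'\<close> by (intro summable_mult summable_geometric) (simp add: powr_less_one)
      show "\<exists>\<^sub>\<infinity>l. \<exists>q\<in>T l. z \<in> {z. cell l z = q}" if "z \<in> A" for z
        unfolding INFM_nat_le
      proof
        fix M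
        obtain l where "l \<ge> max L M" "cell l z \<in> G l"
          using inf[OF \<open>z \<in> A\<close>] unfolding INFM_nat_le by blast
        then show "\<exists>l\<ge>M. \<exists>q\<in>T l. z \<in> {z. cell l z = q}"
          using \<open>z \<in> A\<close> by (intro exI[of _ l]) (auto simp: T_def)
      qed
    qed
    with assms(1) show False by simp
  qed
qed

lemma bounded_finite_net:
  fixes S :: "'a::heine_borel set"
  assumes "bounded S" "0 < e"
  shows "\<exists>X. finite X \<and> X \<subseteq> S \<and> S \<subseteq> (\<Union>x\<in>X. ball x e)"
proof -
  have "compact (closure S)" using assms(1) by (simp add: compact_closure)
  moreover have "closure S \<subseteq> (\<Union>x\<in>S. ball x e)"
  proof
    fix y assume "y \<in> closure S"
    then obtain x where "x \<in> S" "dist x y < e" using assms(2) by (auto simp: closure_approachable)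
    then show "y \<in> (\<Union>x\<in>S. ball x e)" by auto
  qed
  ultimately obtain X where "X \<subseteq> S" "finite X" "closure S \<subseteq> (\<Union>x\<in>X. ball x e)"
    using compactE_image[of "closure S" S "\<lambda>x. ball x e"] by auto
  then show ?thesis using closure_subset[of S] by (intro exI[of _ X]) auto
qed

text \<open>
At level \<open>l\<close> the second moment bound is applied to a finite net of the parameters whose planes meet many
of the chosen cells.  It yields a cover of total size \<open>O(l * 2 powr (- l * \<eta>))\<close> with \<open>\<eta> > 0\<close> the gap in the
hypothesis on \<open>s\<close>, and every parameter with a large slice is covered at infinitely many levels.
\<close>

lemma large_slice_params_null:
  fixes B :: "(real ^ 'n) set" and I :: "'n set"
  assumes null: "hausdorff_content s B = 0" and "0 < s" and \<tau>: "0 < \<tau>" "\<tau> \<le> 1"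
    and s: "s < 2 * a + \<tau> - real (card I)" and a': "a < a'" "0 \<le> a'" and "0 \<le> m"
  shows "hausdorff_content \<tau> {\<theta> \<in> graph_params I. norm \<theta> \<le> m \<and>
      hausdorff_content a' (plane \<theta> \<inter> cball 0 m \<inter> B) \<noteq> 0} = 0"
    (is "hausdorff_content \<tau> ?E = 0")
proof -
  obtain G :: "nat \<Rightarrow> ('n \<Rightarrow> int) set" and A where "0 \<le> A" and G: "\<forall>l. finite (G l)"
    "\<forall>l. real (card (G l)) \<le> A * 2 powr (l * s)" "\<forall>z\<in>B. \<exists>\<^sub>\<infinity>l. cell l z \<in> G l"
    using hausdorff_null_imp_grid_cover[OF null \<open>0 < s\<close>] by (elim exE conjE)
  note G = G[rule_format]
  \<comment> \<open>Any two parameters in question are at distance less than \<open>lam\<close>.\<close>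
  define lam where "lam = 2 * m + 1"
  have "0 < lam" using \<open>0 \<le> m\<close> by (simp add: lam_def)
  obtain K where "0 < K" and K: "\<forall>\<theta>\<in>graph_params I. \<forall>\<phi>\<in>graph_params I. norm \<theta> \<le> m \<longrightarrow> norm \<phi> \<le> m \<longrightarrow>
     (\<forall>l j. j \<le> l \<longrightarrow> (j = l \<or> lam * (1/2) ^ Suc j \<le> dist \<theta> \<phi>) \<longrightarrow>
       real (card (plane_cells l m \<theta> \<inter> plane_cells l m \<phi>)) * 2 ^ l \<le> K * (2 ^ l) ^ card I * 2 ^ j)"
    using card_common_cells_le[OF \<open>0 \<le> m\<close> \<open>0 < lam\<close>, of I] by (elim exE conjE)
  define c where "c l \<theta> = cell l ` (plane \<theta> \<inter> cball 0 m \<inter> B) \<inter> G l" for l \<theta>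
  define E where "E l = {\<theta> \<in> ?E. 2 powr (real l * a) \<le> real (card (c l \<theta>))}" for l
  define \<eta> where "\<eta> = 2 * a + \<tau> - real (card I) - s"
  have "\<eta> > 0" using s by (simp add: \<eta>_def)
  define C where "C = (12 * lam) powr \<tau> * (A * K)"
  define covers where "covers l T \<longleftrightarrow> finite T \<and> E l \<subseteq> (\<Union>p\<in>T. ball (fst p) (6 * lam * (1/2) ^ snd p)) \<and>
      (\<Sum>p\<in>T. diam_powr \<tau> (ball (fst p) (6 * lam * (1/2) ^ snd p))) \<le> C * (real (Suc l) * (2 powr (- \<eta>)) ^ l)" for l T
  have single: "\<exists>T. covers l T" for l
  proof -
    have "E l \<subseteq> cball 0 m" by (auto simp: E_def)
    then have bdd: "bounded (E l)" by (rule bounded_subset[rotated]) simp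
    have "0 < lam * (1/2) ^ l" using \<open>0 < lam\<close> by simp
    from bounded_finite_net[OF bdd this]
    obtain X where X: "finite X" "X \<subseteq> E l" "E l \<subseteq> (\<Union>x\<in>X. ball x (lam * (1/2) ^ l))"
      by (elim exE conjE)
    \<comment> \<open>The counting bound for the cells shared by two planes at distance about \<open>lam * (1/2) ^ j\<close> is
        \<open>M * 2 ^ j\<close>.\<close>
    define M where "M = K * (2 ^ l) ^ card I / 2 ^ l"
    define h where "h = 2 powr (real l * a)"
    have X_E: "\<theta> \<in> graph_params I" "norm \<theta> \<le> m" "h \<le> real (card (c l \<theta>))" if "\<theta> \<in> X" for \<theta>
      using that X(2) by (auto simp: E_def h_def)
    have meet: "real (card (c l \<theta> \<inter> c l \<phi>)) \<le> M * 2 ^ j"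
      if "\<theta> \<in> X" "\<phi> \<in> X" "j \<le> l" "j = l \<or> lam * (1/2) ^ Suc j \<le> dist \<theta> \<phi>" for \<theta> \<phi> j
    proof -
      have "finite (cell l ` cball (0 :: real ^ 'n) m)"
        using finite_card_cells_of_ball[OF \<open>0 \<le> m\<close>] by blast
      then have "finite (plane_cells l m \<theta>)"
        unfolding plane_cells_def by (rule finite_subset[rotated]) auto
      then have "card (c l \<theta> \<inter> c l \<phi>) \<le> card (plane_cells l m \<theta> \<inter> plane_cells l m \<phi>)"
        by (intro card_mono) (auto simp: c_def plane_cells_def)
      then have "real (card (c l \<theta> \<inter> c l \<phi>)) * 2 ^ l
          \<le> real (card (plane_cells l m \<theta> \<inter> plane_cells l m \<phi>)) * 2 ^ l"
        by (intro mult_right_mono) auto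
      also have "\<dots> \<le> K * (2 ^ l) ^ card I * 2 ^ j"
        using X_E that by (intro K[rule_format]) auto
      finally show ?thesis by (simp add: M_def field_simps)
    qed
    have diam: "dist \<theta> \<phi> < lam" if "\<theta> \<in> X" "\<phi> \<in> X" for \<theta> \<phi>
      using X_E(2)[OF that(1)] X_E(2)[OF that(2)] norm_triangle_ineq4[of \<theta> \<phi>] by (simp add: dist_norm lam_def)
    have "0 \<le> M" "0 \<le> h" using \<open>0 < K\<close> by (simp_all add: M_def h_def)
    have sub: "c l \<theta> \<subseteq> G l" for \<theta> by (simp add: c_def)
    obtain T where T: "T \<subseteq> X \<times> {..l}"
      "X \<subseteq> (\<Union>(x, j)\<in>T. ball x (5 * lam * (1/2) ^ j))"
      "(\<Sum>(x, j)\<in>T. ((1/2) ^ j) powr \<tau>) * h\<^sup>2 \<le> card (G l) * (M * (real l + 1) * 2 powr (l * (1 - \<tau>)))"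
      by (rule weighted_cover_of_incidences[where c = "c l", OF X(1) G(1) sub \<open>0 < lam\<close> \<tau>(2)
            \<open>0 \<le> M\<close> \<open>0 \<le> h\<close> X_E(3) diam meet])
    have "finite T" using T(1) X(1) by (auto intro: finite_subset)
    have cover: "E l \<subseteq> (\<Union>p\<in>T. ball (fst p) (6 * lam * (1/2) ^ snd p))"
    proof
      fix \<theta> assume "\<theta> \<in> E l"
      then obtain x where x: "x \<in> X" "dist x \<theta> < lam * (1/2) ^ l" using X(3) by auto
      then obtain y j where y: "(y, j) \<in> T" "dist y x < 5 * lam * (1/2) ^ j" using T(2) by auto
      have "(1/2::real) ^ l \<le> (1/2) ^ j" using T(1) y(1) by (intro power_decreasing) auto
      then have "lam * (1/2) ^ l \<le> lam * (1/2) ^ j" using \<open>0 < lam\<close> by simp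
      then have "dist y \<theta> < 6 * lam * (1/2) ^ j"
        using x(2) y(2) dist_triangle[of y \<theta> x] by linarith
      then show "\<theta> \<in> (\<Union>p\<in>T. ball (fst p) (6 * lam * (1/2) ^ snd p))"
        using y(1) by (intro UN_I[of "(y, j)"]) auto
    qed
    have dp: "diam_powr \<tau> (ball x (6 * lam * (1/2) ^ j)) \<le> (12 * lam) powr \<tau> * ((1/2) ^ j) powr \<tau>"
      for x :: "(real ^ 'n) \<times> (real ^ 'n ^ 'n)" and j
    proof -
      have "diam_powr \<tau> (ball x (6 * lam * (1/2) ^ j)) \<le> (12 * lam * (1/2) ^ j) powr \<tau>"
        using \<open>0 < lam\<close> \<tau> by (intro diam_powr_le) (auto simp: diameter_ball)
      then show ?thesis using \<open>0 < lam\<close> by (simp add: powr_mult)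
    qed
    have "(\<Sum>p\<in>T. diam_powr \<tau> (ball (fst p) (6 * lam * (1/2) ^ snd p)))
        \<le> (\<Sum>p\<in>T. (12 * lam) powr \<tau> * ((1/2) ^ snd p) powr \<tau>)"
      by (intro sum_mono dp)
    also have "\<dots> = (12 * lam) powr \<tau> * (\<Sum>(x, j)\<in>T. ((1/2) ^ j) powr \<tau>)"
      by (simp add: sum_distrib_left case_prod_unfold)
    also have "\<dots> \<le> (12 * lam) powr \<tau> * (A * K * (real (Suc l) * 2 powr (- (real l * \<eta>))))"
    proof (rule mult_left_mono)
      have "0 < h" by (simp add: h_def)
      have M: "M = K * 2 powr (real l * real (card I) - real l)"
        by (simp add: M_def powr_diff powr_realpow[symmetric] powr_powr)
      have h2: "h\<^sup>2 = 2 powr (2 * real l * a)"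
        by (simp add: h_def power2_eq_square powr_add[symmetric] mult_ac)
      have exps: "2 powr (l * s) * 2 powr (real l * real (card I) - real l) * 2 powr (l * (1 - \<tau>))
          = 2 powr (- (real l * \<eta>)) * 2 powr (2 * real l * a)"
        by (simp only: powr_add[symmetric]) (simp add: \<eta>_def algebra_simps)
      note T(3)
      also have "real (card (G l)) * (M * (real l + 1) * 2 powr (l * (1 - \<tau>)))
          \<le> (A * 2 powr (l * s)) * (M * (real l + 1) * 2 powr (l * (1 - \<tau>)))"
        using \<open>0 \<le> M\<close> by (intro mult_right_mono G(2)) auto
      also have "\<dots> = A * K * (real l + 1)
          * (2 powr (l * s) * 2 powr (real l * real (card I) - real l) * 2 powr (l * (1 - \<tau>)))"
        unfolding M by (simp only: mult_ac)
      also have "\<dots> = A * K * (real (Suc l) * 2 powr (- (real l * \<eta>))) * h\<^sup>2"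
        unfolding exps h2 by (simp add: mult_ac)
      finally show "(\<Sum>(x, j)\<in>T. ((1/2) ^ j) powr \<tau>) \<le> A * K * (real (Suc l) * 2 powr (- (real l * \<eta>)))"
        using \<open>0 < h\<close> by (subst (asm) mult_le_cancel_right) auto
    qed simp
    also have "\<dots> = C * (real (Suc l) * (2 powr (- \<eta>)) ^ l)"
      by (simp add: C_def powr_realpow[symmetric] powr_powr mult.commute mult.left_commute)
    finally have "covers l T" using \<open>finite T\<close> cover by (simp add: covers_def)
    then show ?thesis ..
  qed
  have "\<exists>T. \<forall>l. covers l (T l)" by (rule choice) (intro allI single)
  then obtain T where "\<forall>l. covers l (T l)" ..
  then have T: "finite (T l)" "E l \<subseteq> (\<Union>p\<in>T l. ball (fst p) (6 * lam * (1/2) ^ snd p))"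
    "(\<Sum>p\<in>T l. diam_powr \<tau> (ball (fst p) (6 * lam * (1/2) ^ snd p))) \<le> C * (real (Suc l) * (2 powr (- \<eta>)) ^ l)" for l
    by (simp_all only: covers_def)
  show ?thesis
  proof (rule hausdorff_content_limsup_eq_0[OF T(1) _ T(3)])
    show "bounded (ball (fst p) (6 * lam * (1/2) ^ snd p))" for p :: "((real ^ 'n) \<times> (real ^ 'n ^ 'n)) \<times> nat"
      by simp
    have "norm (2 powr (- \<eta>)) < 1" using \<open>\<eta> > 0\<close> by (simp add: powr_less_one)
    from geometric_deriv_sums[OF this] show "summable (\<lambda>l. C * (real (Suc l) * (2 powr (- \<eta>)) ^ l))"
      by (intro summable_mult) (auto dest: sums_summable)
    show "\<exists>\<^sub>\<infinity>l. \<exists>p\<in>T l. \<theta> \<in> ball (fst p) (6 * lam * (1/2) ^ snd p)" if "\<theta> \<in> ?E" for \<theta>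
    proof -
      have "\<exists>\<^sub>\<infinity>l. 2 powr (real l * a) \<le> real (card (c l \<theta>))"
        unfolding c_def by (rule infinitely_many_levels_with_many_cells[OF _ a' G(1)]) (use that G(3) in auto)
      then show ?thesis
      proof (rule INFM_mono)
        fix l assume "2 powr (real l * a) \<le> real (card (c l \<theta>))"
        then have "\<theta> \<in> E l" using that by (simp add: E_def)
        then show "\<exists>p\<in>T l. \<theta> \<in> ball (fst p) (6 * lam * (1/2) ^ snd p)"
          using T(2)[of l] by blast
      qed
    qed
  qed
qed

section \<open>Faces of rotated cubes\<close>

text \<open>
The affine hull of a face of the unit cube centred at the origin, of codimension \<open>card J\<close>.
\<close>

definition coordinate_flat :: "'n set \<Rightarrow> (real ^ 'n) set" where
  "coordinate_flat J = {y. \<forall>j\<in>J. y $ j = 1/2}"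

text \<open>
The face is cut out by the supporting hyperplane on which the coordinates in \<open>J\<close> have their maximal sum.
\<close>

lemma cube_face_facts:
  fixes J :: "'n::finite set"
  defines "Q \<equiv> cbox (\<chi> i. - 1/2) (\<chi> i. 1/2) :: (real ^ 'n) set"
  shows "(Q \<inter> coordinate_flat J) face_of Q" "affine hull (Q \<inter> coordinate_flat J) = coordinate_flat J"
    "aff_dim (coordinate_flat J) = int (CARD('n) - card J)"
proof -
  have mem: "y \<in> Q \<longleftrightarrow> (\<forall>i. - 1/2 \<le> y $ i \<and> y $ i \<le> 1/2)" for y
    by (simp add: Q_def mem_box_cart)
  define a :: "real ^ 'n" where "a = (\<chi> j. if j \<in> J then 1 else 0)"
  have inner: "a \<bullet> y = (\<Sum>j\<in>J. y $ j)" for y :: "real ^ 'n"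
    by (simp add: inner_vec_def a_def if_distrib[of "\<lambda>c. c * _"] sum.If_cases cong: if_cong)
  have le: "a \<bullet> y \<le> card J / 2" if "y \<in> Q" for y
  proof -
    have "(\<Sum>j\<in>J. y $ j) \<le> (\<Sum>j\<in>J. 1/2)" using that mem by (intro sum_mono) auto
    then show ?thesis by (simp add: inner)
  qed
  have "Q \<inter> coordinate_flat J = Q \<inter> {y. a \<bullet> y = card J / 2}"
  proof (intro set_eqI iffI)
    fix y assume "y \<in> Q \<inter> coordinate_flat J"
    then have "y \<in> Q" and y: "\<And>j. j \<in> J \<Longrightarrow> y $ j = 1/2" by (auto simp: coordinate_flat_def)
    from y have "(\<Sum>j\<in>J. y $ j) = (\<Sum>j\<in>J. 1/2)" by (rule sum.cong[OF refl])
    then show "y \<in> Q \<inter> {y. a \<bullet> y = card J / 2}" using \<open>y \<in> Q\<close> by (simp add: inner)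
  next
    fix y assume y: "y \<in> Q \<inter> {y. a \<bullet> y = card J / 2}"
    then have "(\<Sum>j\<in>J. 1/2 - y $ j) = 0" by (simp add: inner sum_subtractf)
    moreover have "0 \<le> 1/2 - y $ j" for j using y mem by auto
    ultimately have "\<forall>j\<in>J. 1/2 - y $ j = 0" by (subst (asm) sum_nonneg_eq_0_iff) auto
    then show "y \<in> Q \<inter> coordinate_flat J" using y by (simp add: coordinate_flat_def)
  qed
  moreover have "(Q \<inter> {y. a \<bullet> y = card J / 2}) face_of Q"
    using le by (intro face_of_Int_supporting_hyperplane_le) (simp_all add: Q_def)
  ultimately show "(Q \<inter> coordinate_flat J) face_of Q" by simp
  have aff: "affine (coordinate_flat J)"
    unfolding affine_def
  proof (intro ballI allI impI)
    fix y z :: "real ^ 'n" and u v :: real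
    assume yz: "y \<in> coordinate_flat J" "z \<in> coordinate_flat J" and uv: "u + v = 1"
    have "(u *\<^sub>R y + v *\<^sub>R z) $ j = 1/2" if "j \<in> J" for j
    proof -
      have "y $ j = 1/2" "z $ j = 1/2" using yz that by (simp_all add: coordinate_flat_def)
      then have "(u *\<^sub>R y + v *\<^sub>R z) $ j = u * (1/2) + v * (1/2)" by (simp only: vector_add_component vector_scaleR_component)  simp
      also have "\<dots> = (u + v) * (1/2)" by (rule distrib_right[symmetric])
      finally show ?thesis by (simp add: uv)
    qed
    then show "u *\<^sub>R y + v *\<^sub>R z \<in> coordinate_flat J" by (simp add: coordinate_flat_def)
  qed
  \<comment> \<open>An open box around a relative interior point of the face.\<close>
  define W :: "(real ^ 'n) set" where "W = box (\<chi> i. if i \<in> J then 0 else - 1/2) (\<chi> i. if i \<in> J then 1 else 1/2)"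
  have W: "coordinate_flat J \<inter> W \<subseteq> Q \<inter> coordinate_flat J"
  proof
    fix y assume y: "y \<in> coordinate_flat J \<inter> W"
    have "- 1/2 \<le> y $ i \<and> y $ i \<le> 1/2" for i
    proof (cases "i \<in> J")
      case True
      then have "y $ i = 1/2" using y by (simp add: coordinate_flat_def)
      then show ?thesis by simp
    next
      case False
      have "(if i \<in> J then 0 else - 1/2) < y $ i \<and> y $ i < (if i \<in> J then 1 else 1/2)"
      proof -
        have "y \<in> W" using y by simp
        then show ?thesis unfolding W_def mem_box_cart by (simp del: if_split)
      qed
      with False show ?thesis by simp
    qed
    then show "y \<in> Q \<inter> coordinate_flat J" using y mem by blast
  qed
  have "(\<chi> i. if i \<in> J then 1/2 else 0) \<in> coordinate_flat J \<inter> W"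
    by (simp add: coordinate_flat_def W_def mem_box_cart)
  then have "coordinate_flat J \<inter> W \<noteq> {}" by blast
  moreover have "open W" by (simp add: W_def open_box)
  ultimately have "affine hull (coordinate_flat J \<inter> W) = coordinate_flat J"
    by (simp add: affine_hull_affine_Int_open[OF aff] hull_same[of affine, OF aff])
  then have "coordinate_flat J \<subseteq> affine hull (Q \<inter> coordinate_flat J)"
    using hull_mono[OF W, of affine] by simp
  moreover have "affine hull (Q \<inter> coordinate_flat J) \<subseteq> coordinate_flat J"
    using aff by (intro hull_minimal) auto
  ultimately show "affine hull (Q \<inter> coordinate_flat J) = coordinate_flat J" by blast
  have trans: "coordinate_flat J = (+) (\<chi> i. 1/2) ` {y :: real ^ 'n. \<forall>i. i \<notin> - J \<longrightarrow> y $ i = 0}"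
  proof (intro set_eqI iffI)
    fix y :: "real ^ 'n" assume "y \<in> coordinate_flat J"
    then show "y \<in> (+) (\<chi> i. 1/2) ` {y. \<forall>i. i \<notin> - J \<longrightarrow> y $ i = 0}"
      by (intro image_eqI[of _ _ "y - (\<chi> i. 1/2)"]) (auto simp: coordinate_flat_def)
  qed (auto simp: coordinate_flat_def)
  have sub: "subspace {y :: real ^ 'n. \<forall>i. i \<notin> - J \<longrightarrow> y $ i = 0}"
    by (auto simp: subspace_def)
  have "aff_dim (coordinate_flat J) = int (dim {y :: real ^ 'n. \<forall>i. i \<notin> - J \<longrightarrow> y $ i = 0})"
    unfolding trans by (simp only: aff_dim_translation_eq aff_dim_subspace[OF sub])
  also have "dim {y :: real ^ 'n. \<forall>i. i \<notin> - J \<longrightarrow> y $ i = 0} = card (- J)"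
    using dim_substandard_cart[where 'a = real and d = "- J"] by (simp add: dim_vec_eq)
  finally show "aff_dim (coordinate_flat J) = int (CARD('n) - card J)"
    by (simp add: Compl_eq_Diff_UNIV card_Diff_subset)
qed

text \<open>
The distance on the right does not depend on the cube: a rotation maps the face of the standard cube
to a face of the rotated one, and it preserves the distance from the centre.
\<close>

lemma skeleton_contains_flat_piece:
  fixes Q :: "(real ^ 'n) set" and J :: "'n set"
  assumes Q: "rotated_unit_cube x Q" and k: "card J + k = CARD('n)"
  shows "\<exists>F. F \<subseteq> skeleton k Q \<and> convex F \<and> aff_dim F = int k
     \<and> infdist x (affine hull F) = infdist 0 (coordinate_flat J)"
proof -
  define Q0 :: "(real ^ 'n) set" where "Q0 = cbox (\<chi> i. - 1/2) (\<chi> i. 1/2)"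
  obtain T :: "real ^ 'n ^ 'n" where T: "rotation_matrix T" "Q = (\<lambda>y. x + T *v y) ` Q0"
    using Q unfolding rotated_unit_cube_def Q0_def by auto
  have "orthogonal_transformation ((*v) T)"
    using T(1) by (simp add: rotation_matrix_def orthogonal_transformation_matrix)
  then have lin: "linear ((*v) T)" and inj: "inj ((*v) T)" and iso: "\<And>y. norm (T *v y) = norm y"
    by (auto simp: orthogonal_transformation_linear orthogonal_transformation_inj orthogonal_transformation_norm)
  define g where "g = (\<lambda>y. x + T *v y)"
  have g: "g ` S = (+) x ` ((*v) T ` S)" for S by (simp add: g_def image_image)
  define F where "F = g ` (Q0 \<inter> coordinate_flat J)"
  note facts = cube_face_facts[of J, folded Q0_def]
  have face: "F face_of Q"
    unfolding F_def T(2) g_def[symmetric] unfolding g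
    by (simp only: face_of_translation_eq face_of_linear_image[OF lin inj] facts(1))
  have hull: "affine hull F = g ` coordinate_flat J"
    unfolding F_def g affine_hull_translation
    by (simp add: affine_hull_linear_image[symmetric] facts(2))
  have "aff_dim F = aff_dim (affine hull F)" by simp
  also have "\<dots> = int k"
    unfolding hull g aff_dim_translation_eq aff_dim_injective_linear_image[OF lin inj] facts(3)
    using k by simp
  finally have dim: "aff_dim F = int k" .
  have "dist x (g y) = dist 0 y" for y by (simp add: g_def dist_norm iso)
  then have "infdist x (g ` coordinate_flat J) = infdist 0 (coordinate_flat J)"
    by (simp add: infdist_def image_image)
  then have "infdist x (affine hull F) = infdist 0 (coordinate_flat J)" by (simp add: hull)
  moreover have "F \<subseteq> skeleton k Q" using face dim by (auto simp: skeleton_def)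
  moreover have "convex F" using face by (rule face_of_imp_convex) 
  ultimately show ?thesis using dim by blast
qed

section \<open>Hausdorff dimension of unions of pieces of planes\<close>

lemma hausdorff_dim_le:
  assumes "hausdorff_content s A = 0" "0 \<le> s"
  shows "hausdorff_dim A \<le> ereal s"
  unfolding hausdorff_dim_def
  using assms by (intro INF_lower) (simp add: hausdorff_measure_eq_0_iff)

lemma le_hausdorff_dimI:
  assumes "\<And>s. 0 \<le> s \<Longrightarrow> hausdorff_content s A = 0 \<Longrightarrow> t \<le> ereal s"
  shows "t \<le> hausdorff_dim A"
  unfolding hausdorff_dim_def
  using assms by (intro INF_greatest) (auto simp: hausdorff_measure_eq_0_iff)

lemma hausdorff_dim_mono:
  assumes "A \<subseteq> B"
  shows "hausdorff_dim A \<le> hausdorff_dim B"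
proof (rule le_hausdorff_dimI)
  fix s :: real assume "0 \<le> s" "hausdorff_content s B = 0"
  then show "hausdorff_dim A \<le> ereal s"
    using hausdorff_content_mono[OF assms, of s] by (intro hausdorff_dim_le) auto
qed

lemma convex_hausdorff_dim_ge:
  fixes S :: "(real ^ 'n) set"
  assumes "convex S" "aff_dim S = int d"
  shows "ereal (real d) \<le> hausdorff_dim S"
proof (rule le_hausdorff_dimI)
  fix s :: real assume s: "0 \<le> s" "hausdorff_content s S = 0"
  show "ereal (real d) \<le> ereal s"
  proof (rule ccontr)
    assume "\<not> ?thesis"
    then have "hausdorff_content (real d) S = 0"
      by (intro hausdorff_content_eq_0_mono[OF s(2,1)]) auto
    then show False using convex_hausdorff_content_neq_0[OF assms(1)] assms(2) by auto
  qed
qed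

lemma hausdorff_content_neq_0_of_dim:
  assumes "ereal \<alpha> \<le> hausdorff_dim A" "A \<noteq> {}" "0 \<le> a'" "a' < \<alpha> \<or> a' = 0"
  shows "hausdorff_content a' A \<noteq> 0"
proof
  assume null: "hausdorff_content a' A = 0"
  show False
  proof (cases "a' = 0")
    case True
    then show ?thesis using null assms(2) by (simp add: hausdorff_content_0_eq_0_iff)
  next
    case False
    have "ereal \<alpha> \<le> ereal a'"
      by (rule order.trans[OF assms(1) hausdorff_dim_le[OF null assms(3)]])
    then show ?thesis using False assms(4) by simp
  qed
qed

lemma exists_ball_hausdorff_content_neq_0:
  fixes A B :: "'a::real_normed_vector set"
  assumes "hausdorff_content s (A \<inter> B) \<noteq> 0"
  shows "\<exists>m::nat. hausdorff_content s (A \<inter> cball 0 (real m) \<inter> B) \<noteq> 0"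
proof (rule ccontr)
  assume "\<not> ?thesis"
  then have "hausdorff_content s (\<Union>m\<in>(UNIV::nat set). A \<inter> cball 0 (real m) \<inter> B) = 0"
    by (intro hausdorff_content_UN_eq_0) auto
  moreover have "A \<inter> B \<subseteq> (\<Union>m\<in>(UNIV::nat set). A \<inter> cball 0 (real m) \<inter> B)"
    using real_arch_simple by auto
  ultimately show False using assms hausdorff_content_mono by (metis le_zero_eq)
qed

text \<open>
Countably many pairs of a set of coordinates and a common bound for centres, parameters and slices
exhaust all centres; on each piece the two estimates are chained.
\<close>

lemma hausdorff_content_centres_eq_0:
  fixes B C :: "(real ^ 'n) set"
  assumes "k < CARD('n)" "0 \<le> r" and null: "hausdorff_content s B = 0" and "0 < s"
    and \<tau>: "0 < \<tau>" "\<tau> \<le> 1" and s: "s < 2 * a + \<tau> - real k" and a': "a < a'" "0 \<le> a'"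
    and C: "\<And>x. x \<in> C \<Longrightarrow> \<exists>P. affine_subspace_dim k P \<and> infdist x P = r \<and> hausdorff_content a' (P \<inter> B) \<noteq> 0"
  shows "hausdorff_content (\<tau> + (real CARD('n) - 1)) C = 0"
proof -
  define E where "E I m = {\<theta> \<in> graph_params I. norm \<theta> \<le> real m \<and>
      hausdorff_content a' (plane \<theta> \<inter> cball 0 (real m) \<inter> B) \<noteq> 0}" for I :: "'n set" and m :: nat
  define D where "D p = {x. norm x \<le> real (snd p) \<and> (\<exists>\<theta>\<in>E (fst p) (snd p). infdist x (plane \<theta>) = r)}" for p
  define J where "J = {I :: 'n set. card I = k} \<times> (UNIV :: nat set)"
  have "hausdorff_content (\<tau> + (real CARD('n) - 1)) (D p) = 0" if "p \<in> J" for p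
  proof -
    have I: "card (fst p) = k" using that by (auto simp: J_def)
    then have "fst p \<noteq> UNIV" using \<open>k < CARD('n)\<close> by auto
    moreover have "hausdorff_content \<tau> (E (fst p) (snd p)) = 0"
      unfolding E_def by (rule large_slice_params_null[OF null \<open>0 < s\<close> \<tau> _ a']) (use s I in auto)
    moreover have "E (fst p) (snd p) \<subseteq> graph_params (fst p)" by (auto simp: E_def)
    ultimately show ?thesis unfolding D_def
      using \<tau>(1) \<open>0 \<le> r\<close> by (intro hausdorff_content_points_at_distance) auto
  qed
  moreover have "countable J" unfolding J_def by (intro countable_SIGMA) (auto intro: countable_finite)
  ultimately have "hausdorff_content (\<tau> + (real CARD('n) - 1)) (\<Union>p\<in>J. D p) = 0"
    by (intro hausdorff_content_UN_eq_0)
  moreover have "C \<subseteq> (\<Union>p\<in>J. D p)"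
  proof
    fix x assume "x \<in> C"
    then obtain P where P: "affine_subspace_dim k P" "infdist x P = r" "hausdorff_content a' (P \<inter> B) \<noteq> 0"
      using C by blast
    obtain I \<theta> where I: "card I = k" and \<theta>: "\<theta> \<in> graph_params I" "P = plane \<theta>"
      using affine_subspace_is_plane[OF P(1)] by blast
    obtain m0 :: nat where m0: "hausdorff_content a' (P \<inter> cball 0 (real m0) \<inter> B) \<noteq> 0"
      using exists_ball_hausdorff_content_neq_0[OF P(3)] by blast
    obtain m1 :: nat where m1: "norm x + norm \<theta> \<le> real m1" using real_arch_simple by blast
    define m where "m = max m0 m1"
    have "P \<inter> cball 0 (real m0) \<inter> B \<subseteq> P \<inter> cball 0 (real m) \<inter> B" by (auto simp: m_def)
    then have "hausdorff_content a' (P \<inter> cball 0 (real m) \<inter> B) \<noteq> 0"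
      using m0 hausdorff_content_mono by (metis le_zero_eq)
    moreover have "real m1 \<le> real m" by (simp add: m_def)
    then have "norm \<theta> \<le> real m" "norm x \<le> real m"
      using m1 norm_ge_zero[of x] norm_ge_zero[of \<theta>] by linarith+
    ultimately have "\<theta> \<in> E I m" "norm x \<le> real m" using \<theta> by (simp_all add: E_def)
    then have "x \<in> D (I, m)" using \<theta>(2) P(2) unfolding D_def by auto
    then show "x \<in> (\<Union>p\<in>J. D p)" using I by (intro UN_I[of "(I, m)"]) (auto simp: J_def)
  qed
  ultimately show ?thesis using hausdorff_content_mono by (metis le_zero_eq)
qed

lemma hausdorff_dim_union_of_plane_pieces:
  fixes B C :: "(real ^ 'n) set"
  assumes k: "k < CARD('n)" and \<alpha>: "0 \<le> \<alpha>" "\<alpha> \<le> real k" and "0 \<le> r" and "C \<noteq> {}"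
    and P: "\<And>x. x \<in> C \<Longrightarrow> \<exists>P. affine_subspace_dim k P \<and> infdist x P = r \<and>
       P \<inter> B \<noteq> {} \<and> ereal \<alpha> \<le> hausdorff_dim (P \<inter> B)"
  shows "ereal (2 * \<alpha> - real k) + hausdorff_dim C - ereal (real CARD('n) - 1) \<le> hausdorff_dim B"
proof (rule le_hausdorff_dimI)
  fix s :: real assume "0 \<le> s" and null: "hausdorff_content s B = 0"
  define n where "n = real CARD('n)"
  obtain x P0 where P0: "P0 \<inter> B \<noteq> {}" "ereal \<alpha> \<le> hausdorff_dim (P0 \<inter> B)"
    using \<open>C \<noteq> {}\<close> P by blast
  have "s \<noteq> 0" using null P0(1) by (auto simp: hausdorff_content_0_eq_0_iff)
  then have "0 < s" using \<open>0 \<le> s\<close> by simp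
  have "hausdorff_dim (P0 \<inter> B) \<le> ereal s"
    using hausdorff_dim_mono[of "P0 \<inter> B" B] hausdorff_dim_le[OF null \<open>0 \<le> s\<close>] by auto
  with P0(2) have "ereal \<alpha> \<le> ereal s" by (rule order.trans)
  then have "\<alpha> \<le> s" by simp
  define t0 where "t0 = s - (2 * \<alpha> - real k) + (n - 1)"
  have "hausdorff_dim C \<le> ereal t" if "t0 < t" for t
  proof (cases "n < t")
    case True
    then have "hausdorff_content t (UNIV :: (real ^ 'n) set) = 0"
      unfolding n_def by (rule hausdorff_content_UNIV_eq_0)
    then have "hausdorff_dim (UNIV :: (real ^ 'n) set) \<le> ereal t"
      using True by (intro hausdorff_dim_le) (auto simp: n_def)
    then show ?thesis using hausdorff_dim_mono[of C UNIV] by auto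
  next
    case False
    \<comment> \<open>Spend a quarter of the slack \<open>t - t0\<close> on \<open>a < \<alpha>\<close>.  For \<open>\<alpha> = 0\<close> take \<open>a' = 0\<close>, where nonvanishing content
        means nonemptiness.\<close>
    define \<tau> where "\<tau> = t - (n - 1)"
    define \<epsilon> where "\<epsilon> = (t - t0) / 4"
    define a where "a = \<alpha> - \<epsilon>"
    define a' where "a' = (if \<alpha> = 0 then 0 else max 0 ((a + \<alpha>) / 2))"
    have "0 < \<epsilon>" using that by (simp add: \<epsilon>_def)
    then have "a < (a + \<alpha>) / 2" "(a + \<alpha>) / 2 < \<alpha>" "\<alpha> = 0 \<Longrightarrow> a < 0" by (simp_all add: a_def)
    then have a': "a < a'" "0 \<le> a'" "a' < \<alpha> \<or> a' = 0"
      by (auto simp: a'_def less_max_iff_disj max_def)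
    have \<tau>: "0 < \<tau>" "\<tau> \<le> 1"
      using that False \<open>\<alpha> \<le> s\<close> \<alpha>(2) by (auto simp: \<tau>_def t0_def)
    have s: "s < 2 * a + \<tau> - real k"
      using \<open>0 < \<epsilon>\<close> by (simp add: a_def \<tau>_def t0_def \<epsilon>_def field_simps)
    have "hausdorff_content (\<tau> + (real CARD('n) - 1)) C = 0"
    proof (rule hausdorff_content_centres_eq_0[OF k \<open>0 \<le> r\<close> null \<open>0 < s\<close> \<tau> s a'(1,2)])
      fix x assume "x \<in> C"
      then obtain P where P: "affine_subspace_dim k P" "infdist x P = r" "P \<inter> B \<noteq> {}"
        "ereal \<alpha> \<le> hausdorff_dim (P \<inter> B)" using P by blast
      have "hausdorff_content a' (P \<inter> B) \<noteq> 0"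
        by (rule hausdorff_content_neq_0_of_dim[OF P(4,3) a'(2,3)])
      then show "\<exists>P. affine_subspace_dim k P \<and> infdist x P = r \<and> hausdorff_content a' (P \<inter> B) \<noteq> 0"
        using P by blast
    qed
    then have "hausdorff_content t C = 0" by (simp add: \<tau>_def n_def)
    moreover have "1 \<le> n" by (simp add: n_def Suc_leI)
    then have "0 \<le> t" using \<tau>(1) by (simp add: \<tau>_def)
    ultimately show ?thesis by (intro hausdorff_dim_le)
  qed
  note dim_C_le = this
  have "hausdorff_dim C \<le> ereal t0"
  proof (rule ccontr)
    assume "\<not> ?thesis"
    then have "ereal t0 < hausdorff_dim C" by simp
    then obtain t where "ereal t0 < ereal t" "ereal t < hausdorff_dim C"
      using ereal_dense2 by blast
    with dim_C_le[of t] show False by simp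
  qed
  then have "ereal (2 * \<alpha> - real k) + hausdorff_dim C - ereal (n - 1) \<le> ereal (2 * \<alpha> - real k) + ereal t0 - ereal (n - 1)"
    by (intro ereal_minus_mono add_left_mono) auto
  also have "\<dots> = ereal s" by (simp add: t0_def)
  finally show "ereal (2 * \<alpha> - real k) + hausdorff_dim C - ereal (real CARD('n) - 1) \<le> ereal s"
    by (simp add: n_def)
qed

lemma hausdorff_dim_union_of_full_planes:
  fixes B :: "(real ^ 'n) set"
  assumes k: "k < CARD('n)" and "0 \<le> r"
    and P: "\<And>x. \<exists>P. affine_subspace_dim k P \<and> infdist x P = r \<and> (\<exists>F. F \<subseteq> P \<inter> B \<and> convex F \<and> aff_dim F = int k)"
  shows "ereal (real k + 1) \<le> hausdorff_dim B"
proof -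
  have "ereal (2 * real k - real k) + hausdorff_dim (UNIV :: (real ^ 'n) set) - ereal (real CARD('n) - 1) \<le> hausdorff_dim B"
  proof (rule hausdorff_dim_union_of_plane_pieces[OF k _ _ \<open>0 \<le> r\<close>])
    fix x :: "real ^ 'n"
    obtain P F where *: "affine_subspace_dim k P" "infdist x P = r" "F \<subseteq> P \<inter> B" "convex F" "aff_dim F = int k"
      using P by blast
    have "F \<noteq> {}" using *(5) by auto
    moreover have "ereal (real k) \<le> hausdorff_dim (P \<inter> B)"
      using convex_hausdorff_dim_ge[OF *(4,5)] hausdorff_dim_mono[OF *(3)] by (rule order.trans)
    ultimately show "\<exists>P. affine_subspace_dim k P \<and> infdist x P = r \<and> P \<inter> B \<noteq> {} \<and> ereal (real k) \<le> hausdorff_dim (P \<inter> B)"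
      using * by blast
  qed auto
  moreover have "ereal (real CARD('n)) \<le> hausdorff_dim (UNIV :: (real ^ 'n) set)"
    by (rule convex_hausdorff_dim_ge) auto
  then have "ereal (2 * real k - real k) + ereal (real CARD('n)) - ereal (real CARD('n) - 1)
      \<le> ereal (2 * real k - real k) + hausdorff_dim (UNIV :: (real ^ 'n) set) - ereal (real CARD('n) - 1)"
    by (intro ereal_minus_mono add_left_mono) auto
  ultimately show ?thesis by simp
qed

theorem theorem2p6:
  fixes k :: nat
  assumes "k < CARD('n::finite)"
  shows
    "(\<forall>(\<alpha>::real) (r::real) (C :: (real ^ 'n) set) (B :: (real ^ 'n) set).
        0 \<le> \<alpha> \<longrightarrow> \<alpha> \<le> real k \<longrightarrow> 0 \<le> r \<longrightarrow> C \<noteq> {} \<longrightarrow>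
        (\<forall>x\<in>C. \<exists>P. affine_subspace_dim k P \<and> infdist x P = r \<and>
                  P \<inter> B \<noteq> {} \<and> hausdorff_dim (P \<inter> B) \<ge> ereal \<alpha>) \<longrightarrow>
        hausdorff_dim B \<ge> ereal (2 * \<alpha> - real k) + hausdorff_dim C - ereal (real CARD('n) - 1))
     \<and>
     (\<forall>B :: (real ^ 'n) set.
        (\<exists>r>0. \<forall>x. \<exists>P. affine_subspace_dim k P \<and> infdist x P = r \<and> P \<subseteq> B) \<or>
        (\<forall>x. \<exists>Q. rotated_unit_cube x Q \<and> skeleton k Q \<subseteq> B) \<longrightarrow>
        hausdorff_dim B \<ge> ereal (real k + 1))"
proof (intro conjI allI impI)
  fix \<alpha> r :: real and C B :: "(real ^ 'n) set"
  assume "0 \<le> \<alpha>" "\<alpha> \<le> real k" "0 \<le> r" "C \<noteq> {}"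
    "\<forall>x\<in>C. \<exists>P. affine_subspace_dim k P \<and> infdist x P = r \<and> P \<inter> B \<noteq> {} \<and> hausdorff_dim (P \<inter> B) \<ge> ereal \<alpha>"
  note hyps = this
  show "hausdorff_dim B \<ge> ereal (2 * \<alpha> - real k) + hausdorff_dim C - ereal (real CARD('n) - 1)"
    by (rule hausdorff_dim_union_of_plane_pieces[OF assms hyps(1-4) hyps(5)[rule_format]])
next
  fix B :: "(real ^ 'n) set"
  assume "(\<exists>r>0. \<forall>x. \<exists>P. affine_subspace_dim k P \<and> infdist x P = r \<and> P \<subseteq> B) \<or>
        (\<forall>x. \<exists>Q. rotated_unit_cube x Q \<and> skeleton k Q \<subseteq> B)"
  then show "hausdorff_dim B \<ge> ereal (real k + 1)"
  proof
    assume "\<exists>r>0. \<forall>x. \<exists>P. affine_subspace_dim k P \<and> infdist x P = r \<and> P \<subseteq> B"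
    then obtain r where "0 < r" and r: "\<And>x. \<exists>P. affine_subspace_dim k P \<and> infdist x P = r \<and> P \<subseteq> B"
      by blast
    show ?thesis
    proof (rule hausdorff_dim_union_of_full_planes[OF assms less_imp_le[OF \<open>0 < r\<close>]])
      fix x
      obtain P where P: "affine_subspace_dim k P" "infdist x P = r" "P \<subseteq> B" using r by blast
      then have "P \<subseteq> P \<inter> B" "convex P" "aff_dim P = int k"
        by (auto simp: affine_subspace_dim_def affine_imp_convex)
      with P show "\<exists>P. affine_subspace_dim k P \<and> infdist x P = r \<and> (\<exists>F. F \<subseteq> P \<inter> B \<and> convex F \<and> aff_dim F = int k)"
        by blast
    qed
  next
    assume cubes: "\<forall>x. \<exists>Q. rotated_unit_cube x Q \<and> skeleton k Q \<subseteq> B"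
    obtain J :: "'n set" where J: "card J = CARD('n) - k"
      using obtain_subset_with_card_n[of "CARD('n) - k" "UNIV :: 'n set"] by auto
    show ?thesis
    proof (rule hausdorff_dim_union_of_full_planes[OF assms infdist_nonneg])
      fix x
      obtain Q where Q: "rotated_unit_cube x Q" "skeleton k Q \<subseteq> B" using cubes by blast
      obtain F where F: "F \<subseteq> skeleton k Q" "convex F" "aff_dim F = int k"
        "infdist x (affine hull F) = infdist 0 (coordinate_flat J)"
        using skeleton_contains_flat_piece[OF Q(1), of J k] J assms by auto
      have "F \<subseteq> affine hull F \<inter> B" using F(1) Q(2) hull_subset[of F affine] by blast
      moreover have "affine_subspace_dim k (affine hull F)"
        using F(3) by (simp add: affine_subspace_dim_def)
      ultimately show "\<exists>P. affine_subspace_dim k P \<and> infdist x P = infdist 0 (coordinate_flat J) \<and>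
          (\<exists>F. F \<subseteq> P \<inter> B \<and> convex F \<and> aff_dim F = int k)"
        using F by blast
    qed
  qed
qed

end
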